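(* Let $A$ be a complete real lmc $*$-algebra. Then $A$ is a real locally C*-algebra if and only if $A$ contains a $*$-subalgebra $B$ such that: 1. $B$ is a real C*-algebra with some norm $\|\cdot\|_B$; and 2. the inclusion $(B,\|\cdot\|_B)\to A$ is a continuous embedding (i.e. it is continuous and injective) with dense range. Further, if $B\subseteq A$ is a $*$-subalgebra satisfying 1 and 2 and the unit ball $B_{\mathbf 1}=\{x\in B:\|x\|_B\le 1\}$ is closed in $A$ in the projective topology of $A$, then $B=A_b$, where $A_b$ denotes the bounded part of $A$.
   Context: All algebras are associative and are assumed unital. A real C*-algebra is a real Banach $*$-algebra whose norm is regular, i.e. $\|x^*x\|=\|x\|^2$ for all $x$, and whose complexification is a complex C*-algebra (for a norm extending the given one). Projective limits: let $\Lambda$ be an upward directed set, $(E_\alpha)_{\alpha\in\Lambda}$ a family of real topological $*$-algebras with locally convex Hausdorff topologies, and for $\alpha\le\beta$ let $g_\alpha^\beta:E_\beta\to E_\alpha$ be continuous $*$-homomorphisms with $g_\alpha^\alpha=\mathrm{Id}$ and $g_\alpha^\gamma=g_\alpha^\beta\circ g_\beta^\gamma$ for $\alpha\le\beta\le\gamma$ (a projective family). The projective limit $\varprojlim E_\alpha$ is the $*$-subalgebra of $\prod_\alpha E_\alpha$ of all $(x_\alpha)$ with $x_\alpha=g_\alpha^\beta(x_\beta)$ for all $\alpha\le\beta$, with the projective topology, i.e. the topology induced by the restrictions of the coordinate projections. A complete real lmc $*$-algebra is a topological $*$-algebra over $\mathbb{R}$ that is a projective limit of a projective family of real Banach $*$-algebras;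 its topology is called its projective topology. A real locally C*-algebra is a topological $*$-algebra that is a projective limit of a projective family of real C*-algebras; its topology is then defined by a saturated family $\Gamma(A)$ of continuous submultiplicative seminorms $p$ that are regular, i.e. $p(x^*x)=p(x)^2$ for all $x$ (saturated means closed under taking maxima of finite subfamilies). The bounded part of a real locally C*-algebra $A$ is $A_b=\{x\in A:\ \|x\|_\infty=\sup_{p\in\Gamma(A)}p(x)<\infty\}$. *)

theory Defs
  imports "HOL-Analysis.Analysis" "HOL-Algebra.Module"
begin

section \<open>Unital *-algebras on explicit carriers\<close>

text \<open>
  Algebras are records with explicit carriers, because projective families of algebras have to be
  quantified over. Scalars are an ordinary type \<open>'k\<close> together with its conjugation \<open>cj\<close>, so
  that the real case (\<open>cj\<close> the identity) and the complex case (\<open>cj = cnj\<close>) are treated at once.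
  The zero algebra is not excluded.
\<close>

record ('k, 'a) star_alg = "('k, 'a) module" +
  star :: "'a \<Rightarrow> 'a"

locale star_algebra = ring A
  for cj :: "'k::real_normed_field \<Rightarrow> 'k" and A :: "('k, 'a) star_alg" (structure) +
  assumes smult_closed: "x \<in> carrier A \<Longrightarrow> k \<odot> x \<in> carrier A"
    and smult_l_distr: "x \<in> carrier A \<Longrightarrow> (k + l) \<odot> x = (k \<odot> x) \<oplus> (l \<odot> x)"
    and smult_r_distr: "\<lbrakk>x \<in> carrier A; y \<in> carrier A\<rbrakk> \<Longrightarrow> k \<odot> (x \<oplus> y) = (k \<odot> x) \<oplus> (k \<odot> y)"
    and smult_assoc: "x \<in> carrier A \<Longrightarrow> (k * l) \<odot> x = k \<odot> (l \<odot> x)"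
    and smult_one: "x \<in> carrier A \<Longrightarrow> 1 \<odot> x = x"
    and smult_mult_left: "\<lbrakk>x \<in> carrier A; y \<in> carrier A\<rbrakk> \<Longrightarrow> (k \<odot> x) \<otimes> y = k \<odot> (x \<otimes> y)"
    and smult_mult_right: "\<lbrakk>x \<in> carrier A; y \<in> carrier A\<rbrakk> \<Longrightarrow> x \<otimes> (k \<odot> y) = k \<odot> (x \<otimes> y)"
    and star_closed: "x \<in> carrier A \<Longrightarrow> star A x \<in> carrier A"
    and star_star: "x \<in> carrier A \<Longrightarrow> star A (star A x) = x"
    and star_add: "\<lbrakk>x \<in> carrier A; y \<in> carrier A\<rbrakk> \<Longrightarrow> star A (x \<oplus> y) = star A x \<oplus> star A y"
    and star_mult: "\<lbrakk>x \<in> carrier A; y \<in> carrier A\<rbrakk> \<Longrightarrow> star A (x \<otimes> y) = star A y \<otimes> star A x"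
    and star_smult: "x \<in> carrier A \<Longrightarrow> star A (k \<odot> x) = cj k \<odot> star A x"

abbreviation real_star_algebra :: "(real, 'a) star_alg \<Rightarrow> bool"
  where "real_star_algebra \<equiv> star_algebra (\<lambda>t. t)"

definition star_hom :: "('k, 'a) star_alg \<Rightarrow> ('k, 'b) star_alg \<Rightarrow> ('a \<Rightarrow> 'b) set"
  where "star_hom A B = {h \<in> ring_hom A B.
    (\<forall>k. \<forall>x\<in>carrier A. h (k \<odot>\<^bsub>A\<^esub> x) = k \<odot>\<^bsub>B\<^esub> h x) \<and>
    (\<forall>x\<in>carrier A. h (star A x) = star B (h x))}"

definition star_subalgebra :: "'a set \<Rightarrow> ('k, 'a) star_alg \<Rightarrow> bool"
  where "star_subalgebra B A \<longleftrightarrow> B \<subseteq> carrier A \<and> \<one>\<^bsub>A\<^esub> \<in> B \<and>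
    (\<forall>x\<in>B. \<forall>y\<in>B. x \<oplus>\<^bsub>A\<^esub> y \<in> B \<and> x \<otimes>\<^bsub>A\<^esub> y \<in> B) \<and>
    (\<forall>x\<in>B. (\<forall>k. k \<odot>\<^bsub>A\<^esub> x \<in> B) \<and> star A x \<in> B)"


section \<open>Banach *-algebras and C*-algebras\<close>

text \<open>The distance is cut off outside the carrier because \<open>Metric_space\<close> requires
  non-negativity and symmetry on the whole type.\<close>

definition norm_dist :: "('k, 'a) star_alg \<Rightarrow> ('a \<Rightarrow> real) \<Rightarrow> 'a \<Rightarrow> 'a \<Rightarrow> real"
  where "norm_dist A nrm x y =
    (if x \<in> carrier A \<and> y \<in> carrier A then nrm (x \<ominus>\<^bsub>A\<^esub> y) else 0)"

definition norm_topology :: "('k, 'a) star_alg \<Rightarrow> ('a \<Rightarrow> real) \<Rightarrow> 'a topology"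
  where "norm_topology A nrm = Metric_space.mtopology (carrier A) (norm_dist A nrm)"

text \<open>The involution is only required to be bounded; in C*-algebras it is then isometric. The
  norm of the unit is not normalised.\<close>

locale banach_star_algebra = star_algebra cj A
  for cj :: "'k::real_normed_field \<Rightarrow> 'k" and A :: "('k, 'a) star_alg" (structure) +
  fixes nrm :: "'a \<Rightarrow> real"
  assumes nrm_nonneg: "x \<in> carrier A \<Longrightarrow> 0 \<le> nrm x"
    and nrm_eq_zero: "x \<in> carrier A \<Longrightarrow> nrm x = 0 \<longleftrightarrow> x = \<zero>"
    and nrm_triangle: "\<lbrakk>x \<in> carrier A; y \<in> carrier A\<rbrakk> \<Longrightarrow> nrm (x \<oplus> y) \<le> nrm x + nrm y"
    and nrm_smult: "x \<in> carrier A \<Longrightarrow> nrm (k \<odot> x) = norm k * nrm x"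
    and nrm_mult: "\<lbrakk>x \<in> carrier A; y \<in> carrier A\<rbrakk> \<Longrightarrow> nrm (x \<otimes> y) \<le> nrm x * nrm y"
    and star_bounded: "\<exists>C. \<forall>x\<in>carrier A. nrm (star A x) \<le> C * nrm x"
    and complete: "Metric_space.mcomplete (carrier A) (norm_dist A nrm)"

abbreviation real_banach_star_algebra :: "(real, 'a) star_alg \<Rightarrow> ('a \<Rightarrow> real) \<Rightarrow> bool"
  where "real_banach_star_algebra \<equiv> banach_star_algebra (\<lambda>t. t)"

definition regular_on :: "('k, 'a) star_alg \<Rightarrow> ('a \<Rightarrow> real) \<Rightarrow> bool"
  where "regular_on A p \<longleftrightarrow> (\<forall>x\<in>carrier A. p (star A x \<otimes>\<^bsub>A\<^esub> x) = (p x)\<^sup>2)"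

definition complex_Cstar_algebra :: "(complex, 'a) star_alg \<Rightarrow> ('a \<Rightarrow> real) \<Rightarrow> bool"
  where "complex_Cstar_algebra A nrm \<longleftrightarrow> banach_star_algebra cnj A nrm \<and> regular_on A nrm"

text \<open>In the complexification the pair \<open>(x, y)\<close> stands for \<open>x + \<i> y\<close>.\<close>

definition complexification :: "(real, 'a) star_alg \<Rightarrow> (complex, 'a \<times> 'a) star_alg"
  where "complexification A =
    \<lparr>carrier = carrier A \<times> carrier A,
     mult = (\<lambda>(x, y) (u, v).
       ((x \<otimes>\<^bsub>A\<^esub> u) \<ominus>\<^bsub>A\<^esub> (y \<otimes>\<^bsub>A\<^esub> v), (x \<otimes>\<^bsub>A\<^esub> v) \<oplus>\<^bsub>A\<^esub> (y \<otimes>\<^bsub>A\<^esub> u))),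
     one = (\<one>\<^bsub>A\<^esub>, \<zero>\<^bsub>A\<^esub>),
     zero = (\<zero>\<^bsub>A\<^esub>, \<zero>\<^bsub>A\<^esub>),
     add = (\<lambda>(x, y) (u, v). (x \<oplus>\<^bsub>A\<^esub> u, y \<oplus>\<^bsub>A\<^esub> v)),
     smult = (\<lambda>k (x, y).
       ((Re k \<odot>\<^bsub>A\<^esub> x) \<ominus>\<^bsub>A\<^esub> (Im k \<odot>\<^bsub>A\<^esub> y), (Re k \<odot>\<^bsub>A\<^esub> y) \<oplus>\<^bsub>A\<^esub> (Im k \<odot>\<^bsub>A\<^esub> x))),
     star = (\<lambda>(x, y). (star A x, \<ominus>\<^bsub>A\<^esub> star A y))\<rparr>"

definition real_Cstar_algebra :: "(real, 'a) star_alg \<Rightarrow> ('a \<Rightarrow> real) \<Rightarrow> bool"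
  where "real_Cstar_algebra A nrm \<longleftrightarrow> real_banach_star_algebra A nrm \<and> regular_on A nrm \<and>
    (\<exists>N. complex_Cstar_algebra (complexification A) N \<and>
         (\<forall>x\<in>carrier A. N (x, \<zero>\<^bsub>A\<^esub>) = nrm x))"


section \<open>Topological *-algebras and projective limits\<close>

definition real_topological_star_algebra :: "(real, 'a) star_alg \<Rightarrow> 'a topology \<Rightarrow> bool"
  where "real_topological_star_algebra A T \<longleftrightarrow> real_star_algebra A \<and> topspace T = carrier A \<and>
    continuous_map (prod_topology T T) T (\<lambda>(x, y). x \<oplus>\<^bsub>A\<^esub> y) \<and>
    continuous_map (prod_topology T T) T (\<lambda>(x, y). x \<otimes>\<^bsub>A\<^esub> y) \<and>
    continuous_map (prod_topology euclidean T) T (\<lambda>(k, x). k \<odot>\<^bsub>A\<^esub> x) \<and>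
    continuous_map T T (star A)"

definition locally_convex :: "(real, 'a) star_alg \<Rightarrow> 'a topology \<Rightarrow> bool"
  where "locally_convex A T \<longleftrightarrow>
    (\<forall>U. openin T U \<and> \<zero>\<^bsub>A\<^esub> \<in> U \<longrightarrow>
      (\<exists>V. openin T V \<and> \<zero>\<^bsub>A\<^esub> \<in> V \<and> V \<subseteq> U \<and>
        (\<forall>x\<in>V. \<forall>y\<in>V. \<forall>t\<in>{0..1}. (t \<odot>\<^bsub>A\<^esub> x) \<oplus>\<^bsub>A\<^esub> ((1 - t) \<odot>\<^bsub>A\<^esub> y) \<in> V)))"

definition upward_directed :: "'i set \<Rightarrow> ('i \<Rightarrow> 'i \<Rightarrow> bool) \<Rightarrow> bool"
  where "upward_directed I below \<longleftrightarrow> I \<noteq> {} \<and> reflp_on I below \<and> transp_on I below \<and>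
    (\<forall>i\<in>I. \<forall>j\<in>I. \<exists>k\<in>I. below i k \<and> below j k)"

text \<open>The map \<open>g i j\<close> goes from \<open>E j\<close> to \<open>E i\<close>, for \<open>i\<close> below \<open>j\<close>.\<close>

locale projective_family =
  fixes I :: "'i set" and below :: "'i \<Rightarrow> 'i \<Rightarrow> bool"
    and E :: "'i \<Rightarrow> (real, 'e) star_alg" and S :: "'i \<Rightarrow> 'e topology"
    and g :: "'i \<Rightarrow> 'i \<Rightarrow> 'e \<Rightarrow> 'e"
  assumes directed: "upward_directed I below"
    and algebras: "i \<in> I \<Longrightarrow> real_topological_star_algebra (E i) (S i)"
    and lc: "i \<in> I \<Longrightarrow> locally_convex (E i) (S i)"
    and hausdorff: "i \<in> I \<Longrightarrow> Hausdorff_space (S i)"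
    and hom: "\<lbrakk>i \<in> I; j \<in> I; below i j\<rbrakk> \<Longrightarrow> g i j \<in> star_hom (E j) (E i)"
    and cont: "\<lbrakk>i \<in> I; j \<in> I; below i j\<rbrakk> \<Longrightarrow> continuous_map (S j) (S i) (g i j)"
    and ident: "\<lbrakk>i \<in> I; x \<in> carrier (E i)\<rbrakk> \<Longrightarrow> g i i x = x"
    and compose: "\<lbrakk>i \<in> I; j \<in> I; k \<in> I; below i j; below j k; x \<in> carrier (E k)\<rbrakk>
      \<Longrightarrow> g i k x = g i j (g j k x)"

definition projective_limit ::
  "'i set \<Rightarrow> ('i \<Rightarrow> 'i \<Rightarrow> bool) \<Rightarrow> ('i \<Rightarrow> (real, 'e) star_alg) \<Rightarrow> ('i \<Rightarrow> 'i \<Rightarrow> 'e \<Rightarrow> 'e)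
    \<Rightarrow> (real, 'i \<Rightarrow> 'e) star_alg"
  where "projective_limit I below E g =
    \<lparr>carrier = {x \<in> (\<Pi>\<^sub>E i\<in>I. carrier (E i)). \<forall>i\<in>I. \<forall>j\<in>I. below i j \<longrightarrow> x i = g i j (x j)},
     mult = (\<lambda>x y. \<lambda>i\<in>I. x i \<otimes>\<^bsub>E i\<^esub> y i),
     one = (\<lambda>i\<in>I. \<one>\<^bsub>E i\<^esub>),
     zero = (\<lambda>i\<in>I. \<zero>\<^bsub>E i\<^esub>),
     add = (\<lambda>x y. \<lambda>i\<in>I. x i \<oplus>\<^bsub>E i\<^esub> y i),
     smult = (\<lambda>k x. \<lambda>i\<in>I. k \<odot>\<^bsub>E i\<^esub> x i),
     star = (\<lambda>x. \<lambda>i\<in>I. star (E i) (x i))\<rparr>"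

definition projective_limit_topology ::
  "'i set \<Rightarrow> ('i \<Rightarrow> 'i \<Rightarrow> bool) \<Rightarrow> ('i \<Rightarrow> (real, 'e) star_alg) \<Rightarrow> ('i \<Rightarrow> 'e topology)
    \<Rightarrow> ('i \<Rightarrow> 'i \<Rightarrow> 'e \<Rightarrow> 'e) \<Rightarrow> ('i \<Rightarrow> 'e) topology"
  where "projective_limit_topology I below E S g =
    subtopology (product_topology S I) (carrier (projective_limit I below E g))"

definition top_star_isomorphic ::
  "(real, 'a) star_alg \<Rightarrow> 'a topology \<Rightarrow> (real, 'b) star_alg \<Rightarrow> 'b topology \<Rightarrow> bool"
  where "top_star_isomorphic A T B S \<longleftrightarrow> (\<exists>h \<in> star_hom A B. homeomorphic_map T S h)"

text \<open>
  HOL cannot quantify existentially over types, so the types of the indices and of the elements of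
  the factor algebras are explicit parameters of the next two notions. A locally C*-algebra on the
  type \<open>'a\<close> is the limit of its quotients by kernels of seminorms, so that the index type
  \<open>'a \<Rightarrow> real\<close> and the element type \<open>'a set\<close> suffice.
\<close>

definition complete_real_lmc_star_algebra ::
  "'i itself \<Rightarrow> 'e itself \<Rightarrow> (real, 'a) star_alg \<Rightarrow> 'a topology \<Rightarrow> bool"
  where "complete_real_lmc_star_algebra _ _ A T \<longleftrightarrow> real_topological_star_algebra A T \<and>
    (\<exists>(I :: 'i set) below (E :: 'i \<Rightarrow> (real, 'e) star_alg) nrm g.
      (\<forall>i\<in>I. real_banach_star_algebra (E i) (nrm i)) \<and>
      projective_family I below E (\<lambda>i. norm_topology (E i) (nrm i)) g \<and>
      top_star_isomorphic A T (projective_limit I below E g)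
        (projective_limit_topology I below E (\<lambda>i. norm_topology (E i) (nrm i)) g))"

definition real_locally_Cstar_algebra ::
  "'i itself \<Rightarrow> 'e itself \<Rightarrow> (real, 'a) star_alg \<Rightarrow> 'a topology \<Rightarrow> bool"
  where "real_locally_Cstar_algebra _ _ A T \<longleftrightarrow> real_topological_star_algebra A T \<and>
    (\<exists>(I :: 'i set) below (E :: 'i \<Rightarrow> (real, 'e) star_alg) nrm g.
      (\<forall>i\<in>I. real_Cstar_algebra (E i) (nrm i)) \<and>
      projective_family I below E (\<lambda>i. norm_topology (E i) (nrm i)) g \<and>
      top_star_isomorphic A T (projective_limit I below E g)
        (projective_limit_topology I below E (\<lambda>i. norm_topology (E i) (nrm i)) g))"


section \<open>Regular seminorms and the bounded part\<close>

definition submultiplicative_seminorm :: "(real, 'a) star_alg \<Rightarrow> ('a \<Rightarrow> real) \<Rightarrow> bool"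
  where "submultiplicative_seminorm A p \<longleftrightarrow>
    (\<forall>x\<in>carrier A. 0 \<le> p x \<and> (\<forall>k. p (k \<odot>\<^bsub>A\<^esub> x) = \<bar>k\<bar> * p x)) \<and>
    (\<forall>x\<in>carrier A. \<forall>y\<in>carrier A. p (x \<oplus>\<^bsub>A\<^esub> y) \<le> p x + p y \<and> p (x \<otimes>\<^bsub>A\<^esub> y) \<le> p x * p y)"

text \<open>Seminorms are total functions, so closure under finite maxima is required only up to the
  irrelevant values outside the carrier.\<close>

definition saturated :: "'a set \<Rightarrow> ('a \<Rightarrow> real) set \<Rightarrow> bool"
  where "saturated X \<Gamma> \<longleftrightarrow>
    (\<forall>F. finite F \<and> F \<noteq> {} \<and> F \<subseteq> \<Gamma> \<longrightarrow> (\<exists>q\<in>\<Gamma>. \<forall>x\<in>X. q x = (MAX p\<in>F. p x)))"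

definition defining_regular_seminorms ::
  "(real, 'a) star_alg \<Rightarrow> 'a topology \<Rightarrow> ('a \<Rightarrow> real) set \<Rightarrow> bool"
  where "defining_regular_seminorms A T \<Gamma> \<longleftrightarrow>
    (\<forall>p\<in>\<Gamma>. submultiplicative_seminorm A p \<and> regular_on A p \<and>
      continuous_map T euclideanreal p) \<and>
    saturated (carrier A) \<Gamma> \<and>
    T = topology_generated_by
      {{y \<in> carrier A. p (y \<ominus>\<^bsub>A\<^esub> x) < e} | p x e. p \<in> \<Gamma> \<and> x \<in> carrier A \<and> 0 < e}"

definition bounded_part :: "(real, 'a) star_alg \<Rightarrow> ('a \<Rightarrow> real) set \<Rightarrow> 'a set"
  where "bounded_part A \<Gamma> = {x \<in> carrier A. (SUP p\<in>\<Gamma>. ereal (p x)) < \<infinity>}"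


section \<open>Densely embedded C*-algebras\<close>

definition dense_Cstar_subalgebra ::
  "(real, 'a) star_alg \<Rightarrow> 'a topology \<Rightarrow> 'a set \<Rightarrow> ('a \<Rightarrow> real) \<Rightarrow> bool"
  where "dense_Cstar_subalgebra A T B nrm \<longleftrightarrow> star_subalgebra B A \<and>
    real_Cstar_algebra (A\<lparr>carrier := B\<rparr>) nrm \<and>
    continuous_map (norm_topology (A\<lparr>carrier := B\<rparr>) nrm) T (\<lambda>x. x) \<and>
    inj_on (\<lambda>x. x) B \<and>
    T closure_of ((\<lambda>x. x) ` B) = topspace T"

end

theory Submission
  imports Defs
begin

text \<open>
  The proof avoids spectral theory and functional calculus. It rests on two facts about a complete
  C*-norm \<open>N\<close> on a complex *-algebra.

  First, for a selfadjoint \<open>h\<close> the element \<open>1 + h\<^sup>2\<close> is invertible and its inverse has norm at most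
  1. Indeed, if the resolvent \<open>u = (h + is)\<^sup>-\<^sup>1\<close> exists for some \<open>s > 0\<close>, then
  \<open>u* - u = 2is u*u\<close>, so that the C*-identity gives \<open>2s N(u)\<^sup>2 \<le> 2 N(u)\<close>, that is \<open>N(u) \<le> 1/s\<close>. For large
  \<open>s\<close> the resolvent exists by the Neumann series, and with this bound a second Neumann series reaches
  every point of \<open>(0, s)\<close>. The inverses \<open>(1 + h\<^sup>2)\<^sup>-\<^sup>1\<close> play the role of cut-off functions.

  Second, let \<open>p\<close> be a submultiplicative seminorm with \<open>p \<le> K N\<close> and \<open>p(x*) \<le> D p(x)\<close>, and let
  \<open>h = x*x\<close>. If \<open>p(h\<^sup>n)\<close> tends to 0, then \<open>y = x (1 + h\<^sup>n)\<^sup>-\<^sup>1\<close> is close to \<open>x\<close> for \<open>p\<close>, while the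
  C*-identity, iterated, gives \<open>N(y)\<^sup>2\<^sup>n \<le> 2\<close>. After a correction by a convergent series, \<open>x\<close> has
  representatives modulo the kernel of \<open>p\<close> of norm arbitrarily close to 1. Rescaled, this yields
  both that the quotient norm modulo \<open>ker p\<close> is at most \<open>sqrt D \<cdot> p\<close>, hence equivalent to \<open>p\<close>, and that
  the quotient norm is again a C*-norm (\<open>representative_of_small_seminorm\<close>,
  \<open>representative_of_small_square\<close>, \<open>quotient_Cstar\<close>). Real C*-algebras are treated through their
  complexifications, with a C*-norm chosen invariant under complex conjugation
  (\<open>real_Cstar_pair_exists\<close>), so that the two real components are bounded by the norm.

  The theorem follows. Let \<open>B\<close> be a dense C*-subalgebra of a limit \<open>A\<close> of Banach *-algebras with
  coordinate seminorms \<open>p\<^sub>i\<close>. By the second fact \<open>p\<^sub>i\<close> is equivalent on \<open>B\<close> to the C*-norm of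
  \<open>B / ker p\<^sub>i\<close>; so the image of \<open>B\<close> in the \<open>i\<close>-th factor is complete, \<open>A = B + ker p\<^sub>i\<close>, and \<open>A\<close> is
  the limit of the C*-algebras \<open>B / ker p\<^sub>i\<close> (\<open>dense_imp_locally_Cstar\<close>). Conversely, in a limit
  of C*-algebras the bounded elements with the supremum norm form a C*-algebra, and they are dense
  because by the first fact \<open>x (1 + t\<^sup>2(x*x)\<^sup>2)\<^sup>-\<^sup>1\<close> is bounded, with a bound depending on \<open>t\<close> only, and
  tends to \<open>x\<close> as \<open>t\<close> tends to 0 (\<open>dense_subalgebra_exists\<close>). Finally, a continuous regular
  seminorm never exceeds the norm of \<open>B\<close>, so \<open>B\<close> consists of bounded elements. If \<open>x\<close> is bounded, it
  may be scaled so that \<open>p(x) < 1/2\<close> for all regular seminorms \<open>p\<close>; an element \<open>b\<close> of \<open>B\<close> with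
  \<open>p(b - x)\<close> small can by the second fact be replaced, without being moved for \<open>p\<close>, by an element of the
  unit ball of \<open>B\<close>. Hence \<open>x\<close> lies in the closure of this ball
  (\<open>dense_closed_unit_ball_eq_bounded_part\<close>).
\<close>


section \<open>*-algebras, seminorms and norm topologies\<close>

context star_algebra
begin

lemma smult_zero_left: "x \<in> carrier A \<Longrightarrow> 0 \<odot> x = \<zero>"
proof -
  assume x: "x \<in> carrier A"
  have "0 \<odot> x = 0 \<odot> x \<oplus> 0 \<odot> x"
    using smult_l_distr[OF x, of 0 0] by simp
  then show ?thesis
    using smult_closed[OF x, of 0] by (metis add.l_cancel_one')
qed

lemma smult_zero_right: "k \<odot> \<zero> = \<zero>"
proof -
  have "k \<odot> \<zero> = k \<odot> \<zero> \<oplus> k \<odot> \<zero>"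
    using smult_r_distr[of \<zero> \<zero> k] by simp
  then show ?thesis
    using smult_closed[OF zero_closed, of k] by (metis add.l_cancel_one')
qed

lemma smult_neg_right: "x \<in> carrier A \<Longrightarrow> k \<odot> (\<ominus> x) = \<ominus> (k \<odot> x)"
  by (metis a_inv_closed minus_equality l_neg smult_closed smult_r_distr smult_zero_right)

lemma smult_neg_left: "x \<in> carrier A \<Longrightarrow> (- k) \<odot> x = \<ominus> (k \<odot> x)"
  by (metis add.left_inverse minus_equality smult_closed smult_l_distr smult_zero_left)

lemma smult_diff_right: "x \<in> carrier A \<Longrightarrow> y \<in> carrier A \<Longrightarrow> k \<odot> (x \<ominus> y) = k \<odot> x \<ominus> k \<odot> y"
  by (simp add: a_minus_def smult_neg_right smult_r_distr)

lemma smult_diff_left: "x \<in> carrier A \<Longrightarrow> (k - l) \<odot> x = k \<odot> x \<ominus> l \<odot> x"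
  using smult_l_distr[of x k "- l"] by (simp add: a_minus_def smult_neg_left)

lemma star_zero: "star A \<zero> = \<zero>"
proof -
  have "star A \<zero> = star A \<zero> \<oplus> star A \<zero>"
    using star_add[of \<zero> \<zero>] by simp
  then show ?thesis
    using star_closed[OF zero_closed] by (metis add.l_cancel_one')
qed

lemma star_neg: "x \<in> carrier A \<Longrightarrow> star A (\<ominus> x) = \<ominus> star A x"
  by (metis a_inv_closed minus_equality l_neg star_closed star_add star_zero)

lemma star_diff: "x \<in> carrier A \<Longrightarrow> y \<in> carrier A \<Longrightarrow> star A (x \<ominus> y) = star A x \<ominus> star A y"
  by (simp add: a_minus_def star_neg star_add star_closed)

lemma star_one: "star A \<one> = \<one>"
  by (metis l_one one_closed r_one star_closed star_mult star_star)

lemma star_pow: "x \<in> carrier A \<Longrightarrow> star A (x [^] (n::nat)) = star A x [^] n"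
proof (induction n)
  case 0
  then show ?case by (simp add: star_one)
next
  case (Suc n)
  then show ?case
    using nat_pow_Suc2[of "star A x" n] by (simp add: star_mult star_closed)
qed

lemma star_inverse:
  assumes "x \<in> carrier A" "k \<in> carrier A" "star A x = x" "k \<otimes> x = \<one>" "x \<otimes> k = \<one>"
  shows "star A k = k"
proof -
  have "star A k \<otimes> x = \<one>"
    using star_mult[of x k] assms by (simp add: star_one)
  then show ?thesis
    using assms by (metis inv_unique star_closed)
qed

lemmas alg_closed = smult_closed star_closed

lemma minus_eq_iff: "x \<in> carrier A \<Longrightarrow> y \<in> carrier A \<Longrightarrow> x \<ominus> y = \<zero> \<longleftrightarrow> x = y"
  by (metis a_minus_def add.inv_closed minus_equality minus_minus r_neg)

lemma minus_minus_cancel: "x \<in> carrier A \<Longrightarrow> y \<in> carrier A \<Longrightarrow> z \<in> carrier A \<Longrightarrow>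
  x \<ominus> z = (x \<ominus> y) \<oplus> (y \<ominus> z)"
  by algebra

lemma add_minus_cancel: "x \<in> carrier A \<Longrightarrow> y \<in> carrier A \<Longrightarrow> (x \<ominus> y) \<oplus> y = x"
  by algebra

lemma mult_diff_right: "x \<in> carrier A \<Longrightarrow> y \<in> carrier A \<Longrightarrow> z \<in> carrier A \<Longrightarrow>
  x \<otimes> (y \<ominus> z) = x \<otimes> y \<ominus> x \<otimes> z"
  by (simp add: a_minus_def r_distr r_minus)

lemma mult_diff_left: "x \<in> carrier A \<Longrightarrow> y \<in> carrier A \<Longrightarrow> z \<in> carrier A \<Longrightarrow>
  (y \<ominus> z) \<otimes> x = y \<otimes> x \<ominus> z \<otimes> x"
  by (simp add: a_minus_def l_distr l_minus)

end

lemma star_hom_zero: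
  assumes "star_algebra c A" "star_algebra c' B" "h \<in> star_hom A B"
  shows "h \<zero>\<^bsub>A\<^esub> = \<zero>\<^bsub>B\<^esub>"
proof -
  interpret A: star_algebra c A by fact
  interpret B: star_algebra c' B by fact
  show ?thesis
    using assms(3) A.ring_axioms B.ring_axioms ring_hom_zero[of h A B] by (auto simp: star_hom_def)
qed

lemma star_homD:
  assumes "h \<in> star_hom A B"
  shows "x \<in> carrier A \<Longrightarrow> h x \<in> carrier B"
    and "x \<in> carrier A \<Longrightarrow> y \<in> carrier A \<Longrightarrow> h (x \<oplus>\<^bsub>A\<^esub> y) = h x \<oplus>\<^bsub>B\<^esub> h y"
    and "x \<in> carrier A \<Longrightarrow> y \<in> carrier A \<Longrightarrow> h (x \<otimes>\<^bsub>A\<^esub> y) = h x \<otimes>\<^bsub>B\<^esub> h y"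
    and "x \<in> carrier A \<Longrightarrow> h (k \<odot>\<^bsub>A\<^esub> x) = k \<odot>\<^bsub>B\<^esub> h x"
    and "x \<in> carrier A \<Longrightarrow> h (star A x) = star B (h x)"
    and "h \<one>\<^bsub>A\<^esub> = \<one>\<^bsub>B\<^esub>"
  using assms by (auto simp: star_hom_def ring_hom_def)

lemma star_hom_neg:
  assumes "star_algebra c A" "star_algebra c' B" "h \<in> star_hom A B" "x \<in> carrier A"
  shows "h (\<ominus>\<^bsub>A\<^esub> x) = \<ominus>\<^bsub>B\<^esub> h x"
proof -
  interpret A: star_algebra c A by fact
  interpret B: star_algebra c' B by fact
  have "h (\<ominus>\<^bsub>A\<^esub> x) \<oplus>\<^bsub>B\<^esub> h x = \<zero>\<^bsub>B\<^esub>"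
    using star_homD(2)[OF assms(3), of "\<ominus>\<^bsub>A\<^esub> x" x] assms(4) star_hom_zero[OF assms(1,2,3)]
    by (simp add: A.l_neg)
  then show ?thesis
    using B.minus_equality star_homD(1)[OF assms(3)] assms(4) by simp
qed

lemma star_hom_minus:
  assumes "star_algebra c A" "star_algebra c' B" "h \<in> star_hom A B" "x \<in> carrier A" "y \<in> carrier A"
  shows "h (x \<ominus>\<^bsub>A\<^esub> y) = h x \<ominus>\<^bsub>B\<^esub> h y"
proof -
  interpret A: star_algebra c A by fact
  show ?thesis
    using assms star_hom_neg[OF assms(1,2,3)] by (simp add: a_minus_def star_homD)
qed

text \<open>
  Homogeneity is weakened to symmetry, because some of the seminorms below are homogeneous over the reals
  only although the algebra is complex.
\<close>

locale alg_seminorm = star_algebra cj A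
  for cj :: "'k::real_normed_field \<Rightarrow> 'k" and A :: "('k, 'a) star_alg" (structure) +
  fixes p :: "'a \<Rightarrow> real"
  assumes p_nonneg: "x \<in> carrier A \<Longrightarrow> 0 \<le> p x"
    and p_zero: "p \<zero> = 0"
    and p_neg: "x \<in> carrier A \<Longrightarrow> p (\<ominus> x) = p x"
    and p_triangle: "\<lbrakk>x \<in> carrier A; y \<in> carrier A\<rbrakk> \<Longrightarrow> p (x \<oplus> y) \<le> p x + p y"
    and p_mult: "\<lbrakk>x \<in> carrier A; y \<in> carrier A\<rbrakk> \<Longrightarrow> p (x \<otimes> y) \<le> p x * p y"
begin

lemma p_diff_le: "x \<in> carrier A \<Longrightarrow> y \<in> carrier A \<Longrightarrow> p (x \<ominus> y) \<le> p x + p y"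
  using p_triangle[of x "\<ominus> y"] p_neg[of y] by (simp add: a_minus_def)

lemma p_sym: "x \<in> carrier A \<Longrightarrow> y \<in> carrier A \<Longrightarrow> p (x \<ominus> y) = p (y \<ominus> x)"
proof -
  assume "x \<in> carrier A" "y \<in> carrier A"
  then have "x \<ominus> y = \<ominus> (y \<ominus> x)"
    by algebra
  then show ?thesis
    using p_neg[of "y \<ominus> x"] \<open>x \<in> carrier A\<close> \<open>y \<in> carrier A\<close> by simp
qed

lemma p_dist_triangle:
  "x \<in> carrier A \<Longrightarrow> y \<in> carrier A \<Longrightarrow> z \<in> carrier A \<Longrightarrow> p (x \<ominus> z) \<le> p (x \<ominus> y) + p (y \<ominus> z)"
  using p_triangle[of "x \<ominus> y" "y \<ominus> z"] minus_minus_cancel[of x y z] by simp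

lemma p_le_dist: "x \<in> carrier A \<Longrightarrow> y \<in> carrier A \<Longrightarrow> p x \<le> p (x \<ominus> y) + p y"
  using p_triangle[of "x \<ominus> y" y] by (simp add: add_minus_cancel)

lemma p_cong: "x \<in> carrier A \<Longrightarrow> y \<in> carrier A \<Longrightarrow> p (x \<ominus> y) = 0 \<Longrightarrow> p x = p y"
  using p_le_dist[of x y] p_le_dist[of y x] p_sym[of x y] by simp

lemma p_minus_self: "x \<in> carrier A \<Longrightarrow> p (x \<ominus> x) = 0"
  using minus_eq_iff[of x x] by (simp add: p_zero)

lemma p_pow_Suc: "x \<in> carrier A \<Longrightarrow> p (x [^] Suc n) \<le> p x ^ Suc n"
proof (induction n)
  case 0
  then show ?case by simp
next
  case (Suc n)
  have "p (x [^] Suc (Suc n)) \<le> p (x [^] Suc n) * p x"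
    using p_mult[of "x [^] Suc n" x] Suc.prems by simp
  also have "\<dots> \<le> p x ^ Suc n * p x"
    using Suc p_nonneg[of x] by (intro mult_right_mono) auto
  finally show ?case by (simp add: mult.commute)
qed

lemma p_pow: "x \<in> carrier A \<Longrightarrow> 0 < n \<Longrightarrow> p (x [^] n) \<le> p x ^ n"
  using p_pow_Suc[of x "n - 1"] by simp

lemma geometric_Cauchy:
  assumes s: "\<And>n. s n \<in> carrier A" and c: "0 \<le> c" "c < 1"
    and step: "\<And>n. p (s (Suc n) \<ominus> s n) \<le> K * c ^ n"
    and "n \<le> m"
  shows "p (s m \<ominus> s n) \<le> K / (1 - c) * c ^ n"
proof -
  have *: "p (s m \<ominus> s n) \<le> K / (1 - c) * (c ^ n - c ^ m)"
    using \<open>n \<le> m\<close>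
  proof (induction m rule: dec_induct)
    case base
    then show ?case using s p_minus_self by simp
  next
    case (step m)
    have "p (s (Suc m) \<ominus> s n) \<le> K * c ^ m + K / (1 - c) * (c ^ n - c ^ m)"
      using p_dist_triangle[of "s (Suc m)" "s m" "s n"] s assms(4)[of m] step.IH by fastforce
    also have "\<dots> = K / (1 - c) * (c ^ n - c ^ Suc m)"
      using c by (simp add: field_simps)
    finally show ?case .
  qed
  have "0 \<le> K"
    using step[of 0] p_nonneg[of "s (Suc 0) \<ominus> s 0"] s by simp
  then have "K / (1 - c) * (c ^ n - c ^ m) \<le> K / (1 - c) * c ^ n"
    using c by (intro mult_left_mono) auto
  with * show ?thesis by linarith
qed

end

locale regular_seminorm = alg_seminorm cj A p
  for cj :: "'k::real_normed_field \<Rightarrow> 'k" and A :: "('k, 'a) star_alg" (structure) and p +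
  assumes p_regular: "x \<in> carrier A \<Longrightarrow> p (star A x \<otimes> x) = (p x)\<^sup>2"
begin

lemma p_star: "x \<in> carrier A \<Longrightarrow> p (star A x) = p x"
proof -
  have le: "p x \<le> p (star A x)" if x: "x \<in> carrier A" for x
  proof (cases "p x = 0")
    case False
    then have "0 < p x" using p_nonneg[OF x] by simp
    moreover have "p x * p x \<le> p (star A x) * p x"
      using p_regular[OF x] p_mult[of "star A x" x] x by (simp add: star_closed power2_eq_square)
    ultimately show ?thesis by simp
  qed (use x p_nonneg star_closed in auto)
  assume "x \<in> carrier A"
  then show ?thesis
    using le[of x] le[of "star A x"] by (simp add: star_star star_closed)
qed

lemma p_one_le: "p \<one> \<le> 1"
proof -
  have "p \<one> = (p \<one>)\<^sup>2"
    using p_regular[of \<one>] by (simp add: star_one)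
  then show ?thesis
    by (metis order.refl power2_eq_square mult_cancel_left1 zero_le_one)
qed

lemma p_pow': "x \<in> carrier A \<Longrightarrow> p (x [^] (n::nat)) \<le> p x ^ n"
  using p_pow[of x n] p_one_le by (cases n) auto

text \<open>
  On selfadjoint elements the C*-identity turns squaring into squaring of the seminorm. Iterated, it
  removes constants: an estimate of \<open>p (x [^] 2 ^ n)\<close> up to a fixed factor gives one of \<open>p x\<close> without it.
\<close>

lemma p_selfadjoint_pow:
  assumes "x \<in> carrier A" "star A x = x"
  shows "p (x [^] ((2::nat) ^ n)) = p x ^ (2 ^ n)"
proof (induction n)
  case 0
  then show ?case using assms by simp
next
  case (Suc n)
  let ?y = "x [^] ((2::nat) ^ n)"
  have "x [^] ((2::nat) ^ Suc n) = star A ?y \<otimes> ?y"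
    using assms nat_pow_mult[of x "2 ^ n" "2 ^ n"] by (simp add: star_pow mult_2)
  then have "p (x [^] ((2::nat) ^ Suc n)) = (p x ^ (2 ^ n))\<^sup>2"
    using p_regular[of ?y] assms Suc by simp
  then show ?case
    by (simp add: power_mult[symmetric] mult.commute)
qed

end

sublocale banach_star_algebra \<subseteq> alg_seminorm cj A nrm
proof unfold_locales
  show "nrm \<zero> = 0"
    using nrm_eq_zero by simp
  show "nrm (\<ominus> x) = nrm x" if "x \<in> carrier A" for x
    using nrm_smult[of x "- 1"] smult_neg_left[of x 1] that by (simp add: smult_one)
qed (use nrm_nonneg nrm_triangle nrm_mult in auto)

locale alg_norm = alg_seminorm cj A p
  for cj :: "'k::real_normed_field \<Rightarrow> 'k" and A :: "('k, 'a) star_alg" (structure) and p +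
  assumes p_definite: "x \<in> carrier A \<Longrightarrow> p x = 0 \<Longrightarrow> x = \<zero>"
begin

lemma norm_dist_metric: "Metric_space (carrier A) (norm_dist A p)"
proof
  fix x y z
  show "0 \<le> norm_dist A p x y"
    by (auto simp: norm_dist_def p_nonneg)
  show "norm_dist A p x y = norm_dist A p y x"
    by (auto simp: norm_dist_def p_sym)
  show "x \<in> carrier A \<Longrightarrow> y \<in> carrier A \<Longrightarrow> norm_dist A p x y = 0 \<longleftrightarrow> x = y"
    using p_definite[of "x \<ominus> y"] by (auto simp: norm_dist_def minus_eq_iff p_minus_self)
  show "\<lbrakk>x \<in> carrier A; y \<in> carrier A; z \<in> carrier A\<rbrakk> \<Longrightarrow>
    norm_dist A p x z \<le> norm_dist A p x y + norm_dist A p y z"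
    by (auto simp: norm_dist_def p_dist_triangle)
qed

lemma openin_norm_topology:
  "openin (norm_topology A p) U \<longleftrightarrow> U \<subseteq> carrier A \<and>
    (\<forall>x\<in>U. \<exists>r>0. \<forall>y\<in>carrier A. p (y \<ominus> x) < r \<longrightarrow> y \<in> U)"
proof -
  interpret M: Metric_space "carrier A" "norm_dist A p" by (rule norm_dist_metric)
  have "M.mball x r = {y \<in> carrier A. p (y \<ominus> x) < r}" if "x \<in> carrier A" for x r
    using that by (auto simp: M.mball_def norm_dist_def p_sym)
  then have "(\<exists>r>0. M.mball x r \<subseteq> U) \<longleftrightarrow> (\<exists>r>0. \<forall>y\<in>carrier A. p (y \<ominus> x) < r \<longrightarrow> y \<in> U)"
    if "x \<in> carrier A" for x
    using that by (auto simp: subset_iff)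
  then show ?thesis
    unfolding norm_topology_def M.openin_mtopology by blast
qed

lemma topspace_norm_topology [simp]: "topspace (norm_topology A p) = carrier A"
  by (simp add: norm_topology_def Metric_space.topspace_mtopology norm_dist_metric)

lemma openin_norm_ball: "x \<in> carrier A \<Longrightarrow> openin (norm_topology A p) {y \<in> carrier A. p (y \<ominus> x) < r}"
  unfolding openin_norm_topology
proof (intro conjI ballI)
  fix y assume x: "x \<in> carrier A" and y: "y \<in> {y \<in> carrier A. p (y \<ominus> x) < r}"
  show "\<exists>r'>0. \<forall>z\<in>carrier A. p (z \<ominus> y) < r' \<longrightarrow> z \<in> {y \<in> carrier A. p (y \<ominus> x) < r}"
  proof (intro exI[of _ "r - p (y \<ominus> x)"] conjI ballI impI)
    fix z assume "z \<in> carrier A" "p (z \<ominus> y) < r - p (y \<ominus> x)"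
    then show "z \<in> {y \<in> carrier A. p (y \<ominus> x) < r}"
      using p_dist_triangle[of z y x] x y by auto
  qed (use y in auto)
qed auto

text \<open>
  A Cauchy sequence converges as soon as a subsequence does, and a subsequence can be chosen with
  geometrically decreasing steps.
\<close>

lemma mcompleteI:
  assumes "\<And>s. (\<And>n. s n \<in> carrier A) \<Longrightarrow> (\<And>n. p (s (Suc n) \<ominus> s n) \<le> (1 / 2) ^ n) \<Longrightarrow>
    \<exists>l\<in>carrier A. (\<lambda>n. p (s n \<ominus> l)) \<longlonglongrightarrow> 0"
  shows "Metric_space.mcomplete (carrier A) (norm_dist A p)"
proof -
  interpret M: Metric_space "carrier A" "norm_dist A p" by (rule norm_dist_metric)
  show ?thesis
    unfolding M.mcomplete_def
  proof (intro allI impI)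
    fix \<sigma> :: "nat \<Rightarrow> 'a"
    assume \<sigma>: "M.MCauchy \<sigma>"
    have "\<forall>k. \<exists>n. \<forall>i j. n \<le> i \<longrightarrow> n \<le> j \<longrightarrow> norm_dist A p (\<sigma> i) (\<sigma> j) < (1 / 2) ^ k"
      using \<sigma> unfolding M.MCauchy_def by (metis zero_less_divide_1_iff zero_less_numeral zero_less_power)
    then obtain N where N: "\<And>k i j. N k \<le> i \<Longrightarrow> N k \<le> j \<Longrightarrow> norm_dist A p (\<sigma> i) (\<sigma> j) < (1 / 2) ^ k"
      by metis
    \<comment> \<open>The indices increase strictly and stay beyond \<open>N k\<close>.\<close>
    define r where "r = rec_nat (N 0) (\<lambda>k m. max (Suc m) (N (Suc k)))"
    have r_Suc: "r (Suc k) = max (Suc (r k)) (N (Suc k))" for k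
      by (simp add: r_def)
    have "strict_mono r"
      unfolding strict_mono_Suc_iff r_Suc by (simp add: less_max_iff_disj)
    have N_le: "N k \<le> r k" for k
      by (cases k) (simp_all add: r_def)
    have in_carrier: "\<sigma> n \<in> carrier A" for n
      using \<sigma> by (auto simp: M.MCauchy_def)
    have "p ((\<sigma> \<circ> r) (Suc n) \<ominus> (\<sigma> \<circ> r) n) \<le> (1 / 2) ^ n" for n
      using N[of n "r (Suc n)" "r n"] N_le[of n] r_Suc[of n] in_carrier
      by (auto simp: norm_dist_def less_imp_le)
    then obtain l where l: "l \<in> carrier A" "(\<lambda>n. p ((\<sigma> \<circ> r) n \<ominus> l)) \<longlonglongrightarrow> 0"
      using assms[of "\<sigma> \<circ> r"] in_carrier by auto
    have "limitin M.mtopology (\<sigma> \<circ> r) l sequentially"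
      unfolding M.limitin_metric_dist_null using l in_carrier by (auto simp: norm_dist_def)
    then show "\<exists>x. limitin M.mtopology \<sigma> x sequentially"
      using M.MCauchy_convergent_subsequence[OF \<sigma> \<open>strict_mono r\<close>] by blast
  qed
qed

end

sublocale banach_star_algebra \<subseteq> alg_norm cj A nrm
  by unfold_locales (use nrm_eq_zero in auto)

context banach_star_algebra
begin

lemma Cauchy_limit:
  assumes s: "\<And>n. s n \<in> carrier A" and c: "0 \<le> c" "c < 1"
    and step: "\<And>n. nrm (s (Suc n) \<ominus> s n) \<le> K * c ^ n"
  obtains l where "l \<in> carrier A" "\<And>n. nrm (s n \<ominus> l) \<le> K / (1 - c) * c ^ n"
    "(\<lambda>n. nrm (s n \<ominus> l)) \<longlonglongrightarrow> 0"
proof -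
  interpret M: Metric_space "carrier A" "norm_dist A nrm" by (rule norm_dist_metric)
  have geo: "n \<le> m \<Longrightarrow> nrm (s m \<ominus> s n) \<le> K / (1 - c) * c ^ n" for m n
    using geometric_Cauchy[of s c K n m] assms by blast
  have to0: "(\<lambda>n. K / (1 - c) * c ^ n) \<longlonglongrightarrow> 0"
    using c by (intro tendsto_mult_right_zero LIMSEQ_power_zero) auto
  have "M.MCauchy s"
    unfolding M.MCauchy_def
  proof (intro conjI allI impI)
    fix e :: real assume "0 < e"
    then obtain N where N: "\<And>n. N \<le> n \<Longrightarrow> norm (K / (1 - c) * c ^ n) < e"
      using to0 unfolding LIMSEQ_iff by (metis diff_zero)
    have "norm_dist A nrm (s i) (s j) < e" if "N \<le> i" "N \<le> j" for i j
    proof -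
      have "nrm (s (max i j) \<ominus> s (min i j)) < e"
        using geo[of "min i j" "max i j"] N[of "min i j"] that
        by (simp only: real_norm_def) linarith
      then show ?thesis
        using s p_sym[of "s i" "s j"] by (cases "i \<le> j") (auto simp: norm_dist_def)
    qed
    then show "\<exists>N. \<forall>n n'. N \<le> n \<longrightarrow> N \<le> n' \<longrightarrow> norm_dist A nrm (s n) (s n') < e" by blast
  qed (use s in auto)
  then obtain l where "limitin M.mtopology s l sequentially"
    using complete unfolding M.mcomplete_def by blast
  then have l: "l \<in> carrier A" and lim: "(\<lambda>n. nrm (s n \<ominus> l)) \<longlonglongrightarrow> 0"
    unfolding M.limitin_metric_dist_null using s by (auto simp: norm_dist_def)
  have "nrm (s n \<ominus> l) \<le> K / (1 - c) * c ^ n" for n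
  proof (rule tendsto_le[OF sequentially_bot])
    show "(\<lambda>m. K / (1 - c) * c ^ n + nrm (s m \<ominus> l)) \<longlonglongrightarrow> K / (1 - c) * c ^ n"
      using tendsto_add[OF tendsto_const lim] by simp
    show "(\<lambda>m. nrm (s n \<ominus> l)) \<longlonglongrightarrow> nrm (s n \<ominus> l)" by simp
    show "\<forall>\<^sub>F m in sequentially. nrm (s n \<ominus> l) \<le> K / (1 - c) * c ^ n + nrm (s m \<ominus> l)"
      using eventually_ge_at_top[of n]
    proof eventually_elim
      case (elim m)
      then show ?case
        using geo[of n m] p_dist_triangle[of "s n" "s m" l] s l p_sym[of "s n" "s m"] by fastforce
    qed
  qed
  with l lim that show thesis by blast
qed

lemma limit_unique:
  assumes "\<And>n. s n \<in> carrier A" "a \<in> carrier A" "b \<in> carrier A"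
    and "(\<lambda>n. nrm (s n \<ominus> a)) \<longlonglongrightarrow> 0" "(\<lambda>n. nrm (s n \<ominus> b)) \<longlonglongrightarrow> 0"
  shows "a = b"
proof -
  have "nrm (a \<ominus> b) \<le> 0"
  proof (rule tendsto_le[OF sequentially_bot])
    show "(\<lambda>n. nrm (s n \<ominus> a) + nrm (s n \<ominus> b)) \<longlonglongrightarrow> 0"
      using tendsto_add[OF assms(4,5)] by simp
    show "(\<lambda>n. nrm (a \<ominus> b)) \<longlonglongrightarrow> nrm (a \<ominus> b)" by simp
    show "\<forall>\<^sub>F n in sequentially. nrm (a \<ominus> b) \<le> nrm (s n \<ominus> a) + nrm (s n \<ominus> b)"
      using p_dist_triangle[of a _ b] p_sym[of a] assms(1-3) by (intro always_eventually) metis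
  qed
  then have "nrm (a \<ominus> b) = 0"
    using p_nonneg[of "a \<ominus> b"] assms by simp
  then show ?thesis
    using assms p_definite[of "a \<ominus> b"] minus_eq_iff by simp
qed

text \<open>
  The partial sums of the geometric series are the iterates of \<open>y \<mapsto> 1 + x y\<close> from 0. Their limit is a
  fixed point of this map, that is, a right inverse of \<open>1 - x\<close>; as the iterates commute with \<open>x\<close>, it is
  also a fixed point of \<open>y \<mapsto> 1 + y x\<close>.
\<close>

lemma Neumann_inverse:
  assumes x: "x \<in> carrier A" and "nrm x < 1"
  obtains l where "l \<in> carrier A" "(\<one> \<ominus> x) \<otimes> l = \<one>" "l \<otimes> (\<one> \<ominus> x) = \<one>"
proof -
  define s where "s = rec_nat \<zero> (\<lambda>_ y. \<one> \<oplus> x \<otimes> y)"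
  have s_Suc: "s (Suc n) = \<one> \<oplus> x \<otimes> s n" for n
    by (simp add: s_def)
  have s: "s n \<in> carrier A" for n
    by (induction n) (use x in \<open>auto simp: s_def\<close>)
  have step: "nrm (s (Suc n) \<ominus> s n) \<le> nrm \<one> * nrm x ^ n" for n
  proof (induction n)
    case 0
    have "s (Suc 0) \<ominus> s 0 = \<one>" using x by (simp add: s_def a_minus_def)
    then show ?case by simp
  next
    case (Suc n)
    have "s (Suc (Suc n)) \<ominus> s (Suc n) = (\<one> \<oplus> x \<otimes> s (Suc n)) \<ominus> (\<one> \<oplus> x \<otimes> s n)"
      by (simp only: s_Suc)
    also have "\<dots> = x \<otimes> (s (Suc n) \<ominus> s n)"
      using s[of n] s[of "Suc n"] x by algebra
    finally have "nrm (s (Suc (Suc n)) \<ominus> s (Suc n)) \<le> nrm x * nrm (s (Suc n) \<ominus> s n)"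
      using p_mult[of x "s (Suc n) \<ominus> s n"] x s by simp
    also have "\<dots> \<le> nrm x * (nrm \<one> * nrm x ^ n)"
      using Suc p_nonneg[OF x] by (intro mult_left_mono) auto
    finally show ?case by (simp add: mult_ac)
  qed
  obtain l where l: "l \<in> carrier A" and lim: "(\<lambda>n. nrm (s n \<ominus> l)) \<longlonglongrightarrow> 0"
    using Cauchy_limit[OF s p_nonneg[OF x] assms(2) step] by blast
  have comm: "s n \<otimes> x = x \<otimes> s n" for n
  proof (induction n)
    case 0
    show ?case using x by (simp add: s_def)
  next
    case (Suc n)
    have "s (Suc n) \<otimes> x = x \<oplus> x \<otimes> (s n \<otimes> x)"
      using s[of n] x by (simp add: s_Suc l_distr m_assoc)
    then show ?case
      using Suc s[of n] x by (simp add: s_Suc r_distr)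
  qed
  have lim_Suc: "(\<lambda>n. nrm (s (Suc n) \<ominus> l)) \<longlonglongrightarrow> 0"
    using LIMSEQ_Suc[OF lim] .
  have "(\<lambda>n. nrm (s (Suc n) \<ominus> (\<one> \<oplus> x \<otimes> l))) \<longlonglongrightarrow> 0"
  proof (rule real_tendsto_sandwich[OF _ _ tendsto_const])
    show "(\<lambda>n. nrm x * nrm (s n \<ominus> l)) \<longlonglongrightarrow> 0"
      using tendsto_mult_right_zero[OF lim] by simp
    have "s (Suc n) \<ominus> (\<one> \<oplus> x \<otimes> l) = x \<otimes> (s n \<ominus> l)" for n
      using s[of n] x l unfolding s_Suc by algebra
    then show "\<forall>\<^sub>F n in sequentially. nrm (s (Suc n) \<ominus> (\<one> \<oplus> x \<otimes> l)) \<le> nrm x * nrm (s n \<ominus> l)"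
      using p_mult[of x] x s l by (intro always_eventually) simp
  qed (use s x l p_nonneg in \<open>auto intro!: always_eventually\<close>)
  then have eq1: "l = \<one> \<oplus> x \<otimes> l"
    using limit_unique[OF _ _ _ lim_Suc] s l x by simp
  have "(\<lambda>n. nrm (s (Suc n) \<ominus> (\<one> \<oplus> l \<otimes> x))) \<longlonglongrightarrow> 0"
  proof (rule real_tendsto_sandwich[OF _ _ tendsto_const])
    show "(\<lambda>n. nrm (s n \<ominus> l) * nrm x) \<longlonglongrightarrow> 0"
      using tendsto_mult_left_zero[OF lim] by simp
    have "s (Suc n) \<ominus> (\<one> \<oplus> l \<otimes> x) = (s n \<ominus> l) \<otimes> x" for n
      using s[of n] x l unfolding s_Suc comm[symmetric] by algebra
    then show "\<forall>\<^sub>F n in sequentially. nrm (s (Suc n) \<ominus> (\<one> \<oplus> l \<otimes> x)) \<le> nrm (s n \<ominus> l) * nrm x"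
      using p_mult[of _ x] x s l by (intro always_eventually) simp
  qed (use s x l p_nonneg in \<open>auto intro!: always_eventually\<close>)
  then have eq2: "l = \<one> \<oplus> l \<otimes> x"
    using limit_unique[OF _ _ _ lim_Suc] s l x by simp
  have "(\<one> \<ominus> x) \<otimes> l = l \<ominus> x \<otimes> l"
    using x l by algebra
  also have "\<dots> = (\<one> \<oplus> x \<otimes> l) \<ominus> x \<otimes> l"
    using eq1 by simp
  also have "\<dots> = \<one>"
    using x l by algebra
  finally have 1: "(\<one> \<ominus> x) \<otimes> l = \<one>" .
  have "l \<otimes> (\<one> \<ominus> x) = l \<ominus> l \<otimes> x"
    using x l mult_diff_right[of l \<one> x] by simp
  also have "\<dots> = (\<one> \<oplus> l \<otimes> x) \<ominus> l \<otimes> x"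
    using eq2 by simp
  also have "\<dots> = \<one>"
    using x l by algebra
  finally show thesis
    using that[OF l 1] by blast
qed

end

section \<open>Complexification and resolvents of selfadjoint elements\<close>

lemma complexification_simps [simp]:
  "carrier (complexification A) = carrier A \<times> carrier A"
  "(x, y) \<otimes>\<^bsub>complexification A\<^esub> (u, v) =
    ((x \<otimes>\<^bsub>A\<^esub> u) \<ominus>\<^bsub>A\<^esub> (y \<otimes>\<^bsub>A\<^esub> v), (x \<otimes>\<^bsub>A\<^esub> v) \<oplus>\<^bsub>A\<^esub> (y \<otimes>\<^bsub>A\<^esub> u))"
  "\<one>\<^bsub>complexification A\<^esub> = (\<one>\<^bsub>A\<^esub>, \<zero>\<^bsub>A\<^esub>)"
  "\<zero>\<^bsub>complexification A\<^esub> = (\<zero>\<^bsub>A\<^esub>, \<zero>\<^bsub>A\<^esub>)"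
  "(x, y) \<oplus>\<^bsub>complexification A\<^esub> (u, v) = (x \<oplus>\<^bsub>A\<^esub> u, y \<oplus>\<^bsub>A\<^esub> v)"
  "k \<odot>\<^bsub>complexification A\<^esub> (x, y) =
    ((Re k \<odot>\<^bsub>A\<^esub> x) \<ominus>\<^bsub>A\<^esub> (Im k \<odot>\<^bsub>A\<^esub> y), (Re k \<odot>\<^bsub>A\<^esub> y) \<oplus>\<^bsub>A\<^esub> (Im k \<odot>\<^bsub>A\<^esub> x))"
  "star (complexification A) (x, y) = (star A x, \<ominus>\<^bsub>A\<^esub> star A y)"
  by (simp_all add: complexification_def)

lemma complexification_star_algebra:
  assumes "real_star_algebra A"
  shows "star_algebra cnj (complexification A)"
proof -
  interpret star_algebra "\<lambda>t. t" A by fact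
  let ?C = "complexification A"
  have "abelian_group ?C"
  proof (rule abelian_groupI)
    show "\<exists>y\<in>carrier ?C. y \<oplus>\<^bsub>?C\<^esub> x = \<zero>\<^bsub>?C\<^esub>" if "x \<in> carrier ?C" for x
      using that by (cases x) (auto intro!: bexI[of _ "(\<ominus>\<^bsub>A\<^esub> fst x, \<ominus>\<^bsub>A\<^esub> snd x)"] simp: l_neg)
  qed (auto simp: a_ac)
  moreover have "monoid ?C"
  proof
    fix x y z assume "x \<in> carrier ?C" "y \<in> carrier ?C" "z \<in> carrier ?C"
    then obtain x1 x2 y1 y2 z1 z2 where
      "x = (x1, x2)" "y = (y1, y2)" "z = (z1, z2)"
      "x1 \<in> carrier A" "x2 \<in> carrier A" "y1 \<in> carrier A" "y2 \<in> carrier A" "z1 \<in> carrier A" "z2 \<in> carrier A"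
      by auto
    then show "x \<otimes>\<^bsub>?C\<^esub> y \<otimes>\<^bsub>?C\<^esub> z = x \<otimes>\<^bsub>?C\<^esub> (y \<otimes>\<^bsub>?C\<^esub> z)"
      by (simp add: a_minus_def l_distr r_distr minus_add l_minus r_minus m_assoc a_ac)
  qed (auto simp: a_minus_def)
  ultimately have "ring ?C"
  proof (rule ringI)
    fix x y z assume "x \<in> carrier ?C" "y \<in> carrier ?C" "z \<in> carrier ?C"
    then obtain x1 x2 y1 y2 z1 z2 where
      "x = (x1, x2)" "y = (y1, y2)" "z = (z1, z2)"
      "x1 \<in> carrier A" "x2 \<in> carrier A" "y1 \<in> carrier A" "y2 \<in> carrier A" "z1 \<in> carrier A" "z2 \<in> carrier A"
      by auto
    then show "(x \<oplus>\<^bsub>?C\<^esub> y) \<otimes>\<^bsub>?C\<^esub> z = x \<otimes>\<^bsub>?C\<^esub> z \<oplus>\<^bsub>?C\<^esub> y \<otimes>\<^bsub>?C\<^esub> z"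
      "z \<otimes>\<^bsub>?C\<^esub> (x \<oplus>\<^bsub>?C\<^esub> y) = z \<otimes>\<^bsub>?C\<^esub> x \<oplus>\<^bsub>?C\<^esub> z \<otimes>\<^bsub>?C\<^esub> y"
      by (simp_all add: a_minus_def l_distr r_distr minus_add l_minus r_minus m_assoc a_ac)
  qed
  then show ?thesis
  proof (rule star_algebra.intro)
    show "star_algebra_axioms cnj ?C"
    proof
      fix x y k l
      assume "x \<in> carrier ?C"
      then obtain x1 x2 where x: "x = (x1, x2)" "x1 \<in> carrier A" "x2 \<in> carrier A"
        by auto
      show "k \<odot>\<^bsub>?C\<^esub> x \<in> carrier ?C"
        "(k + l) \<odot>\<^bsub>?C\<^esub> x = k \<odot>\<^bsub>?C\<^esub> x \<oplus>\<^bsub>?C\<^esub> l \<odot>\<^bsub>?C\<^esub> x"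
        "1 \<odot>\<^bsub>?C\<^esub> x = x"
        "star ?C x \<in> carrier ?C" "star ?C (star ?C x) = x"
        using x by (simp_all add: alg_closed smult_l_distr smult_one a_minus_def minus_add a_ac
            smult_zero_left star_neg star_star)
      show "(k * l) \<odot>\<^bsub>?C\<^esub> x = k \<odot>\<^bsub>?C\<^esub> (l \<odot>\<^bsub>?C\<^esub> x)"
        using x by (simp add: alg_closed smult_l_distr smult_diff_left smult_diff_right a_minus_def
            minus_add a_ac smult_assoc smult_r_distr smult_neg_right)
      show "star ?C (k \<odot>\<^bsub>?C\<^esub> x) = cnj k \<odot>\<^bsub>?C\<^esub> star ?C x"
        using x by (simp add: alg_closed star_neg star_add star_smult smult_neg_left smult_neg_right
            a_minus_def minus_add a_ac)
      assume "y \<in> carrier ?C"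
      then obtain y1 y2 where y: "y = (y1, y2)" "y1 \<in> carrier A" "y2 \<in> carrier A"
        by auto
      show "k \<odot>\<^bsub>?C\<^esub> (x \<oplus>\<^bsub>?C\<^esub> y) = k \<odot>\<^bsub>?C\<^esub> x \<oplus>\<^bsub>?C\<^esub> k \<odot>\<^bsub>?C\<^esub> y"
        using x y by (simp add: alg_closed smult_r_distr a_minus_def minus_add a_ac)
      show "(k \<odot>\<^bsub>?C\<^esub> x) \<otimes>\<^bsub>?C\<^esub> y = k \<odot>\<^bsub>?C\<^esub> (x \<otimes>\<^bsub>?C\<^esub> y)"
        "x \<otimes>\<^bsub>?C\<^esub> (k \<odot>\<^bsub>?C\<^esub> y) = k \<odot>\<^bsub>?C\<^esub> (x \<otimes>\<^bsub>?C\<^esub> y)"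
        using x y by (simp_all add: alg_closed smult_r_distr a_minus_def minus_add a_ac l_distr r_distr
            l_minus r_minus smult_mult_left smult_mult_right smult_neg_right)
      show "star ?C (x \<oplus>\<^bsub>?C\<^esub> y) = star ?C x \<oplus>\<^bsub>?C\<^esub> star ?C y"
        using x y by (simp add: alg_closed star_add minus_add)
      show "star ?C (x \<otimes>\<^bsub>?C\<^esub> y) = star ?C y \<otimes>\<^bsub>?C\<^esub> star ?C x"
        using x y by (simp add: alg_closed star_add star_neg star_mult minus_add a_minus_def a_ac
            l_minus r_minus)
    qed
  qed
qed

lemma complexification_neg:
  assumes "real_star_algebra A" "x \<in> carrier A" "y \<in> carrier A"
  shows "\<ominus>\<^bsub>complexification A\<^esub> (x, y) = (\<ominus>\<^bsub>A\<^esub> x, \<ominus>\<^bsub>A\<^esub> y)"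
proof -
  interpret star_algebra "\<lambda>t. t" A by fact
  interpret C: star_algebra cnj "complexification A"
    by (rule complexification_star_algebra) fact
  show ?thesis
    using assms by (intro C.minus_equality) (auto simp: l_neg)
qed

lemma complexification_minus:
  assumes "real_star_algebra A" "x \<in> carrier A" "y \<in> carrier A" "u \<in> carrier A" "v \<in> carrier A"
  shows "(x, y) \<ominus>\<^bsub>complexification A\<^esub> (u, v) = (x \<ominus>\<^bsub>A\<^esub> u, y \<ominus>\<^bsub>A\<^esub> v)"
  using assms by (simp add: a_minus_def complexification_neg)

lemma complexification_embed:
  assumes "real_star_algebra A" "x \<in> carrier A" "y \<in> carrier A"
  shows "(x, \<zero>\<^bsub>A\<^esub>) \<otimes>\<^bsub>complexification A\<^esub> (y, \<zero>\<^bsub>A\<^esub>) = (x \<otimes>\<^bsub>A\<^esub> y, \<zero>\<^bsub>A\<^esub>)"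
    and "(x, \<zero>\<^bsub>A\<^esub>) \<oplus>\<^bsub>complexification A\<^esub> (y, \<zero>\<^bsub>A\<^esub>) = (x \<oplus>\<^bsub>A\<^esub> y, \<zero>\<^bsub>A\<^esub>)"
    and "(x, \<zero>\<^bsub>A\<^esub>) \<ominus>\<^bsub>complexification A\<^esub> (y, \<zero>\<^bsub>A\<^esub>) = (x \<ominus>\<^bsub>A\<^esub> y, \<zero>\<^bsub>A\<^esub>)"
    and "of_real t \<odot>\<^bsub>complexification A\<^esub> (x, \<zero>\<^bsub>A\<^esub>) = (t \<odot>\<^bsub>A\<^esub> x, \<zero>\<^bsub>A\<^esub>)"
    and "star (complexification A) (x, \<zero>\<^bsub>A\<^esub>) = (star A x, \<zero>\<^bsub>A\<^esub>)"
proof -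
  interpret star_algebra "\<lambda>t. t" A by fact
  show "(x, \<zero>\<^bsub>A\<^esub>) \<otimes>\<^bsub>complexification A\<^esub> (y, \<zero>\<^bsub>A\<^esub>) = (x \<otimes>\<^bsub>A\<^esub> y, \<zero>\<^bsub>A\<^esub>)"
    "(x, \<zero>\<^bsub>A\<^esub>) \<oplus>\<^bsub>complexification A\<^esub> (y, \<zero>\<^bsub>A\<^esub>) = (x \<oplus>\<^bsub>A\<^esub> y, \<zero>\<^bsub>A\<^esub>)"
    "(x, \<zero>\<^bsub>A\<^esub>) \<ominus>\<^bsub>complexification A\<^esub> (y, \<zero>\<^bsub>A\<^esub>) = (x \<ominus>\<^bsub>A\<^esub> y, \<zero>\<^bsub>A\<^esub>)"
    "of_real t \<odot>\<^bsub>complexification A\<^esub> (x, \<zero>\<^bsub>A\<^esub>) = (t \<odot>\<^bsub>A\<^esub> x, \<zero>\<^bsub>A\<^esub>)"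
    "star (complexification A) (x, \<zero>\<^bsub>A\<^esub>) = (star A x, \<zero>\<^bsub>A\<^esub>)"
    using assms by (simp_all add: complexification_minus)
      (simp_all add: a_minus_def smult_zero_right smult_zero_left alg_closed star_zero)
qed

text \<open>
  Conjugation is a conjugate-linear *-automorphism of the complexification whose fixed points are the
  elements of the real algebra.
\<close>

definition cx_conj :: "(real, 'a) star_alg \<Rightarrow> 'a \<times> 'a \<Rightarrow> 'a \<times> 'a"
  where "cx_conj A = (\<lambda>(x, y). (x, \<ominus>\<^bsub>A\<^esub> y))"

lemma cx_conj_simps:
  assumes "real_star_algebra A" "z \<in> carrier (complexification A)" "w \<in> carrier (complexification A)"
  shows "cx_conj A z \<in> carrier (complexification A)"
    and "cx_conj A (cx_conj A z) = z"
    and "cx_conj A (z \<oplus>\<^bsub>complexification A\<^esub> w) = cx_conj A z \<oplus>\<^bsub>complexification A\<^esub> cx_conj A w"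
    and "cx_conj A (z \<otimes>\<^bsub>complexification A\<^esub> w) = cx_conj A z \<otimes>\<^bsub>complexification A\<^esub> cx_conj A w"
    and "cx_conj A (k \<odot>\<^bsub>complexification A\<^esub> z) = cnj k \<odot>\<^bsub>complexification A\<^esub> cx_conj A z"
    and "cx_conj A (star (complexification A) z) = star (complexification A) (cx_conj A z)"
proof -
  interpret star_algebra "\<lambda>t. t" A by fact
  obtain x y u v where "z = (x, y)" "w = (u, v)"
    "x \<in> carrier A" "y \<in> carrier A" "u \<in> carrier A" "v \<in> carrier A"
    using assms(2,3) by auto
  then show "cx_conj A z \<in> carrier (complexification A)"
    "cx_conj A (cx_conj A z) = z"
    "cx_conj A (z \<oplus>\<^bsub>complexification A\<^esub> w) = cx_conj A z \<oplus>\<^bsub>complexification A\<^esub> cx_conj A w"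
    "cx_conj A (z \<otimes>\<^bsub>complexification A\<^esub> w) = cx_conj A z \<otimes>\<^bsub>complexification A\<^esub> cx_conj A w"
    "cx_conj A (k \<odot>\<^bsub>complexification A\<^esub> z) = cnj k \<odot>\<^bsub>complexification A\<^esub> cx_conj A z"
    "cx_conj A (star (complexification A) z) = star (complexification A) (cx_conj A z)"
    by (simp_all add: cx_conj_def alg_closed minus_add a_minus_def l_minus r_minus smult_neg_right
        smult_neg_left star_neg a_ac)
qed

lemma complexification_map_hom:
  assumes A: "real_star_algebra A" and B: "real_star_algebra B" and f: "f \<in> star_hom A B"
    and z: "z \<in> carrier (complexification A)" and w: "w \<in> carrier (complexification A)"
  shows "map_prod f f z \<in> carrier (complexification B)"
    and "map_prod f f (z \<oplus>\<^bsub>complexification A\<^esub> w) = map_prod f f z \<oplus>\<^bsub>complexification B\<^esub> map_prod f f w"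
    and "map_prod f f (z \<otimes>\<^bsub>complexification A\<^esub> w) = map_prod f f z \<otimes>\<^bsub>complexification B\<^esub> map_prod f f w"
    and "map_prod f f (k \<odot>\<^bsub>complexification A\<^esub> z) = k \<odot>\<^bsub>complexification B\<^esub> map_prod f f z"
    and "map_prod f f (star (complexification A) z) = star (complexification B) (map_prod f f z)"
    and "map_prod f f (cx_conj A z) = cx_conj B (map_prod f f z)"
proof -
  interpret A: star_algebra "\<lambda>t. t" A by (rule A)
  obtain x y u v where zw: "z = (x, y)" "x \<in> carrier A" "y \<in> carrier A" "w = (u, v)" "u \<in> carrier A" "v \<in> carrier A"
    using z w by auto
  note hom = star_homD[OF f] star_hom_neg[OF A B f] star_hom_minus[OF A B f] A.alg_closed
  show "map_prod f f z \<in> carrier (complexification B)"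
    "map_prod f f (z \<oplus>\<^bsub>complexification A\<^esub> w) = map_prod f f z \<oplus>\<^bsub>complexification B\<^esub> map_prod f f w"
    "map_prod f f (z \<otimes>\<^bsub>complexification A\<^esub> w) = map_prod f f z \<otimes>\<^bsub>complexification B\<^esub> map_prod f f w"
    "map_prod f f (k \<odot>\<^bsub>complexification A\<^esub> z) = k \<odot>\<^bsub>complexification B\<^esub> map_prod f f z"
    "map_prod f f (star (complexification A) z) = star (complexification B) (map_prod f f z)"
    "map_prod f f (cx_conj A z) = cx_conj B (map_prod f f z)"
    using zw by (simp_all add: hom cx_conj_def)
qed



locale complex_Cstar = banach_star_algebra cnj C nrm + regular_seminorm cnj C nrm
  for C :: "(complex, 'a) star_alg" (structure) and nrm
begin

text \<open>
  With \<open>z = h + is\<close> and \<open>w = h - is = z*\<close> one has \<open>u* - u = u* (z - w) u = 2is u*u\<close>; the C*-identity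
  turns this into \<open>2s \<parallel>u\<parallel>\<^sup>2 \<le> 2 \<parallel>u\<parallel>\<close>.
\<close>

lemma resolvent_norm_le:
  assumes h: "h \<in> carrier C" "star C h = h" and "0 < s"
    and u: "u \<in> carrier C" "u \<otimes> (h \<oplus> (\<i> * of_real s) \<odot> \<one>) = \<one>" "(h \<oplus> (\<i> * of_real s) \<odot> \<one>) \<otimes> u = \<one>"
  shows "nrm u \<le> 1 / s"
proof -
  let ?z = "h \<oplus> (\<i> * of_real s) \<odot> \<one>" and ?w = "h \<oplus> (- (\<i> * of_real s)) \<odot> \<one>"
  have cl: "?z \<in> carrier C" "?w \<in> carrier C" "star C u \<in> carrier C"
    using h u by (auto simp: alg_closed)
  have sz: "star C ?z = ?w"
    using h by (simp add: star_add star_smult star_one alg_closed)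
  have uw: "star C u \<otimes> ?w = \<one>"
    using star_mult[of ?z u] u cl sz by (simp add: star_one)
  have zw: "?z \<ominus> ?w = (2 * \<i> * of_real s) \<odot> \<one>"
  proof -
    have "?z \<ominus> ?w = (\<i> * of_real s) \<odot> \<one> \<ominus> (- (\<i> * of_real s)) \<odot> \<one>"
      using h alg_closed(1)[of \<one>] by algebra
    also have "\<dots> = (\<i> * of_real s - (- (\<i> * of_real s))) \<odot> \<one>"
      by (rule smult_diff_left[symmetric]) simp
    also have "\<i> * of_real s - (- (\<i> * of_real s)) = 2 * \<i> * complex_of_real s"
      by simp
    finally show ?thesis .
  qed
  have "star C u \<ominus> u = star C u \<otimes> (?z \<otimes> u) \<ominus> (star C u \<otimes> ?w) \<otimes> u"
    using u cl uw by simp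
  also have "\<dots> = star C u \<otimes> (?z \<ominus> ?w) \<otimes> u"
    using cl u(1) by (simp add: mult_diff_left mult_diff_right m_assoc)
  also have "\<dots> = (2 * \<i> * of_real s) \<odot> (star C u \<otimes> u)"
    using cl(3) u(1) by (simp add: zw smult_mult_left smult_mult_right)
  finally have "nrm (star C u \<ominus> u) = 2 * s * (nrm u)\<^sup>2"
    using nrm_smult[of "star C u \<otimes> u" "2 * \<i> * of_real s"] cl u(1) p_regular[of u] \<open>0 < s\<close>
    by (simp add: norm_mult)
  then have "2 * s * (nrm u)\<^sup>2 \<le> 2 * nrm u"
    using p_diff_le[of "star C u" u] cl u(1) p_star[of u] by simp
  then have "s * nrm u * nrm u \<le> 1 * nrm u"
    by (simp add: power2_eq_square mult_ac)
  moreover have "0 \<le> nrm u" using u by (simp add: nrm_nonneg)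
  ultimately have "s * nrm u \<le> 1"
    by (metis less_eq_real_def mult_right_le_imp_le mult_zero_right zero_le_one)
  then show ?thesis
    using \<open>0 < s\<close> by (simp add: field_simps)
qed

text \<open>
  The Neumann series gives the resolvent at a point \<open>is\<close> with \<open>s\<close> larger than \<open>t\<close> and \<open>\<parallel>h\<parallel>\<close>. There it
  has norm at most \<open>1/s\<close>, so \<open>h + it = (h + is) (1 - i(s - t) u)\<close> is invertible by a second Neumann
  series.
\<close>

lemma resolvent_exists:
  assumes h: "h \<in> carrier C" "star C h = h" and "0 < t"
  obtains u where "u \<in> carrier C" "u \<otimes> (h \<oplus> (\<i> * of_real t) \<odot> \<one>) = \<one>"
    "(h \<oplus> (\<i> * of_real t) \<odot> \<one>) \<otimes> u = \<one>"
proof -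
  define s where "s = t + nrm h + 1"
  have s: "t < s" "nrm h < s" "0 < s"
    using \<open>0 < t\<close> nrm_nonneg[OF h(1)] by (auto simp: s_def)
  define i_s where "i_s = \<i> * complex_of_real s"
  have "i_s \<noteq> 0" using s by (simp add: i_s_def)
  let ?x = "(- inverse i_s) \<odot> h"
  have x: "?x \<in> carrier C" using h by (simp add: alg_closed)
  have "nrm ?x < 1"
    using nrm_smult[OF h(1), of "- inverse i_s"] s
    by (simp add: i_s_def norm_mult norm_inverse inverse_eq_divide[symmetric] norm_divide del: inverse_eq_divide)
      (simp add: field_simps)
  then obtain l where l: "l \<in> carrier C" "(\<one> \<ominus> ?x) \<otimes> l = \<one>" "l \<otimes> (\<one> \<ominus> ?x) = \<one>"
    using Neumann_inverse[OF x] by blast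
  have z: "h \<oplus> i_s \<odot> \<one> = i_s \<odot> (\<one> \<ominus> ?x)"
  proof -
    have "i_s \<odot> (\<one> \<ominus> ?x) = i_s \<odot> \<one> \<ominus> (i_s * (- inverse i_s)) \<odot> h"
      by (simp only: smult_diff_right[OF one_closed x] smult_assoc[OF h(1)])
    also have "i_s * (- inverse i_s) = - 1"
      using \<open>i_s \<noteq> 0\<close> by simp
    also have "(- 1) \<odot> h = \<ominus> h"
      using smult_neg_left[OF h(1), of 1] h by (simp add: smult_one)
    also have "i_s \<odot> \<one> \<ominus> \<ominus> h = h \<oplus> i_s \<odot> \<one>"
      using h alg_closed(1)[of \<one> i_s] by algebra
    finally show ?thesis by simp
  qed
  let ?u = "inverse i_s \<odot> l"
  have inv: "k \<odot> (inverse k \<odot> y) = y" "inverse k \<odot> (k \<odot> y) = y" if "k \<noteq> 0" "y \<in> carrier C" for k y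
    using that smult_assoc[of y k "inverse k"] smult_assoc[of y "inverse k" k] by (simp_all add: smult_one)
  have u: "?u \<in> carrier C" "?u \<otimes> (h \<oplus> i_s \<odot> \<one>) = \<one>" "(h \<oplus> i_s \<odot> \<one>) \<otimes> ?u = \<one>"
    unfolding z using l x \<open>i_s \<noteq> 0\<close>
    by (simp_all add: alg_closed smult_mult_left smult_mult_right inv)
  have u_le: "nrm ?u \<le> 1 / s"
    using resolvent_norm_le[OF h s(3)] u unfolding i_s_def by blast
  define d where "d = \<i> * complex_of_real (s - t)"
  have "nrm (d \<odot> ?u) \<le> (s - t) * (1 / s)"
    using nrm_smult[OF u(1), of d] mult_left_mono[OF u_le, of "s - t"] s
    by (simp add: d_def norm_mult del: of_real_diff)
  also have "\<dots> < 1"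
    using s \<open>0 < t\<close> by (simp add: field_simps)
  finally obtain l' where l': "l' \<in> carrier C" "(\<one> \<ominus> d \<odot> ?u) \<otimes> l' = \<one>" "l' \<otimes> (\<one> \<ominus> d \<odot> ?u) = \<one>"
    by (rule Neumann_inverse[OF smult_closed[OF u(1), of d]])
  have "h \<oplus> (\<i> * of_real t) \<odot> \<one> = (h \<oplus> i_s \<odot> \<one>) \<ominus> d \<odot> \<one>"
  proof -
    have "\<i> * of_real t = i_s - d"
      by (simp add: i_s_def d_def algebra_simps)
    then have "(\<i> * of_real t) \<odot> \<one> = i_s \<odot> \<one> \<ominus> d \<odot> \<one>"
      by (simp add: smult_diff_left)
    then show ?thesis
      using h alg_closed(1)[of \<one>] by (simp add: a_minus_def a_assoc)
  qed
  moreover have "(h \<oplus> i_s \<odot> \<one>) \<ominus> d \<odot> \<one> = (h \<oplus> i_s \<odot> \<one>) \<otimes> (\<one> \<ominus> d \<odot> ?u)"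
    using u h alg_closed(1) by (simp add: mult_diff_right smult_mult_right)
  moreover have "(h \<oplus> i_s \<odot> \<one>) \<ominus> d \<odot> \<one> = (\<one> \<ominus> d \<odot> ?u) \<otimes> (h \<oplus> i_s \<odot> \<one>)"
    using u h alg_closed(1) by (simp add: mult_diff_left smult_mult_left)
  moreover have "(?u \<otimes> l') \<otimes> ((\<one> \<ominus> d \<odot> ?u) \<otimes> (h \<oplus> i_s \<odot> \<one>)) = ?u \<otimes> (l' \<otimes> (\<one> \<ominus> d \<odot> ?u)) \<otimes> (h \<oplus> i_s \<odot> \<one>)"
    using u(1) l'(1) h alg_closed(1) by (simp add: m_assoc)
  moreover have "((h \<oplus> i_s \<odot> \<one>) \<otimes> (\<one> \<ominus> d \<odot> ?u)) \<otimes> (l' \<otimes> ?u) = (h \<oplus> i_s \<odot> \<one>) \<otimes> ((\<one> \<ominus> d \<odot> ?u) \<otimes> l') \<otimes> ?u"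
    using u(1) l'(1) h alg_closed(1) by (simp add: m_assoc)
  moreover have "h \<oplus> i_s \<odot> \<one> \<in> carrier C"
    using h alg_closed(1) by simp
  ultimately have r: "(?u \<otimes> l') \<otimes> (h \<oplus> (\<i> * of_real t) \<odot> \<one>) = \<one>"
    "(h \<oplus> (\<i> * of_real t) \<odot> \<one>) \<otimes> (l' \<otimes> ?u) = \<one>"
    using u l' by simp_all
  have "?u \<otimes> l' = l' \<otimes> ?u"
    using inv_unique[OF r] u(1) l'(1) h alg_closed(1) by simp
  then show thesis
    using that[of "?u \<otimes> l'"] r u(1) l'(1) by simp
qed

text \<open>
  The inverse is \<open>u*u\<close> for the resolvent \<open>u\<close> of \<open>h\<close> at \<open>i\<close>, since \<open>(h + i)(h - i) = 1 + h\<^sup>2\<close>.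
\<close>

lemma inverse_one_plus_square:
  assumes h: "h \<in> carrier C" "star C h = h"
  obtains k where "k \<in> carrier C" "k \<otimes> (\<one> \<oplus> h \<otimes> h) = \<one>" "(\<one> \<oplus> h \<otimes> h) \<otimes> k = \<one>" "nrm k \<le> 1"
proof -
  let ?z = "h \<oplus> \<i> \<odot> \<one>" and ?w = "h \<oplus> (- \<i>) \<odot> \<one>"
  obtain u where u: "u \<in> carrier C" "u \<otimes> ?z = \<one>" "?z \<otimes> u = \<one>"
    using resolvent_exists[OF h, of 1] by auto
  have "nrm u \<le> 1"
    using resolvent_norm_le[OF h, of 1 u] u by simp
  have cl: "?z \<in> carrier C" "?w \<in> carrier C" "star C u \<in> carrier C"
    using h u by (auto simp: alg_closed)
  have sz: "star C ?z = ?w"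
    using h by (simp add: star_add star_smult star_one alg_closed)
  have w: "star C u \<otimes> ?w = \<one>" "?w \<otimes> star C u = \<one>"
    using star_mult[of ?z u] star_mult[of u ?z] u cl sz by (simp_all add: star_one)
  have "?z \<otimes> ?w = \<one> \<oplus> h \<otimes> h"
  proof -
    have "?z \<otimes> ?w = h \<otimes> h \<oplus> (- \<i>) \<odot> h \<oplus> (\<i> \<odot> h \<oplus> (\<i> * (- \<i>)) \<odot> \<one>)"
      using h alg_closed(1)
      by (simp add: l_distr r_distr smult_mult_left smult_mult_right smult_assoc[symmetric] smult_r_distr a_ac)
    also have "\<dots> = \<one> \<oplus> h \<otimes> h"
      using h smult_neg_left[OF h(1), of \<i>] alg_closed(1)[of h] by (simp add: smult_one) algebra
    finally show ?thesis .
  qed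
  moreover have "(star C u \<otimes> u) \<otimes> (?z \<otimes> ?w) = star C u \<otimes> (u \<otimes> ?z) \<otimes> ?w"
    "(?z \<otimes> ?w) \<otimes> (star C u \<otimes> u) = ?z \<otimes> (?w \<otimes> star C u) \<otimes> u"
    using cl u(1) by (simp_all add: m_assoc)
  ultimately have "(star C u \<otimes> u) \<otimes> (\<one> \<oplus> h \<otimes> h) = \<one>" "(\<one> \<oplus> h \<otimes> h) \<otimes> (star C u \<otimes> u) = \<one>"
    using u w cl by simp_all
  moreover have "nrm (star C u \<otimes> u) \<le> 1"
    using p_regular[of u] u(1) \<open>nrm u \<le> 1\<close> nrm_nonneg[of u] by (simp add: power_le_one)
  ultimately show thesis
    using that[of "star C u \<otimes> u"] u(1) cl by simp
qed

end

lemma complex_Cstar_iff: "complex_Cstar_algebra C N \<longleftrightarrow> complex_Cstar C N"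
proof
  assume "complex_Cstar_algebra C N"
  then interpret banach_star_algebra cnj C N
    by (simp add: complex_Cstar_algebra_def)
  show "complex_Cstar C N"
    by unfold_locales (use \<open>complex_Cstar_algebra C N\<close> in \<open>auto simp: complex_Cstar_algebra_def regular_on_def\<close>)
next
  assume "complex_Cstar C N"
  then interpret complex_Cstar C N .
  show "complex_Cstar_algebra C N"
    using banach_star_algebra_axioms p_regular by (auto simp: complex_Cstar_algebra_def regular_on_def)
qed

section \<open>Seminorms dominated by a C*-norm\<close>

text \<open>For a nonzero scalar the converse inequality comes from its inverse.\<close>

lemma homogeneous_of_le:
  assumes "star_algebra c D" and z: "z \<in> carrier D"
    and le: "\<And>k w. w \<in> carrier D \<Longrightarrow> f (k \<odot>\<^bsub>D\<^esub> w) \<le> norm k * f w"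
    and nonneg: "\<And>w. w \<in> carrier D \<Longrightarrow> (0::real) \<le> f w"
  shows "f (k \<odot>\<^bsub>D\<^esub> z) = norm k * f z"
proof (cases "k = 0")
  case True
  interpret star_algebra c D by fact
  show ?thesis using True le[OF z, of 0] nonneg[OF smult_closed[OF z, of 0]] by simp
next
  case False
  interpret star_algebra c D by fact
  have "inverse k \<odot>\<^bsub>D\<^esub> (k \<odot>\<^bsub>D\<^esub> z) = z"
    using smult_assoc[OF z, of "inverse k" k] smult_one[OF z] False by simp
  then have "f z \<le> norm (inverse k) * f (k \<odot>\<^bsub>D\<^esub> z)"
    using le[OF smult_closed[OF z], of "inverse k" k] by simp
  then have "norm k * f z \<le> f (k \<odot>\<^bsub>D\<^esub> z)"
    using False by (simp add: norm_inverse norm_divide field_simps)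
  then show ?thesis using le[OF z, of k] by simp
qed

lemma power_power2_tendsto_zero:
  fixes c :: real
  assumes "0 \<le> c" "c < 1"
  shows "(\<lambda>j. c ^ (2 ^ j)) \<longlonglongrightarrow> 0"
proof -
  have "strict_mono (\<lambda>j. 2 ^ j :: nat)"
    by (simp add: strict_mono_Suc_iff)
  from LIMSEQ_subseq_LIMSEQ[OF LIMSEQ_power_zero this, of c] show ?thesis
    using assms by (simp add: o_def)
qed

text \<open>
  In the application \<open>p\<close> is the sum of a seminorm of the two components in a complexification. Such a
  sum is homogeneous over the reals only.
\<close>

locale dominated_seminorm = complex_Cstar C nrm + p: alg_seminorm cnj C p
  for C :: "(complex, 'a) star_alg" (structure) and nrm p +
  fixes K D :: real
  assumes K_nonneg: "0 \<le> K" and D_nonneg: "0 \<le> D"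
    and p_le: "x \<in> carrier C \<Longrightarrow> p x \<le> K * nrm x"
    and p_star_le: "x \<in> carrier C \<Longrightarrow> p (star C x) \<le> D * p x"
    and p_smult: "x \<in> carrier C \<Longrightarrow> p (of_real t \<odot> x) = \<bar>t\<bar> * p x"
begin

text \<open>
  The element is \<open>y = x k\<close> with \<open>k = (1 + h\<^sup>n)\<^sup>-\<^sup>1\<close> and \<open>h = x*x\<close>; as \<open>n\<close> is even, \<open>h\<^sup>n\<close> is the square
  of a selfadjoint element. Then \<open>x - y = x h\<^sup>n k\<close> is small for \<open>p\<close> when \<open>p(h\<^sup>n)\<close> is. For the norm,
  \<open>y*y = h k\<^sup>2\<close> is selfadjoint and its \<open>n\<close>-th power is \<open>h\<^sup>n k \<cdot> k\<^sup>2\<^sup>n\<^sup>-\<^sup>1 = (1 - k) k\<^sup>2\<^sup>n\<^sup>-\<^sup>1\<close>, of norm at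
  most 2; the exponent is a power of 2, so the C*-identity gives the \<open>n\<close>-th root of this bound for
  \<open>\<parallel>y\<parallel>\<^sup>2\<close>.
\<close>

lemma damped_element:
  assumes x: "x \<in> carrier C" and n: "n = 2 ^ Suc j"
  obtains y where "y \<in> carrier C" "p (x \<ominus> y) \<le> p x * p ((star C x \<otimes> x) [^] n) * K"
    "nrm y ^ (2 * n) \<le> 2"
proof -
  define h where "h = star C x \<otimes> x"
  have h: "h \<in> carrier C" "star C h = h"
    using x by (simp_all add: h_def star_mult star_star star_closed)
  define w where "w = h [^] ((2::nat) ^ j)"
  have w: "w \<in> carrier C" "star C w = w"
    using h by (simp_all add: w_def star_pow)
  have ww: "w \<otimes> w = h [^] n"
    using nat_pow_mult[of h "2 ^ j" "2 ^ j"] h by (simp add: w_def n mult_2)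
  obtain k where k: "k \<in> carrier C" "k \<otimes> (\<one> \<oplus> h [^] n) = \<one>" "(\<one> \<oplus> h [^] n) \<otimes> k = \<one>" "nrm k \<le> 1"
    using inverse_one_plus_square[OF w] unfolding ww by blast
  have star_k: "star C k = k"
    using star_inverse[of "\<one> \<oplus> h [^] n" k] k h by (simp add: star_add star_one star_pow)
  have "h \<otimes> h [^] n = h [^] n \<otimes> h"
    using nat_pow_Suc2[of h n] h by simp
  then have hn: "h \<otimes> (\<one> \<oplus> h [^] n) = (\<one> \<oplus> h [^] n) \<otimes> h"
    using h by (simp add: l_distr r_distr)
  \<comment> \<open>An inverse commutes with everything that commutes with the element.\<close>
  have kh: "k \<otimes> h = h \<otimes> k"
  proof -
    have "k \<otimes> h = k \<otimes> (h \<otimes> (\<one> \<oplus> h [^] n)) \<otimes> k"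
      using k h by (simp add: m_assoc)
    also have "\<dots> = (k \<otimes> (\<one> \<oplus> h [^] n)) \<otimes> (h \<otimes> k)"
      unfolding hn using k(1) h by (simp add: m_assoc)
    finally show ?thesis using k h by simp
  qed
  have one_k: "h [^] n \<otimes> k = \<one> \<ominus> k"
  proof -
    have "h [^] n \<otimes> k = (\<one> \<oplus> h [^] n) \<otimes> k \<ominus> k"
      using k(1) h nat_pow_closed[of h n] by algebra
    then show ?thesis using k by simp
  qed
  define y where "y = x \<otimes> k"
  have y: "y \<in> carrier C" using x k by (simp add: y_def)
  have "x \<ominus> y = x \<otimes> (h [^] n \<otimes> k)"
    unfolding one_k using x k(1) by (simp add: y_def mult_diff_right)
  then have "p (x \<ominus> y) \<le> p x * p (h [^] n \<otimes> k)"
    using p.p_mult[of x "h [^] n \<otimes> k"] x h k(1) by simp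
  also have "\<dots> \<le> p x * (p (h [^] n) * K)"
  proof (intro mult_left_mono)
    have "p k \<le> K"
      using p_le[OF k(1)] k(4) K_nonneg mult_left_mono[of "nrm k" 1 K] by simp
    then show "p (h [^] n \<otimes> k) \<le> p (h [^] n) * K"
      using p.p_mult[of "h [^] n" k] h k(1) p.p_nonneg[of "h [^] n"]
        mult_left_mono[of "p k" K "p (h [^] n)"] by simp
  qed (use x p.p_nonneg in auto)
  finally have le: "p (x \<ominus> y) \<le> p x * p (h [^] n) * K"
    by (simp add: mult.assoc)
  define v where "v = star C y \<otimes> y"
  have v: "v \<in> carrier C" "star C v = v"
    using y by (simp_all add: v_def star_mult star_star star_closed)
  have "v = k \<otimes> h \<otimes> k"
    using x k(1) star_k by (simp add: v_def y_def h_def star_mult star_closed m_assoc)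
  then have v_eq: "v = h \<otimes> (k \<otimes> k)"
    using kh k(1) h by (simp add: m_assoc)
  have "v [^] n = h [^] n \<otimes> (k \<otimes> k) [^] n"
    unfolding v_eq using pow_mult_distrib[of h "k \<otimes> k" n] kh k(1) h by (metis m_assoc m_closed)
  also have "(k \<otimes> k) [^] n = k [^] n \<otimes> k [^] n"
    using pow_mult_distrib[of k k n] k(1) by simp
  also have "k [^] n = k \<otimes> k [^] (n - 1)"
    using nat_pow_Suc2[of k "n - 1"] k(1) by (simp add: n)
  finally have "v [^] n = (\<one> \<ominus> k) \<otimes> (k [^] (n - 1) \<otimes> (k \<otimes> k [^] (n - 1)))"
    unfolding one_k[symmetric] using k(1) h by (simp add: m_assoc)
  moreover have pk: "nrm (k [^] i) \<le> 1" for i :: nat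
    using p_pow'[of k i] k power_le_one[of "nrm k" i] nrm_nonneg[of k] by simp
  moreover have "nrm (\<one> \<ominus> k) \<le> 2"
    using p_diff_le[of \<one> k] k p_one_le by simp
  ultimately have "nrm (v [^] n) \<le> 2 * (1 * (1 * 1))"
    using k(1,4) pk[of "n - 1"]
    by (simp only:) (intro order.trans[OF p_mult] mult_mono nrm_nonneg m_closed nat_pow_closed minus_closed one_closed; simp add: nrm_nonneg)
  then have "(nrm y ^ 2) ^ n \<le> 2"
    using p_selfadjoint_pow[OF v, of "Suc j"] p_regular[OF y] by (simp add: v_def n)
  then have "nrm y ^ (2 * n) \<le> 2"
    by (simp add: power_mult)
  with that[OF y] le show thesis
    by (simp add: h_def)
qed

text \<open>
  Since \<open>\<parallel>y\<parallel>\<^sup>2\<^sup>n \<le> 2\<close>, the norm is at most \<open>1 + d\<close> for large \<open>n\<close> by Bernoulli's inequality.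
\<close>

lemma approximation_normalised:
  assumes x: "x \<in> carrier C" and lim: "(\<lambda>j. p ((star C x \<otimes> x) [^] ((2::nat) ^ j))) \<longlonglongrightarrow> 0" and "0 < d"
  obtains y where "y \<in> carrier C" "p (x \<ominus> y) < d" "nrm y \<le> 1 + d"
proof -
  have "(\<lambda>j. p x * p ((star C x \<otimes> x) [^] ((2::nat) ^ Suc j)) * K) \<longlonglongrightarrow> p x * 0 * K"
    by (intro tendsto_intros LIMSEQ_Suc[OF lim])
  then have "\<forall>\<^sub>F j in sequentially. p x * p ((star C x \<otimes> x) [^] ((2::nat) ^ Suc j)) * K < d"
    using \<open>0 < d\<close> by (intro order_tendstoD) auto
  moreover obtain N where N: "1 / d < 2 ^ N"
    using real_arch_pow[of 2 "1 / d"] by auto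
  have "\<forall>\<^sub>F j in sequentially. 1 / d < 2 ^ j"
    using N by (intro eventually_sequentiallyI[of N]) (erule order.strict_trans2, simp)
  ultimately have "\<forall>\<^sub>F j in sequentially.
      p x * p ((star C x \<otimes> x) [^] ((2::nat) ^ Suc j)) * K < d \<and> 1 / d < 2 ^ j"
    by (rule eventually_conj)
  then obtain j where j: "p x * p ((star C x \<otimes> x) [^] ((2::nat) ^ Suc j)) * K < d" "1 / d < 2 ^ j"
    by (auto simp: eventually_sequentially)
  obtain y where y: "y \<in> carrier C" "nrm y ^ (2 * 2 ^ Suc j) \<le> 2"
    "p (x \<ominus> y) \<le> p x * p ((star C x \<otimes> x) [^] ((2::nat) ^ Suc j)) * K"
    using damped_element[OF x refl, of j] by blast
  have "nrm y \<le> 1 + d"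
  proof (rule ccontr)
    assume "\<not> nrm y \<le> 1 + d"
    then have "(1 + d) ^ (2 * 2 ^ Suc j) \<le> 2"
      using power_mono[of "1 + d" "nrm y" "2 * 2 ^ Suc j"] \<open>0 < d\<close> y(2) by linarith
    moreover have "1 + real (2 * 2 ^ Suc j) * d \<le> (1 + d) ^ (2 * 2 ^ Suc j)"
      using Bernoulli_inequality[of d "2 * 2 ^ Suc j"] \<open>0 < d\<close> by (simp add: mult.commute)
    moreover have "1 < 2 ^ j * d"
      using j(2) \<open>0 < d\<close> by (simp add: field_simps)
    ultimately show False by simp
  qed
  then show thesis
    using that y j(1) by fastforce
qed

lemma approximation:
  assumes x: "x \<in> carrier C" and "0 < s" "0 < d"
    and lim: "(\<lambda>j. p ((star C x \<otimes> x) [^] ((2::nat) ^ j)) / (s\<^sup>2) ^ (2 ^ j)) \<longlonglongrightarrow> 0"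
  obtains y where "y \<in> carrier C" "p (x \<ominus> y) < d" "nrm y \<le> s * (1 + d)"
proof -
  let ?t = "complex_of_real (1 / s)"
  let ?x = "?t \<odot> x"
  have h: "star C x \<otimes> x \<in> carrier C" using x by (simp add: star_closed)
  have sq: "star C ?x \<otimes> ?x = of_real ((1 / s)\<^sup>2) \<odot> (star C x \<otimes> x)"
    using x by (simp add: star_smult smult_mult_left smult_mult_right alg_closed smult_assoc[symmetric]
        power2_eq_square)
  have pow: "(of_real c \<odot> u) [^] (n::nat) = of_real (c ^ n) \<odot> (u [^] n)" if "u \<in> carrier C" for c u n
  proof (induction n)
    case 0
    show ?case by (simp add: smult_one)
  next
    case (Suc n)
    then show ?case
      using that by (simp add: smult_mult_left smult_mult_right alg_closed smult_assoc[symmetric] mult.commute)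
  qed
  have "p ((star C ?x \<otimes> ?x) [^] ((2::nat) ^ j)) = \<bar>((1 / s)\<^sup>2) ^ (2 ^ j)\<bar> * p ((star C x \<otimes> x) [^] ((2::nat) ^ j))"
    for j
    unfolding sq pow[OF h] by (rule p_smult) (simp add: h)
  then have "p ((star C ?x \<otimes> ?x) [^] ((2::nat) ^ j)) = p ((star C x \<otimes> x) [^] ((2::nat) ^ j)) / (s\<^sup>2) ^ (2 ^ j)"
    for j
    by (simp add: power_divide)
  then have "(\<lambda>j. p ((star C ?x \<otimes> ?x) [^] ((2::nat) ^ j))) \<longlonglongrightarrow> 0"
    using lim by simp
  moreover define d' where "d' = min d (d / s)"
  moreover have "0 < d'" "d' \<le> d" "s * d' \<le> d"
    using \<open>0 < s\<close> \<open>0 < d\<close> by (auto simp: d'_def min_def field_simps)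
  ultimately obtain y where y: "y \<in> carrier C" "p (?x \<ominus> y) < d'" "nrm y \<le> 1 + d'"
    using approximation_normalised[of ?x d'] x alg_closed(1) by blast
  let ?y = "complex_of_real s \<odot> y"
  have "complex_of_real s \<odot> ?x = x"
    using x smult_assoc[OF x, of "of_real s" ?t] \<open>0 < s\<close> by (simp add: smult_one)
  then have "p (x \<ominus> ?y) = s * p (?x \<ominus> y)"
    using p_smult[of "?x \<ominus> y" s] smult_diff_right[of ?x y "of_real s"] x y(1) \<open>0 < s\<close> alg_closed(1)[of x ?t] by simp
  also have "\<dots> < s * d'"
    using y(2) \<open>0 < s\<close> by simp
  finally have "p (x \<ominus> ?y) < d" using \<open>s * d' \<le> d\<close> by simp
  moreover have "nrm ?y \<le> s * (1 + d)"
    using nrm_smult[OF y(1), of "of_real s"] y(3) \<open>0 < s\<close> \<open>d' \<le> d\<close> by (simp add: mult_left_mono)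
  ultimately show thesis
    using that[of ?y] y(1) alg_closed(1) by blast
qed

text \<open>
  As \<open>p(x*x) \<le> D p(x)\<^sup>2\<close>, the quotients are bounded by powers of a number below 1.
\<close>

lemma power_quotients_tendsto_zero:
  assumes x: "x \<in> carrier C" and "0 < s" "D * (p x)\<^sup>2 < s\<^sup>2"
  shows "(\<lambda>j. p ((star C x \<otimes> x) [^] ((2::nat) ^ j)) / (s\<^sup>2) ^ (2 ^ j)) \<longlonglongrightarrow> 0"
proof (rule real_tendsto_sandwich[OF _ _ tendsto_const])
  let ?c = "D * (p x)\<^sup>2 / s\<^sup>2"
  have c: "0 \<le> ?c" "?c < 1"
    using assms D_nonneg by simp_all
  show "(\<lambda>j. ?c ^ (2 ^ j)) \<longlonglongrightarrow> 0"
    using c by (rule power_power2_tendsto_zero)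
  have h: "star C x \<otimes> x \<in> carrier C" using x by (simp add: star_closed)
  have "p (star C x \<otimes> x) \<le> D * p x * p x"
    using p.p_mult[of "star C x" x] x p_star_le[OF x] mult_right_mono[OF p_star_le[OF x], of "p x"] p.p_nonneg[OF x]
    by (simp add: star_closed)
  then have "p ((star C x \<otimes> x) [^] ((2::nat) ^ j)) \<le> (D * (p x)\<^sup>2) ^ (2 ^ j)" for j
    by (intro order.trans[OF p.p_pow[OF h] power_mono] p.p_nonneg[OF h])
      (simp_all add: power2_eq_square mult.assoc)
  then show "\<forall>\<^sub>F j in sequentially. p ((star C x \<otimes> x) [^] ((2::nat) ^ j)) / (s\<^sup>2) ^ (2 ^ j) \<le> ?c ^ (2 ^ j)"
    using \<open>0 < s\<close> by (intro always_eventually allI) (simp add: power_divide divide_right_mono)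
qed (use x p.p_nonneg star_closed in \<open>auto intro!: always_eventually\<close>)

text \<open>
  Successive approximation as in the open mapping theorem: an approximation error of size \<open>e / 2\<^sup>n\<close> for
  \<open>p\<close> is itself approximated by an element of norm \<open>O(e / 2\<^sup>n)\<close>, and the sum of these elements converges
  in norm.
\<close>

lemma null_representative:
  assumes x: "x \<in> carrier C" and "0 < e" "p x < e"
  obtains y where "y \<in> carrier C" "p (x \<ominus> y) = 0" "nrm y \<le> 4 * (D + 1) * e"
proof -
  define P where "P n s \<longleftrightarrow> s \<in> carrier C \<and> p (x \<ominus> s) < e / 2 ^ n \<and> (n = 0 \<longrightarrow> s = \<zero>)" for n :: nat and s
  have "\<exists>s. \<forall>n. P n (s n) \<and> nrm (s (Suc n) \<ominus> s n) \<le> 2 * (D + 1) * e * (1 / 2) ^ n"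
  proof (rule dependent_nat_choice)
    show "\<exists>s. P 0 s"
      using assms by (intro exI[of _ \<zero>]) (simp add: P_def a_minus_def)
  next
    fix s n assume "P n s"
    then have s: "s \<in> carrier C" "p (x \<ominus> s) < e / 2 ^ n" by (simp_all add: P_def)
    \<comment> \<open>The radius exceeds \<open>sqrt D * (e / 2 ^ n)\<close> since \<open>D < (D + 1)\<^sup>2\<close>.\<close>
    let ?r = "(D + 1) * (e / 2 ^ n)"
    have pos: "0 < e / 2 ^ n" "0 < ?r" using \<open>0 < e\<close> D_nonneg by simp_all
    have "D * (p (x \<ominus> s))\<^sup>2 \<le> D * (e / 2 ^ n)\<^sup>2"
      using s x D_nonneg p.p_nonneg[of "x \<ominus> s"] by (intro mult_left_mono power_mono) auto
    also have "\<dots> < (D + 1)\<^sup>2 * (e / 2 ^ n)\<^sup>2"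
    proof (rule mult_strict_right_mono)
      have "(D + 1)\<^sup>2 = D + (D * D + D + 1)"
        by (simp add: power2_eq_square algebra_simps)
      then show "D < (D + 1)\<^sup>2"
        using D_nonneg by (simp add: add_nonneg_pos)
    qed (use pos(1) in \<open>auto simp: zero_less_power2\<close>)
    finally have "D * (p (x \<ominus> s))\<^sup>2 < ?r\<^sup>2"
      by (simp add: power_mult_distrib power_divide)
    then obtain y where y: "y \<in> carrier C" "p (x \<ominus> s \<ominus> y) < min 1 (e / 2 ^ Suc n)"
      "nrm y \<le> ?r * (1 + min 1 (e / 2 ^ Suc n))"
      using approximation[OF _ pos(2) _ power_quotients_tendsto_zero[OF _ pos(2)], of "x \<ominus> s" "min 1 (e / 2 ^ Suc n)"]
        x s(1) \<open>0 < e\<close> by auto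
    have "nrm y \<le> ?r * 2"
      using y(3) pos(2) by (elim order.trans) (intro mult_left_mono, auto)
    moreover have "s \<oplus> y \<ominus> s = y" "x \<ominus> (s \<oplus> y) = x \<ominus> s \<ominus> y"
      using s(1) y(1) x by algebra+
    ultimately show "\<exists>t. P (Suc n) t \<and> nrm (t \<ominus> s) \<le> 2 * (D + 1) * e * (1 / 2) ^ n"
      using s(1) y(1,2) by (intro exI[of _ "s \<oplus> y"]) (simp add: P_def power_divide mult_ac)
  qed
  then obtain s where s: "\<And>n. P n (s n)" "\<And>n. nrm (s (Suc n) \<ominus> s n) \<le> 2 * (D + 1) * e * (1 / 2) ^ n"
    by blast
  have sc: "s n \<in> carrier C" and s0: "s 0 = \<zero>" and sp: "p (x \<ominus> s n) < e / 2 ^ n" for n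
    using s(1)[of n] s(1)[of 0] by (auto simp: P_def)
  obtain l where l: "l \<in> carrier C" "\<And>n. nrm (s n \<ominus> l) \<le> 2 * (D + 1) * e / (1 - 1 / 2) * (1 / 2) ^ n"
    "(\<lambda>n. nrm (s n \<ominus> l)) \<longlonglongrightarrow> 0"
    using Cauchy_limit[OF sc _ _ s(2)] by auto
  have "nrm l \<le> 4 * (D + 1) * e"
    using l(2)[of 0] l(1) s0 p_neg[OF l(1)] by (simp add: a_minus_def algebra_simps)
  moreover have "p (x \<ominus> l) \<le> 0"
  proof (rule tendsto_le[OF sequentially_bot _ tendsto_const])
    have "(\<lambda>n. e * (1 / 2) ^ n + K * nrm (s n \<ominus> l)) \<longlonglongrightarrow> e * 0 + K * 0"
      by (intro tendsto_intros l(3) LIMSEQ_power_zero) auto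
    then show "(\<lambda>n. e * (1 / 2) ^ n + K * nrm (s n \<ominus> l)) \<longlonglongrightarrow> 0" by simp
    show "\<forall>\<^sub>F n in sequentially. p (x \<ominus> l) \<le> e * (1 / 2) ^ n + K * nrm (s n \<ominus> l)"
    proof (intro always_eventually allI)
      fix n
      show "p (x \<ominus> l) \<le> e * (1 / 2) ^ n + K * nrm (s n \<ominus> l)"
        using p.p_dist_triangle[OF x sc[of n] l(1)] sp[of n] p_le[of "s n \<ominus> l"] sc[of n] l(1)
        by (simp add: power_divide)
    qed
  qed
  then have "p (x \<ominus> l) = 0"
    using p.p_nonneg[of "x \<ominus> l"] x l(1) by simp
  ultimately show thesis using that l(1) by blast
qed

text \<open>
  The approximation for \<open>p\<close> is made exact by adding a representative of the error, whose norm is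
  controlled by the error.
\<close>

lemma representative_of_power_limit:
  assumes x: "x \<in> carrier C" and "0 < s" "s < t"
    and lim: "(\<lambda>j. p ((star C x \<otimes> x) [^] ((2::nat) ^ j)) / (s\<^sup>2) ^ (2 ^ j)) \<longlonglongrightarrow> 0"
  obtains y where "y \<in> carrier C" "p (x \<ominus> y) = 0" "nrm y \<le> t"
proof -
  \<comment> \<open>Chosen such that the norms of the approximation and of the correction add up to \<open>t\<close>.\<close>
  define d where "d = (t - s) / (s + 4 * (D + 1))"
  have den: "0 < s + 4 * (D + 1)" using \<open>0 < s\<close> D_nonneg by simp
  have "d * (s + 4 * (D + 1)) = t - s"
    using den by (simp add: d_def)
  then have d2: "s * (1 + d) + 4 * (D + 1) * d = t"
    by (simp add: algebra_simps)
  have d1: "0 < d"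
    using den assms(3) by (simp add: d_def)
  note d = d1 d2
  obtain y where y: "y \<in> carrier C" "p (x \<ominus> y) < d" "nrm y \<le> s * (1 + d)"
    using approximation[OF x \<open>0 < s\<close> d(1) lim] by blast
  obtain z where z: "z \<in> carrier C" "p (x \<ominus> y \<ominus> z) = 0" "nrm z \<le> 4 * (D + 1) * d"
    using null_representative[OF _ d(1) y(2)] x y(1) by blast
  have "x \<ominus> (y \<oplus> z) = x \<ominus> y \<ominus> z"
    using x y(1) z(1) by algebra
  moreover have "nrm (y \<oplus> z) \<le> t"
    using p_triangle[of y z] y z d(2) by simp
  ultimately show thesis
    using that[of "y \<oplus> z"] y(1) z(1,2) by simp
qed

text \<open>
  Hence the quotient norm modulo the kernel of \<open>p\<close> is at most \<open>sqrt D * p\<close>: this is how a C*-norm is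
  minimal among algebra norms.
\<close>

lemma representative_of_small_seminorm:
  assumes x: "x \<in> carrier C" and "sqrt D * p x < t"
  obtains y where "y \<in> carrier C" "p (x \<ominus> y) = 0" "nrm y \<le> t"
proof -
  obtain s where s: "sqrt D * p x < s" "s < t"
    using dense[OF assms(2)] by blast
  have "0 \<le> sqrt D * p x" using D_nonneg p.p_nonneg[OF x] by simp
  then have "0 < s" "(sqrt D * p x)\<^sup>2 < s\<^sup>2"
    using s by (auto intro!: power_strict_mono)
  then have "D * (p x)\<^sup>2 < s\<^sup>2"
    using D_nonneg by (simp add: power_mult_distrib)
  then show thesis
    using representative_of_power_limit[OF x \<open>0 < s\<close> s(2) power_quotients_tendsto_zero[OF x \<open>0 < s\<close>]] that by blast
qed

text \<open>
  This is the nontrivial half of the C*-identity for the quotient norm \<open>q\<close>, namely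
  \<open>q(x)\<^sup>2 \<le> q(x*x)\<close>. If \<open>w\<close> represents \<open>x*x\<close>, then \<open>p((x*x)\<^sup>n) = p(w\<^sup>n) \<le> K \<parallel>w\<parallel>\<^sup>n\<close>, so the hypothesis
  of the previous construction holds for every \<open>s\<close> with \<open>s\<^sup>2 > \<parallel>w\<parallel>\<close>.
\<close>

lemma representative_of_small_square:
  assumes x: "x \<in> carrier C" and w: "w \<in> carrier C" "p (star C x \<otimes> x \<ominus> w) = 0" and "sqrt (nrm w) < t"
  obtains y where "y \<in> carrier C" "p (x \<ominus> y) = 0" "nrm y \<le> t"
proof -
  obtain s where s: "sqrt (nrm w) < s" "s < t"
    using dense[OF assms(4)] by blast
  have "0 \<le> nrm w" using w nrm_nonneg by simp
  then have "0 < s" using s(1) by (meson le_less_trans real_sqrt_ge_zero)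
  have "nrm w < s\<^sup>2"
    using s(1) \<open>0 < s\<close> by (metis less_eq_real_def real_sqrt_less_iff real_sqrt_unique)
  have h: "star C x \<otimes> x \<in> carrier C" using x by (simp add: star_closed)
  have pow_cong: "p ((star C x \<otimes> x) [^] n \<ominus> w [^] n) = 0" for n :: nat
  proof (induction n)
    case 0
    show ?case by (simp add: p.p_minus_self)
  next
    case (Suc n)
    let ?h = "star C x \<otimes> x"
    have "?h [^] Suc n \<ominus> w [^] Suc n = (?h [^] n \<ominus> w [^] n) \<otimes> ?h \<oplus> w [^] n \<otimes> (?h \<ominus> w)"
      unfolding nat_pow_Suc using h w(1) nat_pow_closed[OF h, of n] nat_pow_closed[OF w(1), of n] by algebra
    then have "p (?h [^] Suc n \<ominus> w [^] Suc n) \<le> p (?h [^] n \<ominus> w [^] n) * p ?h + p (w [^] n) * p (?h \<ominus> w)"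
      using h w(1) p.p_triangle[of "(?h [^] n \<ominus> w [^] n) \<otimes> ?h" "w [^] n \<otimes> (?h \<ominus> w)"]
        p.p_mult[of "?h [^] n \<ominus> w [^] n" ?h] p.p_mult[of "w [^] n" "?h \<ominus> w"] by simp
    then show ?case
      using Suc w h p.p_nonneg[of "?h [^] Suc n \<ominus> w [^] Suc n"] by simp
  qed
  have "(\<lambda>j. p ((star C x \<otimes> x) [^] ((2::nat) ^ j)) / (s\<^sup>2) ^ (2 ^ j)) \<longlonglongrightarrow> 0"
  proof (rule real_tendsto_sandwich[OF _ _ tendsto_const])
    let ?c = "nrm w / s\<^sup>2"
    have c: "0 \<le> ?c" "?c < 1"
      using \<open>nrm w < s\<^sup>2\<close> \<open>0 \<le> nrm w\<close> \<open>0 < s\<close> by auto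
    have "(\<lambda>j. ?c ^ (2 ^ j)) \<longlonglongrightarrow> 0"
      using c by (rule power_power2_tendsto_zero)
    then show "(\<lambda>j. K * ?c ^ (2 ^ j)) \<longlonglongrightarrow> 0"
      using tendsto_mult_right_zero by blast
    have "p ((star C x \<otimes> x) [^] n) \<le> K * nrm w ^ n" for n :: nat
    proof -
      have "p ((star C x \<otimes> x) [^] n) = p (w [^] n)"
        using p.p_cong[OF _ _ pow_cong[of n]] h w(1) by simp
      also have "\<dots> \<le> K * nrm w ^ n"
        using p_le[of "w [^] n"] p_pow'[of w n] w(1) K_nonneg
        by (meson mult_left_mono nat_pow_closed order.trans)
      finally show ?thesis .
    qed
    then show "\<forall>\<^sub>F j in sequentially. p ((star C x \<otimes> x) [^] ((2::nat) ^ j)) / (s\<^sup>2) ^ (2 ^ j) \<le> K * ?c ^ (2 ^ j)"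
      using \<open>0 < s\<close> by (intro always_eventually allI) (simp add: power_divide divide_right_mono)
  qed (use h p.p_nonneg in \<open>auto intro!: always_eventually\<close>)
  then show thesis
    using representative_of_power_limit[OF x \<open>0 < s\<close> s(2)] that by blast
qed

end

section \<open>Real C*-algebras through conjugation-invariant norms\<close>

text \<open>
  The real part is half the sum of \<open>(x, y)\<close> and its conjugate, and multiplication by \<open>-i\<close> exchanges
  the two parts up to sign.
\<close>

lemma conjugation_invariant_norm:
  assumes R: "real_star_algebra R"
    and triangle: "\<And>z w. z \<in> carrier (complexification R) \<Longrightarrow> w \<in> carrier (complexification R) \<Longrightarrow>
      N (z \<oplus>\<^bsub>complexification R\<^esub> w) \<le> N z + N w"
    and homogeneous: "\<And>z k. z \<in> carrier (complexification R) \<Longrightarrow>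
      N (k \<odot>\<^bsub>complexification R\<^esub> z) = cmod k * N z"
    and conj: "\<And>x y. x \<in> carrier R \<Longrightarrow> y \<in> carrier R \<Longrightarrow> N (x, \<ominus>\<^bsub>R\<^esub> y) = N (x, y)"
    and x: "x \<in> carrier R" and y: "y \<in> carrier R"
  shows "N (x, \<zero>\<^bsub>R\<^esub>) \<le> N (x, y)" and "N (y, \<zero>\<^bsub>R\<^esub>) \<le> N (x, y)"
    and "N (x, y) \<le> N (x, \<zero>\<^bsub>R\<^esub>) + N (y, \<zero>\<^bsub>R\<^esub>)"
proof -
  interpret star_algebra "\<lambda>t. t" R by (rule R)
  have re: "N (x, \<zero>\<^bsub>R\<^esub>) \<le> N (x, y)" if "x \<in> carrier R" "y \<in> carrier R" for x y
  proof -
    have "(x, y) \<oplus>\<^bsub>complexification R\<^esub> (x, \<ominus>\<^bsub>R\<^esub> y) = of_real 2 \<odot>\<^bsub>complexification R\<^esub> (x, \<zero>\<^bsub>R\<^esub>)"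
      using that smult_l_distr[of x 1 1] complexification_embed(4)[OF R, of x x 2]
      by (simp add: r_neg smult_one del: of_real_numeral)
    then have "2 * N (x, \<zero>\<^bsub>R\<^esub>) \<le> N (x, y) + N (x, \<ominus>\<^bsub>R\<^esub> y)"
      using triangle[of "(x, y)" "(x, \<ominus>\<^bsub>R\<^esub> y)"] homogeneous[of "(x, \<zero>\<^bsub>R\<^esub>)" "of_real 2"] that
      by (simp del: complexification_simps(5,6))
    then show ?thesis
      using conj that by simp
  qed
  then show "N (x, \<zero>\<^bsub>R\<^esub>) \<le> N (x, y)" using x y .
  have rot: "N (y, \<ominus>\<^bsub>R\<^esub> x) = N (x, y)" if "x \<in> carrier R" "y \<in> carrier R" for x y
    using that homogeneous[of "(x, y)" "- \<i>"]
    by (simp add: smult_zero_left smult_neg_left smult_one a_minus_def)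
  show "N (y, \<zero>\<^bsub>R\<^esub>) \<le> N (x, y)"
    using re[of y "\<ominus>\<^bsub>R\<^esub> x"] rot[of x y] x y by simp
  show "N (x, y) \<le> N (x, \<zero>\<^bsub>R\<^esub>) + N (y, \<zero>\<^bsub>R\<^esub>)"
    using triangle[of "(x, \<zero>\<^bsub>R\<^esub>)" "(\<zero>\<^bsub>R\<^esub>, y)"] rot[of "\<zero>\<^bsub>R\<^esub>" y] x y by simp
qed

text \<open>
  A real C*-algebra together with a C*-norm on its complexification that is invariant under
  conjugation; \<open>N (x, \<zero>)\<close> is the norm of the real algebra.
\<close>

locale real_Cstar_pair = star_algebra "\<lambda>t. t" R
  for R :: "(real, 'a) star_alg" (structure) +
  fixes N :: "'a \<times> 'a \<Rightarrow> real"
  assumes complex_Cstar: "complex_Cstar (complexification R) N"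
    and N_conj: "\<lbrakk>x \<in> carrier R; y \<in> carrier R\<rbrakk> \<Longrightarrow> N (x, \<ominus> y) = N (x, y)"
begin

sublocale C: complex_Cstar "complexification R" N
  by (rule complex_Cstar)

lemmas real_part_le = conjugation_invariant_norm(1)
    [OF star_algebra_axioms C.nrm_triangle C.nrm_smult N_conj, simplified]
  and imaginary_part_le = conjugation_invariant_norm(2)
    [OF star_algebra_axioms C.nrm_triangle C.nrm_smult N_conj, simplified]
  and N_le_sum = conjugation_invariant_norm(3)
    [OF star_algebra_axioms C.nrm_triangle C.nrm_smult N_conj, simplified]

text \<open>
  If \<open>(u, v)\<close> inverts a real element in the complexification, then already \<open>u\<close> inverts it in the real
  algebra, and \<open>u\<close> is bounded by the norm of \<open>(u, v)\<close>.
\<close>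

lemma inverse_one_plus_square:
  assumes h: "h \<in> carrier R" "star R h = h"
  obtains k where "k \<in> carrier R" "k \<otimes> (\<one> \<oplus> h \<otimes> h) = \<one>" "(\<one> \<oplus> h \<otimes> h) \<otimes> k = \<one>" "N (k, \<zero>) \<le> 1"
proof -
  let ?C = "complexification R"
  let ?g = "\<one> \<oplus> h \<otimes> h"
  have g: "?g \<in> carrier R" using h by simp
  have "(h, \<zero>) \<in> carrier ?C" "star ?C (h, \<zero>) = (h, \<zero>)"
    using h by (simp_all add: star_zero)
  then obtain z where z: "z \<in> carrier ?C" "z \<otimes>\<^bsub>?C\<^esub> (\<one>\<^bsub>?C\<^esub> \<oplus>\<^bsub>?C\<^esub> (h, \<zero>) \<otimes>\<^bsub>?C\<^esub> (h, \<zero>)) = \<one>\<^bsub>?C\<^esub>"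
    "(\<one>\<^bsub>?C\<^esub> \<oplus>\<^bsub>?C\<^esub> (h, \<zero>) \<otimes>\<^bsub>?C\<^esub> (h, \<zero>)) \<otimes>\<^bsub>?C\<^esub> z = \<one>\<^bsub>?C\<^esub>" "N z \<le> 1"
    by (rule C.inverse_one_plus_square)
  have emb: "\<one>\<^bsub>?C\<^esub> \<oplus>\<^bsub>?C\<^esub> (h, \<zero>) \<otimes>\<^bsub>?C\<^esub> (h, \<zero>) = (?g, \<zero>)"
    using h by (simp add: complexification_embed[OF star_algebra_axioms] del: complexification_simps(2,5))
  obtain u v where uv: "z = (u, v)" "u \<in> carrier R" "v \<in> carrier R"
    using z(1) by auto
  have u: "u \<otimes> ?g = \<one>" "?g \<otimes> u = \<one>"
    using z(2,3) uv g unfolding emb by (simp_all add: a_minus_def)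
  have "N (u, \<zero>) \<le> 1"
    using real_part_le[OF uv(2,3)] z(4) uv(1) by simp
  then show thesis
    using that[OF uv(2)] u by simp
qed

lemma Cauchy_limit_real:
  assumes s: "\<And>n. s n \<in> carrier R" and step: "\<And>n. N (s (Suc n) \<ominus> s n, \<zero>) \<le> K * (1 / 2) ^ n"
  obtains a where "a \<in> carrier R" "(\<lambda>n. N (s n \<ominus> a, \<zero>)) \<longlonglongrightarrow> 0"
proof -
  let ?C = "complexification R"
  have sC: "(s n, \<zero>) \<in> carrier ?C" for n using s by simp
  have "N ((s (Suc n), \<zero>) \<ominus>\<^bsub>?C\<^esub> (s n, \<zero>)) \<le> K * (1 / 2) ^ n" for n
    using step[of n] complexification_embed(3)[OF star_algebra_axioms s s, of "Suc n" n] by simp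
  note lim = C.Cauchy_limit[of "\<lambda>n. (s n, \<zero>)", OF sC _ _ this]
  obtain l where l: "l \<in> carrier ?C" "(\<lambda>n. N ((s n, \<zero>) \<ominus>\<^bsub>?C\<^esub> l)) \<longlonglongrightarrow> 0"
    by (rule lim) auto
  then obtain a b where ab: "l = (a, b)" "a \<in> carrier R" "b \<in> carrier R" by auto
  have "N (s n \<ominus> a, \<zero>) \<le> N ((s n, \<zero>) \<ominus>\<^bsub>?C\<^esub> l)" for n
    using real_part_le[of "s n \<ominus> a" "\<zero> \<ominus> b"] s[of n] ab
      complexification_minus[OF star_algebra_axioms, of "s n" \<zero> a b] by simp
  moreover have "0 \<le> N (s n \<ominus> a, \<zero>)" for n
    using s ab by (intro C.nrm_nonneg) simp
  ultimately have "(\<lambda>n. N (s n \<ominus> a, \<zero>)) \<longlonglongrightarrow> 0"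
    by (intro real_tendsto_sandwich[OF _ _ tendsto_const l(2)]) (simp_all add: always_eventually)
  with ab(2) show thesis by (rule that)
qed

theorem real_Cstar_algebra: "real_Cstar_algebra R (\<lambda>x. N (x, \<zero>))"
proof -
  let ?C = "complexification R"
  note emb = complexification_embed[OF star_algebra_axioms]
  let ?n = "\<lambda>x. N (x, \<zero>)"
  interpret n: alg_norm "\<lambda>t. t" R ?n
  proof unfold_locales
    show "?n \<zero> = 0" using C.p_zero by simp
  next
    fix x y assume x: "x \<in> carrier R"
    show "0 \<le> ?n x" using C.nrm_nonneg x by simp
    show "?n (\<ominus> x) = ?n x"
      using C.p_neg[of "(x, \<zero>)"] x complexification_neg[OF star_algebra_axioms, of x \<zero>] by simp
    show "?n x = 0 \<Longrightarrow> x = \<zero>" using C.p_definite[of "(x, \<zero>)"] x by simp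
    assume y: "y \<in> carrier R"
    show "?n (x \<oplus> y) \<le> ?n x + ?n y"
      using C.p_triangle[of "(x, \<zero>)" "(y, \<zero>)"] x y emb(2) by simp
    show "?n (x \<otimes> y) \<le> ?n x * ?n y"
      using C.p_mult[of "(x, \<zero>)" "(y, \<zero>)"] x y emb(1) by simp
  qed
  have "real_banach_star_algebra R ?n"
  proof unfold_locales
    show "Metric_space.mcomplete (carrier R) (norm_dist R ?n)"
    proof (rule n.mcompleteI)
      fix s assume "\<And>n. s n \<in> carrier R" "\<And>n. ?n (s (Suc n) \<ominus> s n) \<le> (1 / 2) ^ n"
      then show "\<exists>l\<in>carrier R. (\<lambda>n. ?n (s n \<ominus> l)) \<longlonglongrightarrow> 0"
        using Cauchy_limit_real[of s 1] by (metis mult_1)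
    qed
    show "\<exists>c. \<forall>x\<in>carrier R. ?n (star R x) \<le> c * ?n x"
    proof (intro exI[of _ 1] ballI)
      fix x assume x: "x \<in> carrier R"
      show "?n (star R x) \<le> 1 * ?n x"
        using C.p_star[of "(x, \<zero>)"] emb(5)[OF x x] x by (simp del: complexification_simps(7))
    qed
    show "?n (k \<odot> x) = norm k * ?n x" if "x \<in> carrier R" for k x
      using C.nrm_smult[of "(x, \<zero>)" "of_real k"] that emb(4)[of x x k] by simp
  qed (use n.p_nonneg n.p_zero n.p_definite n.p_triangle n.p_mult in auto)
  moreover have "regular_on R ?n"
    unfolding regular_on_def
  proof
    fix x assume x: "x \<in> carrier R"
    show "?n (star R x \<otimes> x) = (?n x)\<^sup>2"
      using C.p_regular[of "(x, \<zero>)"] emb(5)[OF x x] emb(1)[OF star_closed[OF x] x] x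
      by (simp del: complexification_simps(2,7))
  qed
  ultimately show "real_Cstar_algebra R ?n"
    using complex_Cstar by (auto simp: real_Cstar_algebra_def complex_Cstar_iff intro!: exI[of _ N])
qed

end

text \<open>
  For a conjugation-invariant norm the complexification is, as a normed space, equivalent to two copies
  of the real algebra. Completeness therefore has to be checked only for real elements.
\<close>

lemma real_Cstar_pairI:
  assumes R: "real_star_algebra R"
    and nonneg: "\<And>z. z \<in> carrier (complexification R) \<Longrightarrow> 0 \<le> N z"
    and definite: "\<And>x. x \<in> carrier R \<Longrightarrow> N (x, \<zero>\<^bsub>R\<^esub>) = 0 \<Longrightarrow> x = \<zero>\<^bsub>R\<^esub>"
    and triangle: "\<And>z w. z \<in> carrier (complexification R) \<Longrightarrow> w \<in> carrier (complexification R) \<Longrightarrow>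
      N (z \<oplus>\<^bsub>complexification R\<^esub> w) \<le> N z + N w"
    and homogeneous: "\<And>z k. z \<in> carrier (complexification R) \<Longrightarrow>
      N (k \<odot>\<^bsub>complexification R\<^esub> z) = cmod k * N z"
    and submult: "\<And>z w. z \<in> carrier (complexification R) \<Longrightarrow> w \<in> carrier (complexification R) \<Longrightarrow>
      N (z \<otimes>\<^bsub>complexification R\<^esub> w) \<le> N z * N w"
    and regular: "\<And>z. z \<in> carrier (complexification R) \<Longrightarrow>
      N (star (complexification R) z \<otimes>\<^bsub>complexification R\<^esub> z) = (N z)\<^sup>2"
    and conj: "\<And>z. z \<in> carrier (complexification R) \<Longrightarrow> N (cx_conj R z) = N z"
    and limits: "\<And>s. (\<And>n. s n \<in> carrier R) \<Longrightarrow>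
      (\<And>n. N (s (Suc n) \<ominus>\<^bsub>R\<^esub> s n, \<zero>\<^bsub>R\<^esub>) \<le> (1 / 2) ^ n) \<Longrightarrow>
      \<exists>l\<in>carrier R. (\<lambda>n. N (s n \<ominus>\<^bsub>R\<^esub> l, \<zero>\<^bsub>R\<^esub>)) \<longlonglongrightarrow> 0"
  shows "real_Cstar_pair R N"
proof -
  let ?C = "complexification R"
  interpret star_algebra "\<lambda>t. t" R by fact
  interpret C: star_algebra cnj ?C by (rule complexification_star_algebra) fact
  note emb = complexification_embed[OF R]
  interpret C: regular_seminorm cnj ?C N
  proof unfold_locales
    show "N \<zero>\<^bsub>?C\<^esub> = 0"
      using homogeneous[OF C.zero_closed, of 0] C.smult_zero_left[OF C.zero_closed] by simp
    show "N (\<ominus>\<^bsub>?C\<^esub> x) = N x" if "x \<in> carrier ?C" for x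
      using homogeneous[OF that, of "- 1"] C.smult_neg_left[OF that, of 1] C.smult_one[OF that] by simp
  qed (use nonneg triangle submult regular in auto)
  have conj': "N (x, \<ominus>\<^bsub>R\<^esub> y) = N (x, y)" if "x \<in> carrier R" "y \<in> carrier R" for x y
    using conj[of "(x, y)"] that by (simp add: cx_conj_def)
  note re = conjugation_invariant_norm(1)[OF R triangle homogeneous conj', simplified]
    and im = conjugation_invariant_norm(2)[OF R triangle homogeneous conj', simplified]
    and sum = conjugation_invariant_norm(3)[OF R triangle homogeneous conj', simplified]
  interpret C: alg_norm cnj ?C N
  proof unfold_locales
    fix z assume "z \<in> carrier ?C" "N z = 0"
    moreover obtain x y where "z = (x, y)" by (cases z)
    ultimately show "z = \<zero>\<^bsub>?C\<^esub>"
      using re[of x y] im[of x y] nonneg[of "(x, \<zero>\<^bsub>R\<^esub>)"] nonneg[of "(y, \<zero>\<^bsub>R\<^esub>)"]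
        definite[of x] definite[of y] by simp
  qed
  interpret C: banach_star_algebra cnj ?C N
  proof unfold_locales
    show "\<exists>c. \<forall>x\<in>carrier ?C. N (star ?C x) \<le> c * N x"
      using C.p_star by (intro exI[of _ 1]) simp
    show "Metric_space.mcomplete (carrier ?C) (norm_dist ?C N)"
    proof (rule C.mcompleteI)
      fix s assume s: "\<And>n. s n \<in> carrier ?C" "\<And>n. N (s (Suc n) \<ominus>\<^bsub>?C\<^esub> s n) \<le> (1 / 2) ^ n"
      define a b where "a n = fst (s n)" and "b n = snd (s n)" for n
      have ab: "s n = (a n, b n)" "a n \<in> carrier R" "b n \<in> carrier R" for n
        using s(1)[of n] by (auto simp: a_def b_def)
      have "N (a (Suc n) \<ominus>\<^bsub>R\<^esub> a n, b (Suc n) \<ominus>\<^bsub>R\<^esub> b n) \<le> (1 / 2) ^ n" for n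
        using s(2)[of n] by (simp add: ab complexification_minus[OF R])
      then have "N (a (Suc n) \<ominus>\<^bsub>R\<^esub> a n, \<zero>\<^bsub>R\<^esub>) \<le> (1 / 2) ^ n"
        "N (b (Suc n) \<ominus>\<^bsub>R\<^esub> b n, \<zero>\<^bsub>R\<^esub>) \<le> (1 / 2) ^ n" for n
        using re im ab(2,3) by (meson minus_closed order.trans)+
      then obtain l m where l: "l \<in> carrier R" "(\<lambda>n. N (a n \<ominus>\<^bsub>R\<^esub> l, \<zero>\<^bsub>R\<^esub>)) \<longlonglongrightarrow> 0"
        and m: "m \<in> carrier R" "(\<lambda>n. N (b n \<ominus>\<^bsub>R\<^esub> m, \<zero>\<^bsub>R\<^esub>)) \<longlonglongrightarrow> 0"
        using limits[of a] limits[of b] ab by metis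
      show "\<exists>l\<in>carrier ?C. (\<lambda>n. N (s n \<ominus>\<^bsub>?C\<^esub> l)) \<longlonglongrightarrow> 0"
      proof (rule bexI[of _ "(l, m)"])
        show "(\<lambda>n. N (s n \<ominus>\<^bsub>?C\<^esub> (l, m))) \<longlonglongrightarrow> 0"
        proof (rule real_tendsto_sandwich[OF _ _ tendsto_const])
          show "(\<lambda>n. N (a n \<ominus>\<^bsub>R\<^esub> l, \<zero>\<^bsub>R\<^esub>) + N (b n \<ominus>\<^bsub>R\<^esub> m, \<zero>\<^bsub>R\<^esub>)) \<longlonglongrightarrow> 0"
            using tendsto_add[OF l(2) m(2)] by simp
          show "\<forall>\<^sub>F n in sequentially. N (s n \<ominus>\<^bsub>?C\<^esub> (l, m)) \<le>
              N (a n \<ominus>\<^bsub>R\<^esub> l, \<zero>\<^bsub>R\<^esub>) + N (b n \<ominus>\<^bsub>R\<^esub> m, \<zero>\<^bsub>R\<^esub>)"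
            using sum ab(2,3) l(1) m(1)
            by (intro always_eventually allI) (simp add: ab(1) complexification_minus[OF R])
          show "\<forall>\<^sub>F n in sequentially. 0 \<le> N (s n \<ominus>\<^bsub>?C\<^esub> (l, m))"
            using nonneg s(1) l(1) m(1) C.minus_closed by (intro always_eventually allI) simp
        qed
      qed (use l m in simp)
    qed
  next
    fix z assume z: "z \<in> carrier ?C"
    show "0 \<le> N z" by (rule nonneg[OF z])
    show "N z = 0 \<longleftrightarrow> z = \<zero>\<^bsub>?C\<^esub>" using C.p_definite[OF z] C.p_zero by blast
    show "N (k \<odot>\<^bsub>?C\<^esub> z) = norm k * N z" for k by (rule homogeneous[OF z])
    fix w assume w: "w \<in> carrier ?C"
    show "N (z \<oplus>\<^bsub>?C\<^esub> w) \<le> N z + N w" by (rule triangle[OF z w])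
    show "N (z \<otimes>\<^bsub>?C\<^esub> w) \<le> N z * N w" by (rule submult[OF z w])
  qed
  have Cstar: "complex_Cstar ?C N"
    by unfold_locales
  show "real_Cstar_pair R N"
    by unfold_locales (use Cstar conj' in auto)
qed


text \<open>
  The maximum of a C*-norm and its composition with conjugation is again a C*-norm, and both agree on
  real elements.
\<close>

lemma real_Cstar_pair_exists:
  assumes "real_Cstar_algebra R nrm"
  obtains N where "real_Cstar_pair R N" "\<And>x. x \<in> carrier R \<Longrightarrow> N (x, \<zero>\<^bsub>R\<^esub>) = nrm x"
proof -
  let ?C = "complexification R"
  obtain N where "complex_Cstar ?C N" and N_emb: "\<And>x. x \<in> carrier R \<Longrightarrow> N (x, \<zero>\<^bsub>R\<^esub>) = nrm x"
    using assms by (auto simp: real_Cstar_algebra_def complex_Cstar_iff)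
  interpret R: banach_star_algebra "\<lambda>t. t" R nrm
    using assms by (simp add: real_Cstar_algebra_def)
  interpret C: complex_Cstar ?C N by fact
  have alg: "real_star_algebra R" by unfold_locales
  note cj = cx_conj_simps[OF alg]
  define M where "M z = max (N z) (N (cx_conj R z))" for z
  have M_emb: "M (x, \<zero>\<^bsub>R\<^esub>) = nrm x" if "x \<in> carrier R" for x
    using that N_emb by (simp add: M_def cx_conj_def)
  have "real_Cstar_pair R M"
  proof (rule real_Cstar_pairI[OF alg])
    fix z assume z: "z \<in> carrier ?C"
    note cz = cj(1)[OF z z]
    show "0 \<le> M z"
      using C.nrm_nonneg[OF z] by (simp add: M_def)
    show "M (k \<odot>\<^bsub>?C\<^esub> z) = cmod k * M z" for k
      using C.nrm_smult[OF z] C.nrm_smult[OF cz]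
      by (simp add: M_def cj(5)[OF z z] max_mult_distrib_left)
    have "(max a b)\<^sup>2 = max (a\<^sup>2) (b\<^sup>2)" if "0 \<le> a" "0 \<le> b" for a b :: real
      using that by (simp add: max_def abs_le_square_iff[symmetric])
    then show "M (star ?C z \<otimes>\<^bsub>?C\<^esub> z) = (M z)\<^sup>2"
      using C.p_regular[OF z] C.p_regular[OF cz] C.nrm_nonneg[OF z] C.nrm_nonneg[OF cz]
      by (simp add: M_def cj(4)[OF C.star_closed[OF z] z] cj(6)[OF z z])
    show "M (cx_conj R z) = M z"
      by (simp add: M_def cj(2)[OF z z] max.commute)
    fix w assume w: "w \<in> carrier ?C"
    note cw = cj(1)[OF w w]
    show "M (z \<oplus>\<^bsub>?C\<^esub> w) \<le> M z + M w"
      using C.nrm_triangle[OF z w] C.nrm_triangle[OF cz cw]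
      unfolding M_def cj(3)[OF z w] by (intro max.boundedI) linarith+
    show "M (z \<otimes>\<^bsub>?C\<^esub> w) \<le> M z * M w"
      unfolding M_def cj(4)[OF z w]
    proof (rule max.boundedI)
      show "N (z \<otimes>\<^bsub>?C\<^esub> w) \<le> max (N z) (N (cx_conj R z)) * max (N w) (N (cx_conj R w))"
        using C.nrm_nonneg[OF z] C.nrm_nonneg[OF w]
        by (intro order.trans[OF C.nrm_mult[OF z w]] mult_mono) auto
      show "N (cx_conj R z \<otimes>\<^bsub>?C\<^esub> cx_conj R w) \<le> max (N z) (N (cx_conj R z)) * max (N w) (N (cx_conj R w))"
        using C.nrm_nonneg[OF z] C.nrm_nonneg[OF cw]
        by (intro order.trans[OF C.nrm_mult[OF cz cw]] mult_mono) auto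
    qed
  next
    show "x = \<zero>\<^bsub>R\<^esub>" if "x \<in> carrier R" "M (x, \<zero>\<^bsub>R\<^esub>) = 0" for x
      using that R.p_definite by (simp add: M_emb)
    fix s assume "\<And>n. s n \<in> carrier R" "\<And>n. M (s (Suc n) \<ominus>\<^bsub>R\<^esub> s n, \<zero>\<^bsub>R\<^esub>) \<le> (1 / 2) ^ n"
    then show "\<exists>l\<in>carrier R. (\<lambda>n. M (s n \<ominus>\<^bsub>R\<^esub> l, \<zero>\<^bsub>R\<^esub>)) \<longlonglongrightarrow> 0"
      using R.Cauchy_limit[of s "1 / 2" 1] by (simp add: M_emb) blast
  qed
  then show thesis
    using that M_emb by blast
qed

section \<open>Quotients of real C*-algebras by seminorms\<close>

lemma surjective_image_star_algebra:
  fixes D (structure)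
  assumes "star_algebra c A" and surj: "f ` carrier A = carrier D"
    and add: "\<And>x y. x \<in> carrier A \<Longrightarrow> y \<in> carrier A \<Longrightarrow> f x \<oplus> f y = f (x \<oplus>\<^bsub>A\<^esub> y)"
    and mult: "\<And>x y. x \<in> carrier A \<Longrightarrow> y \<in> carrier A \<Longrightarrow> f x \<otimes> f y = f (x \<otimes>\<^bsub>A\<^esub> y)"
    and smult: "\<And>k x. x \<in> carrier A \<Longrightarrow> k \<odot> f x = f (k \<odot>\<^bsub>A\<^esub> x)"
    and star: "\<And>x. x \<in> carrier A \<Longrightarrow> star D (f x) = f (star A x)"
    and zero: "\<zero> = f \<zero>\<^bsub>A\<^esub>" and one: "\<one> = f \<one>\<^bsub>A\<^esub>"
  shows "star_algebra c D"
proof -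
  interpret star_algebra c A by fact
  have ex: "\<exists>u\<in>carrier A. x = f u" if "x \<in> carrier D" for x
    using that surj by blast
  have in_D: "f x \<in> carrier D" if "x \<in> carrier A" for x
    using that surj by blast
  note hom = add mult smult star zero one in_D alg_closed
  have "abelian_group D"
  proof (rule abelian_groupI)
    fix x y z assume "x \<in> carrier D" "y \<in> carrier D" "z \<in> carrier D"
    then obtain u v w where "x = f u" "y = f v" "z = f w" "u \<in> carrier A" "v \<in> carrier A" "w \<in> carrier A"
      by (meson ex)
    then show "x \<oplus> y \<oplus> z = x \<oplus> (y \<oplus> z)" by (simp add: hom a_assoc)
  next
    fix x y assume "x \<in> carrier D" "y \<in> carrier D"
    then obtain u v where *: "x = f u" "y = f v" "u \<in> carrier A" "v \<in> carrier A"
      by (meson ex)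
    then show "x \<oplus> y \<in> carrier D" by (simp add: hom)
    show "x \<oplus> y = y \<oplus> x" using * by (simp add: hom a_comm)
  next
    fix x assume "x \<in> carrier D"
    then obtain u where *: "x = f u" "u \<in> carrier A"
      by (meson ex)
    then show "\<zero> \<oplus> x = x" by (simp add: hom)
    show "\<exists>y\<in>carrier D. y \<oplus> x = \<zero>"
      using * by (intro bexI[of _ "f (\<ominus>\<^bsub>A\<^esub> u)"]) (simp_all add: hom l_neg)
  qed (simp add: hom)
  moreover have "monoid D"
  proof
    fix x y z assume "x \<in> carrier D" "y \<in> carrier D" "z \<in> carrier D"
    then obtain u v w where "x = f u" "y = f v" "z = f w" "u \<in> carrier A" "v \<in> carrier A" "w \<in> carrier A"
      by (meson ex)
    then show "x \<otimes> y \<otimes> z = x \<otimes> (y \<otimes> z)" by (simp add: hom m_assoc)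
  next
    fix x y assume "x \<in> carrier D" "y \<in> carrier D"
    then obtain u v where *: "x = f u" "y = f v" "u \<in> carrier A" "v \<in> carrier A"
      by (meson ex)
    then show "x \<otimes> y \<in> carrier D" by (simp add: hom)
  next
    fix x assume "x \<in> carrier D"
    then obtain u where *: "x = f u" "u \<in> carrier A"
      by (meson ex)
    then show "\<one> \<otimes> x = x" "x \<otimes> \<one> = x" by (simp_all add: hom)
  qed (simp add: hom)
  ultimately have "ring D"
  proof (rule ringI)
    fix x y z assume "x \<in> carrier D" "y \<in> carrier D" "z \<in> carrier D"
    then obtain u v w where "x = f u" "y = f v" "z = f w" "u \<in> carrier A" "v \<in> carrier A" "w \<in> carrier A"
      by (meson ex)
    then show "(x \<oplus> y) \<otimes> z = x \<otimes> z \<oplus> y \<otimes> z"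
      "z \<otimes> (x \<oplus> y) = z \<otimes> x \<oplus> z \<otimes> y"
      by (simp_all add: hom l_distr r_distr)
  qed
  then show ?thesis
  proof (rule star_algebra.intro)
    show "star_algebra_axioms c D"
    proof
      fix x k l assume "x \<in> carrier D"
      then obtain u where u: "x = f u" "u \<in> carrier A"
        by (meson ex)
      then show "k \<odot> x \<in> carrier D"
        "(k + l) \<odot> x = k \<odot> x \<oplus> l \<odot> x"
        "(k * l) \<odot> x = k \<odot> (l \<odot> x)"
        "1 \<odot> x = x" "star D x \<in> carrier D" "star D (star D x) = x"
        "star D (k \<odot> x) = c k \<odot> star D x"
        by (simp_all add: hom smult_l_distr smult_assoc smult_one star_star star_smult)
      fix y assume "y \<in> carrier D"
      then obtain v where v: "y = f v" "v \<in> carrier A"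
        by (meson ex)
      show "k \<odot> (x \<oplus> y) = k \<odot> x \<oplus> k \<odot> y"
        "(k \<odot> x) \<otimes> y = k \<odot> (x \<otimes> y)"
        "x \<otimes> (k \<odot> y) = k \<odot> (x \<otimes> y)"
        "star D (x \<oplus> y) = star D x \<oplus> star D y"
        "star D (x \<otimes> y) = star D y \<otimes> star D x"
        using u v by (simp_all add: hom smult_r_distr smult_mult_left smult_mult_right star_add star_mult)
    qed
  qed
qed

definition null_coset :: "('k, 'a) star_alg \<Rightarrow> ('a \<Rightarrow> real) \<Rightarrow> 'a \<Rightarrow> 'a set"
  where "null_coset A p x = {y \<in> carrier A. p (y \<ominus>\<^bsub>A\<^esub> x) = 0}"

definition representative :: "'a set \<Rightarrow> 'a"
  where "representative X = (SOME x. x \<in> X)"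

text \<open>The choice of representatives is immaterial by \<open>quotient_operations\<close> below.\<close>

definition quotient_algebra :: "('k, 'a) star_alg \<Rightarrow> ('a \<Rightarrow> real) \<Rightarrow> ('k, 'a set) star_alg"
  where "quotient_algebra A p =
    \<lparr>carrier = null_coset A p ` carrier A,
     mult = (\<lambda>X Y. null_coset A p (representative X \<otimes>\<^bsub>A\<^esub> representative Y)),
     one = null_coset A p \<one>\<^bsub>A\<^esub>,
     zero = null_coset A p \<zero>\<^bsub>A\<^esub>,
     add = (\<lambda>X Y. null_coset A p (representative X \<oplus>\<^bsub>A\<^esub> representative Y)),
     smult = (\<lambda>k X. null_coset A p (k \<odot>\<^bsub>A\<^esub> representative X)),
     star = (\<lambda>X. null_coset A p (star A (representative X)))\<rparr>"

locale star_seminorm = alg_seminorm cj A p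
  for cj :: "'k::real_normed_field \<Rightarrow> 'k" and A :: "('k, 'a) star_alg" (structure) and p +
  assumes star_null: "x \<in> carrier A \<Longrightarrow> p x = 0 \<Longrightarrow> p (star A x) = 0"
begin

lemma null_coset_eq_iff:
  assumes "x \<in> carrier A" "y \<in> carrier A"
  shows "null_coset A p x = null_coset A p y \<longleftrightarrow> p (x \<ominus> y) = 0"
proof
  assume "null_coset A p x = null_coset A p y"
  moreover have "x \<in> null_coset A p x"
    using assms p_minus_self by (simp add: null_coset_def)
  ultimately show "p (x \<ominus> y) = 0" by (simp add: null_coset_def)
next
  assume *: "p (x \<ominus> y) = 0"
  have "p (z \<ominus> x) = 0 \<longleftrightarrow> p (z \<ominus> y) = 0" if z: "z \<in> carrier A" for z
    using p_dist_triangle[OF z assms(1,2)] p_dist_triangle[OF z assms(2,1)] * p_sym[OF assms] assms z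
      p_nonneg[of "z \<ominus> x"] p_nonneg[of "z \<ominus> y"] by (auto intro!: antisym)
  then show "null_coset A p x = null_coset A p y"
    by (auto simp: null_coset_def)
qed

lemma null_coset_in [simp]: "x \<in> carrier A \<Longrightarrow> null_coset A p x \<in> carrier (quotient_algebra A p)"
  by (simp add: quotient_algebra_def)

lemma representative_null_coset:
  assumes "x \<in> carrier A"
  shows "representative (null_coset A p x) \<in> carrier A" "p (representative (null_coset A p x) \<ominus> x) = 0"
proof -
  have "x \<in> null_coset A p x"
    using assms p_minus_self by (simp add: null_coset_def)
  then have "representative (null_coset A p x) \<in> null_coset A p x"
    unfolding representative_def by (rule someI)
  then show "representative (null_coset A p x) \<in> carrier A" "p (representative (null_coset A p x) \<ominus> x) = 0"
    by (auto simp: null_coset_def)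
qed

lemma representative_in:
  assumes "X \<in> carrier (quotient_algebra A p)"
  shows "representative X \<in> carrier A" "null_coset A p (representative X) = X"
proof -
  obtain x where "x \<in> carrier A" "X = null_coset A p x"
    using assms by (auto simp: quotient_algebra_def)
  then show "representative X \<in> carrier A" "null_coset A p (representative X) = X"
    using representative_null_coset[of x] null_coset_eq_iff[of "representative X" x] by auto
qed

text \<open>
  Scalar multiplication is multiplication by \<open>k \<odot> \<one>\<close>, and \<open>p\<close> is submultiplicative.
\<close>

lemma smult_null: "x \<in> carrier A \<Longrightarrow> p x = 0 \<Longrightarrow> p (k \<odot> x) = 0"
  using p_mult[of "k \<odot> \<one>" x] smult_mult_left[of \<one> x k] p_nonneg[of "k \<odot> x"]
  by (simp add: alg_closed)

lemma quotient_operations: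
  assumes x: "x \<in> carrier A" and y: "y \<in> carrier A"
  shows "null_coset A p x \<oplus>\<^bsub>quotient_algebra A p\<^esub> null_coset A p y = null_coset A p (x \<oplus> y)"
    and "null_coset A p x \<otimes>\<^bsub>quotient_algebra A p\<^esub> null_coset A p y = null_coset A p (x \<otimes> y)"
    and "k \<odot>\<^bsub>quotient_algebra A p\<^esub> null_coset A p x = null_coset A p (k \<odot> x)"
    and "star (quotient_algebra A p) (null_coset A p x) = null_coset A p (star A x)"
proof -
  let ?x = "representative (null_coset A p x)" and ?y = "representative (null_coset A p y)"
  note rx = representative_null_coset[OF x] and ry = representative_null_coset[OF y]
  have "(?x \<oplus> ?y) \<ominus> (x \<oplus> y) = (?x \<ominus> x) \<oplus> (?y \<ominus> y)"
    using rx(1) ry(1) x y by algebra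
  then have "p ((?x \<oplus> ?y) \<ominus> (x \<oplus> y)) \<le> 0"
    using p_triangle[of "?x \<ominus> x" "?y \<ominus> y"] rx ry x y by simp
  then show "null_coset A p x \<oplus>\<^bsub>quotient_algebra A p\<^esub> null_coset A p y = null_coset A p (x \<oplus> y)"
    using rx(1) ry(1) x y p_nonneg[of "(?x \<oplus> ?y) \<ominus> (x \<oplus> y)"]
    by (simp add: quotient_algebra_def null_coset_eq_iff)
  have "?x \<otimes> ?y \<ominus> x \<otimes> y = (?x \<ominus> x) \<otimes> ?y \<oplus> x \<otimes> (?y \<ominus> y)"
    using rx(1) ry(1) x y by algebra
  then have "p (?x \<otimes> ?y \<ominus> x \<otimes> y) \<le> p (?x \<ominus> x) * p ?y + p x * p (?y \<ominus> y)"
    using p_triangle[of "(?x \<ominus> x) \<otimes> ?y" "x \<otimes> (?y \<ominus> y)"] p_mult[of "?x \<ominus> x" ?y] p_mult[of x "?y \<ominus> y"]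
      rx(1) ry(1) x y by simp
  then show "null_coset A p x \<otimes>\<^bsub>quotient_algebra A p\<^esub> null_coset A p y = null_coset A p (x \<otimes> y)"
    using rx ry x y p_nonneg[of "?x \<otimes> ?y \<ominus> x \<otimes> y"]
    by (simp add: quotient_algebra_def null_coset_eq_iff)
  show "k \<odot>\<^bsub>quotient_algebra A p\<^esub> null_coset A p x = null_coset A p (k \<odot> x)"
    using rx x smult_null[of "?x \<ominus> x" k]
    by (simp add: quotient_algebra_def null_coset_eq_iff smult_diff_right alg_closed)
  show "star (quotient_algebra A p) (null_coset A p x) = null_coset A p (star A x)"
    using rx x star_null[of "?x \<ominus> x"]
    by (simp add: quotient_algebra_def null_coset_eq_iff star_diff alg_closed)
qed

lemma quotient_constants:
  "\<zero>\<^bsub>quotient_algebra A p\<^esub> = null_coset A p \<zero>"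
  "\<one>\<^bsub>quotient_algebra A p\<^esub> = null_coset A p \<one>"
  by (simp_all add: quotient_algebra_def)

lemma quotient_star_algebra: "star_algebra cj (quotient_algebra A p)"
proof (rule surjective_image_star_algebra[OF star_algebra_axioms])
  show "null_coset A p ` carrier A = carrier (quotient_algebra A p)"
    by (simp add: quotient_algebra_def)
qed (rule quotient_constants | rule quotient_operations, simp_all)+

lemma null_coset_hom: "null_coset A p \<in> star_hom A (quotient_algebra A p)"
  by (auto simp: star_hom_def ring_hom_def quotient_operations quotient_constants)

end

lemma le_mult_of_add_eps:
  fixes a b c :: real
  assumes "\<And>e. 0 < e \<Longrightarrow> c \<le> (a + e) * (b + e)"
  shows "c \<le> a * b"
proof (rule tendsto_lowerbound)
  have "((\<lambda>e. (a + e) * (b + e)) \<longlongrightarrow> (a + 0) * (b + 0)) (at_right 0)"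
    by (intro tendsto_intros)
  then show "((\<lambda>e. (a + e) * (b + e)) \<longlongrightarrow> a * b) (at_right 0)" by simp
  show "\<forall>\<^sub>F e in at_right 0. c \<le> (a + e) * (b + e)"
    using assms by (auto simp: eventually_at_right_less intro: eventually_mono[OF eventually_at_right_less[of 0]])
qed simp

text \<open>
  A real C*-algebra with a dominated seminorm \<open>p\<close>. The constant \<open>D\<close> is 1 for regular seminorms, and
  it is the bound of the involution when \<open>p\<close> comes from a Banach *-algebra.
\<close>

locale real_Cstar_quotient = real_Cstar_pair R N + p: alg_seminorm "\<lambda>t. t" R p
  for R :: "(real, 'a) star_alg" (structure) and N p +
  fixes K D :: real
  assumes K_nonneg: "0 \<le> K" and D_nonneg: "0 \<le> D"
    and p_le: "x \<in> carrier R \<Longrightarrow> p x \<le> K * N (x, \<zero>)"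
    and p_star_le: "x \<in> carrier R \<Longrightarrow> p (star R x) \<le> D * p x"
    and p_smult: "x \<in> carrier R \<Longrightarrow> p (t \<odot> x) = \<bar>t\<bar> * p x"
begin

definition pair_seminorm :: "'a \<times> 'a \<Rightarrow> real"
  where "pair_seminorm z = p (fst z) + p (snd z)"

sublocale p: star_seminorm "\<lambda>t. t" R p
proof
  show "p (star R x) = 0" if "x \<in> carrier R" "p x = 0" for x
    using p_star_le[OF that(1)] that p.p_nonneg[of "star R x"] star_closed by simp
qed

sublocale P: dominated_seminorm "complexification R" N pair_seminorm "2 * K" D
proof unfold_locales
  let ?C = "complexification R"
  note cx = complexification_neg[OF star_algebra_axioms]
  show "0 \<le> 2 * K" "0 \<le> D" using K_nonneg D_nonneg by simp_all
  show "pair_seminorm \<zero>\<^bsub>?C\<^esub> = 0" by (simp add: pair_seminorm_def p.p_zero)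
  fix z assume "z \<in> carrier ?C"
  then obtain x y where z: "z = (x, y)" "x \<in> carrier R" "y \<in> carrier R" by auto
  show "0 \<le> pair_seminorm z" using z p.p_nonneg by (simp add: pair_seminorm_def)
  show "pair_seminorm (\<ominus>\<^bsub>?C\<^esub> z) = pair_seminorm z"
    using z p.p_neg by (simp add: pair_seminorm_def cx)
  show "pair_seminorm (star ?C z) \<le> D * pair_seminorm z"
    using z p_star_le[OF z(2)] p_star_le[OF z(3)] p.p_neg star_closed
    by (simp add: pair_seminorm_def distrib_left)
  have "pair_seminorm z \<le> K * N (x, \<zero>) + K * N (y, \<zero>)"
    using z p_le[OF z(2)] p_le[OF z(3)] by (simp add: pair_seminorm_def)
  also have "\<dots> \<le> K * N z + K * N z"
    using z real_part_le[OF z(2,3)] imaginary_part_le[OF z(2,3)] K_nonneg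
    by (intro add_mono mult_left_mono) auto
  finally show "pair_seminorm z \<le> 2 * K * N z" by simp
  show "pair_seminorm (of_real t \<odot>\<^bsub>?C\<^esub> z) = \<bar>t\<bar> * pair_seminorm z" for t
    using z p_smult by (simp add: pair_seminorm_def smult_zero_left a_minus_def alg_closed distrib_left)
  fix w assume "w \<in> carrier ?C"
  then obtain u v where w: "w = (u, v)" "u \<in> carrier R" "v \<in> carrier R" by auto
  show "pair_seminorm (z \<oplus>\<^bsub>?C\<^esub> w) \<le> pair_seminorm z + pair_seminorm w"
    using z w p.p_triangle[of x u] p.p_triangle[of y v] by (simp add: pair_seminorm_def)
  show "pair_seminorm (z \<otimes>\<^bsub>?C\<^esub> w) \<le> pair_seminorm z * pair_seminorm w"
    using z w p.p_diff_le[of "x \<otimes> u" "y \<otimes> v"] p.p_triangle[of "x \<otimes> v" "y \<otimes> u"]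
      p.p_mult[of x u] p.p_mult[of y v] p.p_mult[of x v] p.p_mult[of y u]
    by (simp add: pair_seminorm_def algebra_simps)
qed

lemma bounded_representative:
  assumes x: "x \<in> carrier R" and "sqrt D * p x < t"
  obtains y where "y \<in> carrier R" "p (x \<ominus> y) = 0" "N (y, \<zero>) \<le> t"
proof -
  have "sqrt D * pair_seminorm (x, \<zero>) < t"
    using assms by (simp add: pair_seminorm_def p.p_zero)
  then obtain z where z: "z \<in> carrier (complexification R)"
    "pair_seminorm ((x, \<zero>) \<ominus>\<^bsub>complexification R\<^esub> z) = 0" "N z \<le> t"
    using P.representative_of_small_seminorm[of "(x, \<zero>)" t] x by auto
  obtain y y' where y: "z = (y, y')" "y \<in> carrier R" "y' \<in> carrier R"
    using z(1) by auto
  have "p (x \<ominus> y) + p (\<zero> \<ominus> y') = 0"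
    using z(2) x y by (simp add: pair_seminorm_def complexification_minus[OF star_algebra_axioms])
  then have "p (x \<ominus> y) = 0"
    using p.p_nonneg[of "x \<ominus> y"] p.p_nonneg[of "\<zero> \<ominus> y'"] x y by simp
  moreover have "N (y, \<zero>) \<le> t"
    using real_part_le[OF y(2,3)] z(3) y(1) by simp
  ultimately show thesis using that y(2) by blast
qed

abbreviation Q :: "(real, 'a set) star_alg"
  where "Q \<equiv> quotient_algebra R p"

definition coset_pair :: "'a \<times> 'a \<Rightarrow> 'a set \<times> 'a set"
  where "coset_pair = map_prod (null_coset R p) (null_coset R p)"

definition quotient_norm :: "'a set \<times> 'a set \<Rightarrow> real"
  where "quotient_norm Z = Inf {N z | z. z \<in> carrier (complexification R) \<and> coset_pair z = Z}"

lemma coset_pair_eq_iff: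
  assumes "z \<in> carrier (complexification R)" "w \<in> carrier (complexification R)"
  shows "coset_pair z = coset_pair w \<longleftrightarrow> pair_seminorm (z \<ominus>\<^bsub>complexification R\<^esub> w) = 0"
proof -
  obtain x y u v where zw: "z = (x, y)" "x \<in> carrier R" "y \<in> carrier R" "w = (u, v)" "u \<in> carrier R" "v \<in> carrier R"
    using assms by auto
  then have "0 \<le> p (x \<ominus> u)" "0 \<le> p (y \<ominus> v)"
    using p.p_nonneg by simp_all
  then show ?thesis
    using zw by (auto simp: coset_pair_def p.null_coset_eq_iff pair_seminorm_def
        complexification_minus[OF star_algebra_axioms])
qed

lemmas coset_pair_hom = complexification_map_hom
  [OF star_algebra_axioms p.quotient_star_algebra p.null_coset_hom, folded coset_pair_def]

lemma coset_pair_surj: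
  assumes "Z \<in> carrier (complexification Q)"
  obtains z where "z \<in> carrier (complexification R)" "coset_pair z = Z"
  using assms that[of "(representative (fst Z), representative (snd Z))"] p.representative_in
  by (auto simp: coset_pair_def)

lemma quotient_norm_le:
  "z \<in> carrier (complexification R) \<Longrightarrow> coset_pair z = Z \<Longrightarrow> quotient_norm Z \<le> N z"
  unfolding quotient_norm_def
  by (rule cInf_lower) (use C.nrm_nonneg in \<open>auto intro!: bdd_belowI[of _ 0]\<close>)

lemma quotient_norm_nonneg:
  assumes "Z \<in> carrier (complexification Q)"
  shows "0 \<le> quotient_norm Z"
  unfolding quotient_norm_def
proof (rule cInf_greatest)
  show "{N z | z. z \<in> carrier (complexification R) \<and> coset_pair z = Z} \<noteq> {}"
    using coset_pair_surj[OF assms] by blast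
  fix x assume "x \<in> {N z | z. z \<in> carrier (complexification R) \<and> coset_pair z = Z}"
  then obtain z where "x = N z" "z \<in> carrier (complexification R)" by blast
  then show "0 \<le> x" using C.nrm_nonneg by simp
qed

lemma quotient_norm_less:
  assumes "Z \<in> carrier (complexification Q)" "quotient_norm Z < t"
  obtains z where "z \<in> carrier (complexification R)" "coset_pair z = Z" "N z < t"
proof -
  have "{N z | z. z \<in> carrier (complexification R) \<and> coset_pair z = Z} \<noteq> {}"
    using coset_pair_surj[OF assms(1)] by blast
  from cInf_lessD[OF this, of t] show thesis
    using assms(2) that unfolding quotient_norm_def by blast
qed

lemma quotient_norm_le_seminorm:
  assumes x: "x \<in> carrier R"
  shows "quotient_norm (null_coset R p x, \<zero>\<^bsub>Q\<^esub>) \<le> sqrt D * p x"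
proof (rule dense_ge)
  fix t assume "sqrt D * p x < t"
  then obtain y where y: "y \<in> carrier R" "p (x \<ominus> y) = 0" "N (y, \<zero>) \<le> t"
    using bounded_representative[OF x] by blast
  then have "coset_pair (y, \<zero>) = (null_coset R p x, \<zero>\<^bsub>Q\<^esub>)"
    using x p.null_coset_eq_iff[of x y] by (simp add: coset_pair_def p.quotient_constants)
  then show "quotient_norm (null_coset R p x, \<zero>\<^bsub>Q\<^esub>) \<le> t"
    using quotient_norm_le[of "(y, \<zero>)"] y by force
qed

lemma seminorm_le_quotient_norm:
  assumes x: "x \<in> carrier R"
  shows "p x \<le> 2 * K * quotient_norm (null_coset R p x, \<zero>\<^bsub>Q\<^esub>)"
proof -
  let ?Z = "(null_coset R p x, \<zero>\<^bsub>Q\<^esub>)"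
  have Z: "?Z = coset_pair (x, \<zero>)" 
    by (simp add: coset_pair_def p.quotient_constants)
  have xC: "(x, \<zero>) \<in> carrier (complexification R)" using x by simp
  have ZD: "?Z \<in> carrier (complexification Q)"
    unfolding Z by (rule coset_pair_hom(1)[OF xC xC])
  have "p x \<le> (2 * K + e) * (quotient_norm ?Z + e)" if "0 < e" for e
  proof -
    obtain z where z: "z \<in> carrier (complexification R)" "coset_pair z = ?Z" "N z < quotient_norm ?Z + e"
      using quotient_norm_less[OF ZD, of "quotient_norm ?Z + e"] \<open>0 < e\<close> by auto
    have "p x = pair_seminorm (x, \<zero>)" by (simp add: pair_seminorm_def p.p_zero)
    also have "\<dots> = pair_seminorm z"
      using P.p.p_cong[OF xC z(1)] coset_pair_eq_iff[OF xC z(1)] z(2) Z by simp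
    also have "\<dots> \<le> 2 * K * N z" by (rule P.p_le[OF z(1)])
    also have "\<dots> \<le> (2 * K + e) * (quotient_norm ?Z + e)"
      using z(3) K_nonneg C.nrm_nonneg[OF z(1)] \<open>0 < e\<close> by (intro mult_mono) auto
    finally show ?thesis .
  qed
  then show ?thesis by (rule le_mult_of_add_eps)
qed

text \<open>
  The infimum over representatives inherits the triangle inequality, homogeneity, submultiplicativity and
  invariance under conjugation. The inequality \<open>q(z)\<^sup>2 \<le> q(z*z)\<close> is \<open>representative_of_small_square\<close>.
  Completeness is the usual lifting of a series with geometrically decreasing terms.
\<close>

theorem quotient_Cstar: "real_Cstar_pair Q quotient_norm"
proof -
  let ?C = "complexification R" and ?D = "complexification Q"
  interpret Q: star_algebra "\<lambda>t. t" Q by (rule p.quotient_star_algebra)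
  interpret D: star_algebra cnj ?D by (rule complexification_star_algebra) (rule p.quotient_star_algebra)
  note R_alg = star_algebra_axioms and Q_alg = p.quotient_star_algebra
  have smult_le: "quotient_norm (k \<odot>\<^bsub>?D\<^esub> Z) \<le> cmod k * quotient_norm Z" if Z: "Z \<in> carrier ?D" for k Z
  proof -
    have "quotient_norm (k \<odot>\<^bsub>?D\<^esub> Z) \<le> (cmod k + e) * (quotient_norm Z + e)" if "0 < e" for e
    proof -
      obtain z where z: "z \<in> carrier ?C" "coset_pair z = Z" "N z < quotient_norm Z + e"
        using quotient_norm_less[OF Z, of "quotient_norm Z + e"] \<open>0 < e\<close> by auto
      have "quotient_norm (k \<odot>\<^bsub>?D\<^esub> Z) \<le> N (k \<odot>\<^bsub>?C\<^esub> z)"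
        using coset_pair_hom(4)[OF z(1) z(1)] z(2) C.smult_closed[OF z(1)] by (intro quotient_norm_le) simp_all
      also have "\<dots> \<le> (cmod k + e) * (quotient_norm Z + e)"
        unfolding C.nrm_smult[OF z(1)] using z(3) \<open>0 < e\<close> C.nrm_nonneg[OF z(1)] by (intro mult_mono) auto
      finally show ?thesis .
    qed
    then show ?thesis by (rule le_mult_of_add_eps)
  qed
  have mult_le: "quotient_norm (Z \<otimes>\<^bsub>?D\<^esub> W) \<le> quotient_norm Z * quotient_norm W"
    if Z: "Z \<in> carrier ?D" and W: "W \<in> carrier ?D" for Z W
  proof (rule le_mult_of_add_eps)
    fix e :: real assume "0 < e"
    obtain z where z: "z \<in> carrier ?C" "coset_pair z = Z" "N z < quotient_norm Z + e"
      using quotient_norm_less[OF Z, of "quotient_norm Z + e"] \<open>0 < e\<close> by auto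
    obtain w where w: "w \<in> carrier ?C" "coset_pair w = W" "N w < quotient_norm W + e"
      using quotient_norm_less[OF W, of "quotient_norm W + e"] \<open>0 < e\<close> by auto
    have "quotient_norm (Z \<otimes>\<^bsub>?D\<^esub> W) \<le> N (z \<otimes>\<^bsub>?C\<^esub> w)"
      using coset_pair_hom(3)[OF z(1) w(1)] z(1,2) w(1,2) C.m_closed by (intro quotient_norm_le) simp_all
    also have "\<dots> \<le> N z * N w" by (rule C.nrm_mult[OF z(1) w(1)])
    also have "\<dots> \<le> (quotient_norm Z + e) * (quotient_norm W + e)"
      using z(3) w(3) C.nrm_nonneg[OF z(1)] C.nrm_nonneg[OF w(1)] by (intro mult_mono) auto
    finally show "quotient_norm (Z \<otimes>\<^bsub>?D\<^esub> W) \<le> (quotient_norm Z + e) * (quotient_norm W + e)" .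
  qed
  have star_le: "quotient_norm (star ?D Z) \<le> quotient_norm Z" if Z: "Z \<in> carrier ?D" for Z
  proof (rule dense_ge)
    fix t assume "quotient_norm Z < t"
    obtain z where z: "z \<in> carrier ?C" "coset_pair z = Z" "N z < t"
      using quotient_norm_less[OF Z \<open>quotient_norm Z < t\<close>] by blast
    then show "quotient_norm (star ?D Z) \<le> t"
      using quotient_norm_le[OF C.star_closed[OF z(1)], of "star ?D Z"] coset_pair_hom(5)[OF z(1) z(1)]
        C.p_star[OF z(1)] by simp
  qed
  have conj_le: "quotient_norm (cx_conj Q Z) \<le> quotient_norm Z" if Z: "Z \<in> carrier ?D" for Z
  proof (rule dense_ge)
    fix t assume "quotient_norm Z < t"
    then obtain z where z: "z \<in> carrier ?C" "coset_pair z = Z" "N z < t"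
      using quotient_norm_less[OF Z] by blast
    have "N (cx_conj R z) = N z"
      using z(1) N_conj by (auto simp: cx_conj_def)
    then show "quotient_norm (cx_conj Q Z) \<le> t"
      using quotient_norm_le[OF cx_conj_simps(1)[OF R_alg z(1) z(1)], of "cx_conj Q Z"]
        coset_pair_hom(6)[OF z(1) z(1)] z by simp
  qed
  have limits: "\<exists>l\<in>carrier Q. (\<lambda>n. quotient_norm (X n \<ominus>\<^bsub>Q\<^esub> l, \<zero>\<^bsub>Q\<^esub>)) \<longlonglongrightarrow> 0"
    if X: "\<And>n. X n \<in> carrier Q" "\<And>n. quotient_norm (X (Suc n) \<ominus>\<^bsub>Q\<^esub> X n, \<zero>\<^bsub>Q\<^esub>) \<le> (1 / 2) ^ n" for X
  proof -
    have "\<exists>y. y \<in> carrier R \<and> null_coset R p y = X (Suc n) \<ominus>\<^bsub>Q\<^esub> X n \<and> N (y, \<zero>) \<le> 2 * (1 / 2) ^ n" for n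
    proof -
      have "quotient_norm (X (Suc n) \<ominus>\<^bsub>Q\<^esub> X n, \<zero>\<^bsub>Q\<^esub>) < 2 * (1 / 2) ^ n"
        using X(2)[of n] by (rule order.strict_trans1) simp
      moreover have "(X (Suc n) \<ominus>\<^bsub>Q\<^esub> X n, \<zero>\<^bsub>Q\<^esub>) \<in> carrier ?D" using X(1) by simp
      ultimately obtain z where z: "z \<in> carrier ?C" "coset_pair z = (X (Suc n) \<ominus>\<^bsub>Q\<^esub> X n, \<zero>\<^bsub>Q\<^esub>)" "N z < 2 * (1 / 2) ^ n"
        using quotient_norm_less by blast
      then obtain y y' where y: "z = (y, y')" "y \<in> carrier R" "y' \<in> carrier R" by auto
      then show ?thesis
        using real_part_le[OF y(2,3)] z(2,3) by (intro exI[of _ y]) (simp add: coset_pair_def)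
    qed
    then obtain y where y: "\<And>n. y n \<in> carrier R" "\<And>n. null_coset R p (y n) = X (Suc n) \<ominus>\<^bsub>Q\<^esub> X n"
      "\<And>n. N (y n, \<zero>) \<le> 2 * (1 / 2) ^ n"
      by metis
    \<comment> \<open>The lifted partial sums: \<open>s n\<close> represents \<open>X n\<close>.\<close>
    define s where "s = rec_nat (representative (X 0)) (\<lambda>n x. x \<oplus> y n)"
    have s_Suc: "s (Suc n) = s n \<oplus> y n" for n by (simp add: s_def)
    have s: "s n \<in> carrier R \<and> null_coset R p (s n) = X n" for n
    proof (induction n)
      case 0
      show ?case using p.representative_in[OF X(1)[of 0]] by (simp add: s_def)
    next
      case (Suc n)
      have "X n \<oplus>\<^bsub>Q\<^esub> (X (Suc n) \<ominus>\<^bsub>Q\<^esub> X n) = X (Suc n)"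
        using X(1)[of n] X(1)[of "Suc n"] Q.add_minus_cancel Q.a_comm by simp
      then show ?case
        using Suc y(1,2)[of n] p.quotient_operations(1)[of "s n" "y n"] by (simp add: s_Suc)
    qed
    have "s (Suc n) \<ominus> s n = y n" for n
      unfolding s_Suc using s[of n] y(1)[of n] by algebra
    then obtain a where a: "a \<in> carrier R" "(\<lambda>n. N (s n \<ominus> a, \<zero>)) \<longlonglongrightarrow> 0"
      using Cauchy_limit_real[of s 2] s y(3) by metis
    show ?thesis
    proof (rule bexI[of _ "null_coset R p a"])
      have "quotient_norm (X n \<ominus>\<^bsub>Q\<^esub> null_coset R p a, \<zero>\<^bsub>Q\<^esub>) \<le> N (s n \<ominus> a, \<zero>)" for n
      proof (rule quotient_norm_le)
        show "coset_pair (s n \<ominus> a, \<zero>) = (X n \<ominus>\<^bsub>Q\<^esub> null_coset R p a, \<zero>\<^bsub>Q\<^esub>)"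
          using star_hom_minus[OF R_alg Q_alg p.null_coset_hom, of "s n" a] s[of n] a(1)
          by (simp add: coset_pair_def p.quotient_constants)
      qed (use s[of n] a(1) in simp)
      then show "(\<lambda>n. quotient_norm (X n \<ominus>\<^bsub>Q\<^esub> null_coset R p a, \<zero>\<^bsub>Q\<^esub>)) \<longlonglongrightarrow> 0"
        using X(1) a(1) by (intro real_tendsto_sandwich[OF _ _ tendsto_const a(2)])
          (auto intro!: always_eventually quotient_norm_nonneg)
    qed (use a in simp)
  qed
  show ?thesis
  proof (rule real_Cstar_pairI[OF Q_alg])
    fix Z assume Z: "Z \<in> carrier ?D"
    show "0 \<le> quotient_norm Z" by (rule quotient_norm_nonneg[OF Z])
    show "quotient_norm (cx_conj Q Z) = quotient_norm Z"
      using conj_le[OF Z] conj_le[OF cx_conj_simps(1)[OF Q_alg Z Z]] cx_conj_simps(2)[OF Q_alg Z Z] by simp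
    show "quotient_norm (k \<odot>\<^bsub>?D\<^esub> Z) = cmod k * quotient_norm Z" for k
      by (rule homogeneous_of_le[OF D.star_algebra_axioms Z smult_le quotient_norm_nonneg])
    show "quotient_norm (star ?D Z \<otimes>\<^bsub>?D\<^esub> Z) = (quotient_norm Z)\<^sup>2"
    proof (rule antisym)
      show "quotient_norm (star ?D Z \<otimes>\<^bsub>?D\<^esub> Z) \<le> (quotient_norm Z)\<^sup>2"
        using mult_le[OF D.star_closed[OF Z] Z] mult_right_mono[OF star_le[OF Z] quotient_norm_nonneg[OF Z]]
        by (simp add: power2_eq_square)
      let ?W = "star ?D Z \<otimes>\<^bsub>?D\<^esub> Z"
      have W: "?W \<in> carrier ?D" using Z D.star_closed D.m_closed by blast
      obtain z where z: "z \<in> carrier ?C" "coset_pair z = Z"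
        using coset_pair_surj[OF Z] by blast
      have zz: "star ?C z \<otimes>\<^bsub>?C\<^esub> z \<in> carrier ?C" "coset_pair (star ?C z \<otimes>\<^bsub>?C\<^esub> z) = ?W"
        using coset_pair_hom(3)[OF C.star_closed[OF z(1)] z(1)] coset_pair_hom(5)[OF z(1) z(1)] z C.star_closed C.m_closed by auto
      have "quotient_norm Z \<le> sqrt (quotient_norm ?W)"
      proof (rule dense_ge)
        fix t assume t: "sqrt (quotient_norm ?W) < t"
        obtain s where s: "sqrt (quotient_norm ?W) < s" "s < t"
          using dense[OF t] by blast
        have "0 < s" using s(1) quotient_norm_nonneg[OF W] by (meson le_less_trans real_sqrt_ge_zero)
        then have "quotient_norm ?W < s\<^sup>2"
          using s(1) by (metis less_eq_real_def real_sqrt_less_iff real_sqrt_unique)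
        then obtain w where w: "w \<in> carrier ?C" "coset_pair w = ?W" "N w < s\<^sup>2"
          using quotient_norm_less[OF W] by blast
        have "sqrt (N w) < t"
          using w(3) \<open>0 < s\<close> s(2) by (smt (verit) real_sqrt_less_mono real_sqrt_unique)
        moreover have "pair_seminorm (star ?C z \<otimes>\<^bsub>?C\<^esub> z \<ominus>\<^bsub>?C\<^esub> w) = 0"
          using coset_pair_eq_iff[OF zz(1) w(1)] zz(2) w(2) by simp
        ultimately obtain y where y: "y \<in> carrier ?C" "pair_seminorm (z \<ominus>\<^bsub>?C\<^esub> y) = 0" "N y \<le> t"
          using P.representative_of_small_square[OF z(1) w(1)] by blast
        have "coset_pair y = Z"
          using coset_pair_eq_iff[OF z(1) y(1)] y(2) z(2) by simp
        show "quotient_norm Z \<le> t"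
          using quotient_norm_le[OF y(1) \<open>coset_pair y = Z\<close>] y(3) by simp
      qed
      then show "(quotient_norm Z)\<^sup>2 \<le> quotient_norm ?W"
        using power_mono[of "quotient_norm Z" "sqrt (quotient_norm ?W)" 2] quotient_norm_nonneg[OF Z]
          quotient_norm_nonneg[OF W] by simp
    qed
    fix W assume W: "W \<in> carrier ?D"
    show "quotient_norm (Z \<otimes>\<^bsub>?D\<^esub> W) \<le> quotient_norm Z * quotient_norm W"
      by (rule mult_le[OF Z W])
    show "quotient_norm (Z \<oplus>\<^bsub>?D\<^esub> W) \<le> quotient_norm Z + quotient_norm W"
    proof (rule field_le_epsilon)
      fix e :: real assume "0 < e"
      obtain z where z: "z \<in> carrier ?C" "coset_pair z = Z" "N z < quotient_norm Z + e / 2"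
        using quotient_norm_less[OF Z, of "quotient_norm Z + e / 2"] \<open>0 < e\<close> by auto
      obtain w where w: "w \<in> carrier ?C" "coset_pair w = W" "N w < quotient_norm W + e / 2"
        using quotient_norm_less[OF W, of "quotient_norm W + e / 2"] \<open>0 < e\<close> by auto
      have "quotient_norm (Z \<oplus>\<^bsub>?D\<^esub> W) \<le> N (z \<oplus>\<^bsub>?C\<^esub> w)"
        using coset_pair_hom(2)[OF z(1) w(1)] z(1,2) w(1,2) C.a_closed by (intro quotient_norm_le) simp_all
      then show "quotient_norm (Z \<oplus>\<^bsub>?D\<^esub> W) \<le> quotient_norm Z + quotient_norm W + e"
        using C.nrm_triangle[OF z(1) w(1)] z(3) w(3) by simp
    qed
  next
    show "X = \<zero>\<^bsub>Q\<^esub>" if X: "X \<in> carrier Q" "quotient_norm (X, \<zero>\<^bsub>Q\<^esub>) = 0" for X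
    proof -
      obtain x where x: "x \<in> carrier R" "X = null_coset R p x"
        using p.representative_in[OF X(1)] by metis
      then have "p x \<le> 0" using seminorm_le_quotient_norm[OF x(1)] X(2) by simp
      then have "p (x \<ominus> \<zero>) = 0" using p.p_nonneg[OF x(1)] x(1) by (simp add: a_minus_def)
      then show ?thesis
        using x p.null_coset_eq_iff[of x \<zero>] by (simp add: p.quotient_constants)
    qed
  next
    fix X
    assume "\<And>n. X n \<in> carrier Q" "\<And>n. quotient_norm (X (Suc n) \<ominus>\<^bsub>Q\<^esub> X n, \<zero>\<^bsub>Q\<^esub>) \<le> (1 / 2) ^ n"
    then show "\<exists>l\<in>carrier Q. (\<lambda>n. quotient_norm (X n \<ominus>\<^bsub>Q\<^esub> l, \<zero>\<^bsub>Q\<^esub>)) \<longlonglongrightarrow> 0"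
      by (rule limits)
  qed
qed

end

section \<open>Norm topologies and projective limits of Banach *-algebras\<close>

context alg_norm
begin

lemma continuous_map_norm_topologyI:
  assumes "\<And>x. x \<in> topspace X \<Longrightarrow> f x \<in> carrier A"
    and nbhd: "\<And>x r. x \<in> topspace X \<Longrightarrow> 0 < r \<Longrightarrow>
      \<exists>U. openin X U \<and> x \<in> U \<and> (\<forall>y\<in>U. p (f y \<ominus> f x) < r)"
  shows "continuous_map X (norm_topology A p) f"
  unfolding continuous_map_def
proof (intro conjI allI impI)
  fix V assume V: "openin (norm_topology A p) V"
  show "openin X {x \<in> topspace X. f x \<in> V}"
  proof (subst openin_subopen, intro ballI)
    fix x assume "x \<in> {x \<in> topspace X. f x \<in> V}"
    then have x: "x \<in> topspace X" "f x \<in> V" by auto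
    then obtain r where r: "0 < r" "\<And>y. y \<in> carrier A \<Longrightarrow> p (y \<ominus> f x) < r \<Longrightarrow> y \<in> V"
      using V unfolding openin_norm_topology by blast
    obtain U where U: "openin X U" "x \<in> U" "\<And>y. y \<in> U \<Longrightarrow> p (f y \<ominus> f x) < r"
      using nbhd[OF x(1) r(1)] by blast
    then have "U \<subseteq> {x \<in> topspace X. f x \<in> V}"
      using r(2) assms(1) openin_subset[OF U(1)] by blast
    with U show "\<exists>W. openin X W \<and> x \<in> W \<and> W \<subseteq> {x \<in> topspace X. f x \<in> V}" by blast
  qed
qed (use assms in auto)

lemma Hausdorff_norm_topology: "Hausdorff_space (norm_topology A p)"
  unfolding norm_topology_def by (rule Metric_space.Hausdorff_space_mtopology[OF norm_dist_metric])

end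

text \<open>Scaling turns an inclusion of balls into an inequality of seminorms.\<close>

lemma seminorm_le_of_ball:
  fixes A :: "(real, 'a) star_alg"
  assumes "star_algebra c A" and x: "x \<in> carrier A" and "0 < r"
    and p: "0 \<le> p x" "\<And>k. p (k \<odot>\<^bsub>A\<^esub> x) = \<bar>k\<bar> * p x" and q: "\<And>k. q (k \<odot>\<^bsub>A\<^esub> x) = \<bar>k\<bar> * q x"
    and ball: "\<And>y. y \<in> carrier A \<Longrightarrow> p y < r \<Longrightarrow> q y < 1"
  shows "q x \<le> 1 / r * p x"
proof -
  interpret star_algebra c A by fact
  have "q x * r \<le> p x"
  proof (rule dense_ge)
    fix t assume "p x < t"
    then have "0 < t" using p(1) by simp
    have "p ((r / t) \<odot>\<^bsub>A\<^esub> x) < r"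
      using \<open>p x < t\<close> \<open>0 < t\<close> \<open>0 < r\<close> p(1) by (simp add: p(2) field_simps)
    then have "q ((r / t) \<odot>\<^bsub>A\<^esub> x) < 1"
      using ball smult_closed[OF x] by blast
    then show "q x * r \<le> t"
      using \<open>0 < t\<close> \<open>0 < r\<close> by (simp add: q field_simps)
  qed
  then show ?thesis using \<open>0 < r\<close> by (simp add: field_simps)
qed

lemma norm_topology_star_algebra:
  fixes A (structure)
  assumes "real_banach_star_algebra A nrm"
  shows "real_topological_star_algebra A (norm_topology A nrm)"
    and "locally_convex A (norm_topology A nrm)"
    and "Hausdorff_space (norm_topology A nrm)"
proof -
  interpret banach_star_algebra "\<lambda>t. t" A nrm by fact
  let ?T = "norm_topology A nrm"
  let ?B = "\<lambda>x r. {y \<in> carrier A. nrm (y \<ominus> x) < r}"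
  have ball: "openin ?T (?B x r)" "0 < r \<Longrightarrow> x \<in> ?B x r" if "x \<in> carrier A" for x r
    using that openin_norm_ball p_minus_self by auto
  have top2: "topspace (prod_topology ?T ?T) = carrier A \<times> carrier A" by simp
  show "Hausdorff_space ?T" by (rule Hausdorff_norm_topology)
  have add: "continuous_map (prod_topology ?T ?T) ?T (\<lambda>(x, y). x \<oplus> y)"
  proof (rule continuous_map_norm_topologyI)
    fix z and r :: real assume "z \<in> topspace (prod_topology ?T ?T)" "0 < r"
    then obtain x y where z: "z = (x, y)" "x \<in> carrier A" "y \<in> carrier A" by auto
    define d where "d = r / 2"
    have d: "0 < d" "d + d = r" using \<open>0 < r\<close> by (simp_all add: d_def)
    have "nrm (u \<oplus> v \<ominus> (x \<oplus> y)) < r" if "u \<in> ?B x d" "v \<in> ?B y d" for u v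
    proof -
      have "u \<oplus> v \<ominus> (x \<oplus> y) = (u \<ominus> x) \<oplus> (v \<ominus> y)"
        using that z by (simp add: a_minus_def minus_add a_ac)
      then show ?thesis
        using that z d(2) p_triangle[of "u \<ominus> x" "v \<ominus> y"] by simp
    qed
    then show "\<exists>U. openin (prod_topology ?T ?T) U \<and> z \<in> U \<and>
        (\<forall>w\<in>U. nrm ((case w of (x, y) \<Rightarrow> x \<oplus> y) \<ominus> (case z of (x, y) \<Rightarrow> x \<oplus> y)) < r)"
      using z d(1) ball
      by (intro exI[of _ "?B x d \<times> ?B y d"]) (auto simp: openin_prod_Times_iff p_minus_self)
  qed auto
  have mult: "continuous_map (prod_topology ?T ?T) ?T (\<lambda>(x, y). x \<otimes> y)"
  proof (rule continuous_map_norm_topologyI)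
    fix z and r :: real assume "z \<in> topspace (prod_topology ?T ?T)" "0 < r"
    then obtain x y where z: "z = (x, y)" "x \<in> carrier A" "y \<in> carrier A" by auto
    define d where "d = min 1 (r / (nrm x + nrm y + 2))"
    have den: "0 < nrm x + nrm y + 2" using nrm_nonneg[OF z(2)] nrm_nonneg[OF z(3)] by simp
    have "d \<le> r / (nrm x + nrm y + 2)" by (simp add: d_def)
    then have d: "0 < d" "d \<le> 1" "d * (nrm x + nrm y + 2) \<le> r"
      using den \<open>0 < r\<close> by (simp_all only: pos_le_divide_eq[OF den]) (simp_all add: d_def)
    have "nrm (u \<otimes> v \<ominus> (x \<otimes> y)) < r" if "u \<in> ?B x d" "v \<in> ?B y d" for u v
    proof -
      have uv: "u \<in> carrier A" "v \<in> carrier A" using that by auto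
      have "u \<otimes> v \<ominus> x \<otimes> y = (u \<ominus> x) \<otimes> v \<oplus> x \<otimes> (v \<ominus> y)"
        using uv z by algebra
      then have "nrm (u \<otimes> v \<ominus> x \<otimes> y) \<le> nrm (u \<ominus> x) * nrm v + nrm x * nrm (v \<ominus> y)"
        using uv z p_triangle[of "(u \<ominus> x) \<otimes> v" "x \<otimes> (v \<ominus> y)"]
          p_mult[of "u \<ominus> x" v] p_mult[of x "v \<ominus> y"] by simp
      also have "\<dots> \<le> d * (nrm y + 1) + nrm x * d"
        using that uv z p_le_dist[of v y] d nrm_nonneg
        by (intro add_mono mult_mono) auto
      also have "\<dots> < d * (nrm x + nrm y + 2)"
        using d by (simp add: algebra_simps)
      finally show ?thesis using d by simp
    qed
    then show "\<exists>U. openin (prod_topology ?T ?T) U \<and> z \<in> U \<and>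
        (\<forall>w\<in>U. nrm ((case w of (x, y) \<Rightarrow> x \<otimes> y) \<ominus> (case z of (x, y) \<Rightarrow> x \<otimes> y)) < r)"
      using z d ball
      by (intro exI[of _ "?B x d \<times> ?B y d"]) (auto simp: openin_prod_Times_iff p_minus_self)
  qed auto
  have smult: "continuous_map (prod_topology euclidean ?T) ?T (\<lambda>(k, x). k \<odot> x)"
  proof (rule continuous_map_norm_topologyI)
    fix z :: "real \<times> 'a" and r :: real assume "z \<in> topspace (prod_topology euclidean ?T)" "0 < r"
    then obtain k x where z: "z = (k, x)" "x \<in> carrier A" by auto
    define d where "d = min 1 (r / (\<bar>k\<bar> + nrm x + 2))"
    have den: "0 < \<bar>k\<bar> + nrm x + 2" using nrm_nonneg[OF z(2)] by simp
    have "d \<le> r / (\<bar>k\<bar> + nrm x + 2)" by (simp add: d_def)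
    then have d: "0 < d" "d \<le> 1" "d * (\<bar>k\<bar> + nrm x + 2) \<le> r"
      using den \<open>0 < r\<close> by (simp_all only: pos_le_divide_eq[OF den]) (simp_all add: d_def)
    have "nrm (l \<odot> u \<ominus> (k \<odot> x)) < r" if "l \<in> ball k d" "u \<in> ?B x d" for l u
    proof -
      have u: "u \<in> carrier A" and l: "\<bar>l - k\<bar> < d" using that by (auto simp: dist_real_def)
      have "l \<odot> u \<ominus> k \<odot> x = (l - k) \<odot> u \<oplus> k \<odot> (u \<ominus> x)"
        using u z minus_minus_cancel[of "l \<odot> u" "k \<odot> u" "k \<odot> x"]
        by (simp add: smult_diff_left smult_diff_right alg_closed)
      then have "nrm (l \<odot> u \<ominus> k \<odot> x) \<le> \<bar>l - k\<bar> * nrm u + \<bar>k\<bar> * nrm (u \<ominus> x)"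
        using u z p_triangle[of "(l - k) \<odot> u" "k \<odot> (u \<ominus> x)"] nrm_smult[of u "l - k"] nrm_smult[of "u \<ominus> x" k]
        by (simp add: alg_closed)
      also have "\<dots> \<le> d * (nrm x + 1) + \<bar>k\<bar> * d"
        using that u l z p_le_dist[of u x] d nrm_nonneg
        by (intro add_mono mult_mono) auto
      also have "\<dots> < d * (\<bar>k\<bar> + nrm x + 2)"
        using d by (simp add: algebra_simps)
      finally show ?thesis using d by simp
    qed
    then show "\<exists>U. openin (prod_topology euclidean ?T) U \<and> z \<in> U \<and>
        (\<forall>w\<in>U. nrm ((case w of (k, x) \<Rightarrow> k \<odot> x) \<ominus> (case z of (k, x) \<Rightarrow> k \<odot> x)) < r)"
      using z d ball
      by (intro exI[of _ "ball k d \<times> ?B x d"]) (auto simp: openin_prod_Times_iff p_minus_self)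
  qed (auto simp: alg_closed)
  obtain c where c: "\<And>x. x \<in> carrier A \<Longrightarrow> nrm (star A x) \<le> c * nrm x"
    using star_bounded by blast
  have star: "continuous_map ?T ?T (star A)"
  proof (rule continuous_map_norm_topologyI)
    fix x and r :: real assume "x \<in> topspace ?T" "0 < r"
    then have x: "x \<in> carrier A" by simp
    let ?d = "r / (\<bar>c\<bar> + 1)"
    have "0 < ?d" using \<open>0 < r\<close> by simp
    have "nrm (star A u \<ominus> star A x) < r" if "u \<in> ?B x ?d" for u
    proof -
      have "nrm (star A u \<ominus> star A x) \<le> c * nrm (u \<ominus> x)"
        using that x c[of "u \<ominus> x"] by (simp add: star_diff)
      also have "\<dots> \<le> \<bar>c\<bar> * nrm (u \<ominus> x)"
        using that x nrm_nonneg by (intro mult_right_mono) auto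
      also have "\<dots> \<le> \<bar>c\<bar> * ?d"
        using that by (intro mult_left_mono) auto
      also have "\<dots> < r"
        using \<open>0 < r\<close> by (simp add: field_simps)
      finally show ?thesis .
    qed
    then show "\<exists>U. openin ?T U \<and> x \<in> U \<and> (\<forall>y\<in>U. nrm (star A y \<ominus> star A x) < r)"
      using ball(1)[OF x, of ?d] ball(2)[OF x \<open>0 < ?d\<close>] by blast
  qed (auto simp: alg_closed)
  show "real_topological_star_algebra A ?T"
    using star_algebra_axioms add mult smult star by (simp add: real_topological_star_algebra_def)
  show "locally_convex A ?T"
    unfolding locally_convex_def
  proof (intro allI impI)
    fix U assume "openin ?T U \<and> \<zero> \<in> U"
    then obtain r where r: "0 < r" "\<And>y. y \<in> carrier A \<Longrightarrow> nrm (y \<ominus> \<zero>) < r \<Longrightarrow> y \<in> U"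
      unfolding openin_norm_topology by blast
    show "\<exists>V. openin ?T V \<and> \<zero> \<in> V \<and> V \<subseteq> U \<and>
        (\<forall>x\<in>V. \<forall>y\<in>V. \<forall>t\<in>{0..1}. t \<odot> x \<oplus> (1 - t) \<odot> y \<in> V)"
    proof (intro exI[of _ "?B \<zero> r"] conjI ballI)
      fix x y and t :: real
      assume "x \<in> ?B \<zero> r" "y \<in> ?B \<zero> r" and t: "t \<in> {0..1}"
      then have xy: "x \<in> carrier A" "y \<in> carrier A" "nrm x < r" "nrm y < r"
        by (auto simp: a_minus_def)
      have "nrm (t \<odot> x \<oplus> (1 - t) \<odot> y) \<le> t * nrm x + (1 - t) * nrm y"
        using p_triangle[of "t \<odot> x" "(1 - t) \<odot> y"] nrm_smult[of x t] nrm_smult[of y "1 - t"] xy t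
        by (simp add: alg_closed)
      also have "\<dots> < r"
        using xy t by (intro convex_bound_lt) auto
      finally show "t \<odot> x \<oplus> (1 - t) \<odot> y \<in> ?B \<zero> r"
        using xy by (simp add: a_minus_def alg_closed)
    qed (use ball[OF zero_closed] r in auto)
  qed
qed

lemma continuous_star_hom_bounded:
  assumes "real_banach_star_algebra A n" "real_banach_star_algebra B m" and f: "f \<in> star_hom A B"
    and cont: "continuous_map (norm_topology A n) (norm_topology B m) f"
  obtains c where "0 \<le> c" "\<And>x. x \<in> carrier A \<Longrightarrow> m (f x) \<le> c * n x"
proof -
  interpret A: banach_star_algebra "\<lambda>t. t" A n by fact
  interpret B: banach_star_algebra "\<lambda>t. t" B m by fact
  let ?U = "{x \<in> carrier A. f x \<in> {y \<in> carrier B. m (y \<ominus>\<^bsub>B\<^esub> \<zero>\<^bsub>B\<^esub>) < 1}}"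
  have f0: "f \<zero>\<^bsub>A\<^esub> = \<zero>\<^bsub>B\<^esub>"
    by (rule star_hom_zero[OF _ _ f]) unfold_locales
  have "openin (norm_topology A n) ?U"
    using openin_continuous_map_preimage[OF cont B.openin_norm_ball[OF B.zero_closed, of 1]] by simp
  moreover have "\<zero>\<^bsub>A\<^esub> \<in> ?U"
    by (simp add: f0 B.p_minus_self)
  ultimately obtain r where r: "0 < r" "\<And>y. y \<in> carrier A \<Longrightarrow> n (y \<ominus>\<^bsub>A\<^esub> \<zero>\<^bsub>A\<^esub>) < r \<Longrightarrow> y \<in> ?U"
    unfolding A.openin_norm_topology by blast
  have ball: "m (f y) < 1" if "y \<in> carrier A" "n y < r" for y
    using r(2)[OF that(1)] that star_homD(1)[OF f] by (simp add: a_minus_def)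
  have "m (f x) \<le> 1 / r * n x" if x: "x \<in> carrier A" for x
    by (rule seminorm_le_of_ball[OF A.star_algebra_axioms x r(1), where q = "\<lambda>x. m (f x)"])
      (use x ball A.nrm_nonneg A.nrm_smult B.nrm_smult star_homD(1,4)[OF f] in auto)
  then show thesis
    using that[of "1 / r"] r(1) by simp
qed

lemma bounded_star_hom_continuous:
  assumes "real_banach_star_algebra A n" "real_banach_star_algebra B m" and f: "f \<in> star_hom A B"
    and c: "0 \<le> c" "\<And>x. x \<in> carrier A \<Longrightarrow> m (f x) \<le> c * n x"
  shows "continuous_map (norm_topology A n) (norm_topology B m) f"
proof -
  interpret A: banach_star_algebra "\<lambda>t. t" A n by fact
  interpret B: banach_star_algebra "\<lambda>t. t" B m by fact
  show ?thesis
  proof (rule B.continuous_map_norm_topologyI)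
    fix x and r :: real assume "x \<in> topspace (norm_topology A n)" "0 < r"
    then have x: "x \<in> carrier A" by simp
    let ?d = "r / (c + 1)"
    have "0 < ?d" using c(1) \<open>0 < r\<close> by simp
    have "m (f y \<ominus>\<^bsub>B\<^esub> f x) < r" if "y \<in> carrier A" "n (y \<ominus>\<^bsub>A\<^esub> x) < ?d" for y
    proof -
      have "m (f y \<ominus>\<^bsub>B\<^esub> f x) = m (f (y \<ominus>\<^bsub>A\<^esub> x))"
        using star_hom_minus[OF A.star_algebra_axioms B.star_algebra_axioms f that(1) x] by simp
      also have "\<dots> \<le> c * n (y \<ominus>\<^bsub>A\<^esub> x)" using c(2) that x by simp
      also have "\<dots> \<le> c * ?d" using that(2) c(1) by (intro mult_left_mono) auto
      also have "\<dots> < r" using c(1) \<open>0 < r\<close> by (simp add: field_simps)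
      finally show ?thesis .
    qed
    then show "\<exists>U. openin (norm_topology A n) U \<and> x \<in> U \<and> (\<forall>y\<in>U. m (f y \<ominus>\<^bsub>B\<^esub> f x) < r)"
      using A.openin_norm_ball[OF x, of ?d] x A.p_minus_self[OF x] \<open>0 < ?d\<close>
      by (intro exI[of _ "{y \<in> carrier A. n (y \<ominus>\<^bsub>A\<^esub> x) < ?d}"]) auto
  qed (use star_homD(1)[OF f] in auto)
qed

locale banach_projective_family =
  projective_family I below E "\<lambda>i. norm_topology (E i) (nrm i)" g
  for I :: "'i set" and below and E :: "'i \<Rightarrow> (real, 'e) star_alg" and nrm g +
  assumes banach: "i \<in> I \<Longrightarrow> real_banach_star_algebra (E i) (nrm i)"
begin

abbreviation L :: "(real, 'i \<Rightarrow> 'e) star_alg"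
  where "L \<equiv> projective_limit I below E g"

abbreviation L_topology :: "('i \<Rightarrow> 'e) topology"
  where "L_topology \<equiv> projective_limit_topology I below E (\<lambda>i. norm_topology (E i) (nrm i)) g"

lemma coordinate_bound:
  assumes "i \<in> I" "j \<in> I" "below i j"
  obtains c where "0 \<le> c" "\<And>x y. x \<in> carrier L \<Longrightarrow> y \<in> carrier L \<Longrightarrow>
    nrm i (x i \<ominus>\<^bsub>E i\<^esub> y i) \<le> c * nrm j (x j \<ominus>\<^bsub>E j\<^esub> y j)"
proof -
  interpret Ei: banach_star_algebra "\<lambda>t. t" "E i" "nrm i" using assms banach by simp
  interpret Ej: banach_star_algebra "\<lambda>t. t" "E j" "nrm j" using assms banach by simp
  obtain c where c: "0 \<le> c" "\<And>x. x \<in> carrier (E j) \<Longrightarrow> nrm i (g i j x) \<le> c * nrm j x"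
    using continuous_star_hom_bounded[OF banach banach hom cont] assms by metis
  have "nrm i (x i \<ominus>\<^bsub>E i\<^esub> y i) \<le> c * nrm j (x j \<ominus>\<^bsub>E j\<^esub> y j)"
    if "x \<in> carrier L" "y \<in> carrier L" for x y
  proof -
    have xy: "x i = g i j (x j)" "y i = g i j (y j)" "x j \<in> carrier (E j)" "y j \<in> carrier (E j)"
      using that assms by (auto simp: projective_limit_def)
    then have "x i \<ominus>\<^bsub>E i\<^esub> y i = g i j (x j \<ominus>\<^bsub>E j\<^esub> y j)"
      using star_hom_minus[OF Ej.star_algebra_axioms Ei.star_algebra_axioms hom] assms by simp
    then show ?thesis using c(2)[of "x j \<ominus>\<^bsub>E j\<^esub> y j"] xy by simp
  qed
  with c(1) that show thesis by blast
qed

lemma upper_bound: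
  assumes "finite F" "F \<subseteq> I"
  obtains j where "j \<in> I" "\<And>i. i \<in> F \<Longrightarrow> below i j"
proof -
  have "\<exists>j\<in>I. \<forall>i\<in>F. below i j"
    using assms
  proof (induction F)
    case empty
    then show ?case using directed by (auto simp: upward_directed_def)
  next
    case (insert k F)
    then obtain j where j: "j \<in> I" "\<forall>i\<in>F. below i j" by auto
    obtain l where l: "l \<in> I" "below k l" "below j l"
      using directed j(1) insert.prems unfolding upward_directed_def by blast
    have "below i l" if "i \<in> F" for i
      using directed j l that insert.prems unfolding upward_directed_def transp_on_def by blast
    with l show ?case by auto
  qed
  with that show thesis by blast
qed

text \<open>
  The index set is directed and the connecting maps are bounded, so finitely many conditions on
  coordinates follow from a single condition on a coordinate above all of them.
\<close>

lemma openin_L_topology: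
  "openin L_topology V \<longleftrightarrow> V \<subseteq> carrier L \<and>
    (\<forall>x\<in>V. \<exists>i\<in>I. \<exists>r>0. \<forall>y\<in>carrier L. nrm i (y i \<ominus>\<^bsub>E i\<^esub> x i) < r \<longrightarrow> y \<in> V)"
proof
  let ?P = "product_topology (\<lambda>i. norm_topology (E i) (nrm i)) I"
  assume "openin L_topology V"
  then obtain W where W: "openin ?P W" "V = W \<inter> carrier L"
    by (auto simp: projective_limit_topology_def openin_subtopology)
  show "V \<subseteq> carrier L \<and>
    (\<forall>x\<in>V. \<exists>i\<in>I. \<exists>r>0. \<forall>y\<in>carrier L. nrm i (y i \<ominus>\<^bsub>E i\<^esub> x i) < r \<longrightarrow> y \<in> V)"
  proof (intro conjI ballI)
    fix x assume "x \<in> V"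
    then have x: "x \<in> W" "x \<in> carrier L" using W by auto
    from W(1)[unfolded openin_product_topology_alt, rule_format, OF x(1)]
    obtain U where U: "finite {i \<in> I. U i \<noteq> topspace (norm_topology (E i) (nrm i))}"
      "\<And>i. i \<in> I \<Longrightarrow> openin (norm_topology (E i) (nrm i)) (U i)" "x \<in> Pi\<^sub>E I U" "Pi\<^sub>E I U \<subseteq> W"
      by (elim exE conjE) (rule that, simp_all)
    let ?F = "{i \<in> I. U i \<noteq> topspace (norm_topology (E i) (nrm i))}"
    obtain j where j: "j \<in> I" "\<And>i. i \<in> ?F \<Longrightarrow> below i j"
      using upper_bound[OF U(1)] by auto
    have "\<exists>r>0. \<forall>y\<in>carrier L. nrm j (y j \<ominus>\<^bsub>E j\<^esub> x j) < r \<longrightarrow> y i \<in> U i" if i: "i \<in> ?F" for i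
    proof -
      interpret Ei: banach_star_algebra "\<lambda>t. t" "E i" "nrm i" using i banach by simp
      have "x i \<in> U i" using U(3) i by auto
      then obtain r where r: "0 < r" "\<And>y. y \<in> carrier (E i) \<Longrightarrow> nrm i (y \<ominus>\<^bsub>E i\<^esub> x i) < r \<Longrightarrow> y \<in> U i"
        using U(2)[of i] i unfolding Ei.openin_norm_topology by blast
      obtain c where c: "0 \<le> c" "\<And>x y. x \<in> carrier L \<Longrightarrow> y \<in> carrier L \<Longrightarrow>
          nrm i (x i \<ominus>\<^bsub>E i\<^esub> y i) \<le> c * nrm j (x j \<ominus>\<^bsub>E j\<^esub> y j)"
        using coordinate_bound[of i j] i j by auto
      have "y i \<in> U i" if y: "y \<in> carrier L" "nrm j (y j \<ominus>\<^bsub>E j\<^esub> x j) < r / (c + 1)" for y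
      proof (rule r(2))
        show "y i \<in> carrier (E i)" using y(1) i by (auto simp: projective_limit_def)
        have "nrm i (y i \<ominus>\<^bsub>E i\<^esub> x i) \<le> c * (r / (c + 1))"
          using c(2)[OF y(1) x(2)] y(2) c(1) by (meson less_imp_le mult_left_mono order.trans)
        also have "\<dots> < r" using c(1) r(1) by (simp add: field_simps)
        finally show "nrm i (y i \<ominus>\<^bsub>E i\<^esub> x i) < r" .
      qed
      then show ?thesis using r(1) c(1) by (intro exI[of _ "r / (c + 1)"]) auto
    qed
    then have "\<forall>i\<in>?F. \<exists>r. 0 < r \<and> (\<forall>y\<in>carrier L. nrm j (y j \<ominus>\<^bsub>E j\<^esub> x j) < r \<longrightarrow> y i \<in> U i)"
      by blast
    from bchoice[OF this] obtain r where
      "\<forall>i\<in>?F. 0 < r i \<and> (\<forall>y\<in>carrier L. nrm j (y j \<ominus>\<^bsub>E j\<^esub> x j) < r i \<longrightarrow> y i \<in> U i)"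
      by (elim exE)
    then have r: "\<And>i. i \<in> ?F \<Longrightarrow> 0 < r i"
      "\<And>i y. i \<in> ?F \<Longrightarrow> y \<in> carrier L \<Longrightarrow> nrm j (y j \<ominus>\<^bsub>E j\<^esub> x j) < r i \<Longrightarrow> y i \<in> U i"
      by blast+
    define s where "s = Min (insert 1 (r ` ?F))"
    have s: "0 < s" "\<And>i. i \<in> ?F \<Longrightarrow> s \<le> r i"
      using U(1) r(1) by (auto simp: s_def)
    have "y \<in> V" if y: "y \<in> carrier L" "nrm j (y j \<ominus>\<^bsub>E j\<^esub> x j) < s" for y
    proof -
      have "y i \<in> U i" if "i \<in> I" for i
      proof (cases "i \<in> ?F")
        case True
        then show ?thesis using r(2)[OF True y(1)] s(2)[OF True] y(2) by simp
      next
        case False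
        interpret Ei: banach_star_algebra "\<lambda>t. t" "E i" "nrm i" using that banach by simp
        show ?thesis using False that y(1) by (auto simp: projective_limit_def)
      qed
      then have "y \<in> Pi\<^sub>E I U" using y(1) by (auto simp: projective_limit_def PiE_iff)
      then show ?thesis using U(4) W(2) y(1) by auto
    qed
    with s(1) j(1) show "\<exists>i\<in>I. \<exists>r>0. \<forall>y\<in>carrier L. nrm i (y i \<ominus>\<^bsub>E i\<^esub> x i) < r \<longrightarrow> y \<in> V" by blast
  qed (use W in auto)
next
  assume *: "V \<subseteq> carrier L \<and>
    (\<forall>x\<in>V. \<exists>i\<in>I. \<exists>r>0. \<forall>y\<in>carrier L. nrm i (y i \<ominus>\<^bsub>E i\<^esub> x i) < r \<longrightarrow> y \<in> V)"
  show "openin L_topology V"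
  proof (subst openin_subopen, intro ballI)
    fix x assume x: "x \<in> V"
    then obtain i r where ir: "i \<in> I" "0 < r" "\<And>y. y \<in> carrier L \<Longrightarrow> nrm i (y i \<ominus>\<^bsub>E i\<^esub> x i) < r \<Longrightarrow> y \<in> V"
      using * by blast
    interpret Ei: banach_star_algebra "\<lambda>t. t" "E i" "nrm i" using ir banach by simp
    have xL: "x \<in> carrier L" using * x by blast
    then have xi: "x i \<in> carrier (E i)" using ir(1) by (auto simp: projective_limit_def)
    have "continuous_map L_topology (norm_topology (E i) (nrm i)) (\<lambda>y. y i)"
      unfolding projective_limit_topology_def
      by (intro continuous_map_from_subtopology continuous_map_product_projection ir(1))
    from openin_continuous_map_preimage[OF this Ei.openin_norm_ball[OF xi, of r]]
    have "openin L_topology {y \<in> topspace L_topology. y i \<in> {z \<in> carrier (E i). nrm i (z \<ominus>\<^bsub>E i\<^esub> x i) < r}}" .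
    moreover have top: "topspace L_topology = carrier L"
    proof -
      have "carrier L \<subseteq> (\<Pi>\<^sub>E i\<in>I. topspace (norm_topology (E i) (nrm i)))"
      proof
        fix y assume y: "y \<in> carrier L"
        have "topspace (norm_topology (E i) (nrm i)) = carrier (E i)" if "i \<in> I" for i
          using algebras[OF that] by (simp add: real_topological_star_algebra_def)
        then show "y \<in> (\<Pi>\<^sub>E i\<in>I. topspace (norm_topology (E i) (nrm i)))"
          using y by (auto simp: projective_limit_def PiE_iff)
      qed
      then show ?thesis by (auto simp: projective_limit_topology_def)
    qed
    ultimately show "\<exists>W. openin L_topology W \<and> x \<in> W \<and> W \<subseteq> V"
      using xL xi ir Ei.p_minus_self[OF xi]
      by (intro exI[of _ "{y \<in> topspace L_topology. y i \<in> {z \<in> carrier (E i). nrm i (z \<ominus>\<^bsub>E i\<^esub> x i) < r}}"]) auto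
  qed
qed

lemma topspace_L_topology: "topspace L_topology = carrier L"
proof -
  have "I \<noteq> {}" using directed by (simp add: upward_directed_def)
  then have "openin L_topology (carrier L)"
    unfolding openin_L_topology by (auto intro!: exI[of _ 1])
  moreover have "topspace L_topology \<subseteq> carrier L"
    by (auto simp: projective_limit_topology_def)
  ultimately show ?thesis using openin_subset by blast
qed

end

section \<open>A limit of quotients of a dense C*-subalgebra\<close>

lemma star_subalgebraD:
  assumes "star_subalgebra B A"
  shows "x \<in> B \<Longrightarrow> x \<in> carrier A" "\<one>\<^bsub>A\<^esub> \<in> B"
    "x \<in> B \<Longrightarrow> y \<in> B \<Longrightarrow> x \<oplus>\<^bsub>A\<^esub> y \<in> B" "x \<in> B \<Longrightarrow> y \<in> B \<Longrightarrow> x \<otimes>\<^bsub>A\<^esub> y \<in> B"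
    "x \<in> B \<Longrightarrow> k \<odot>\<^bsub>A\<^esub> x \<in> B" "x \<in> B \<Longrightarrow> star A x \<in> B"
  using assms by (auto simp: star_subalgebra_def)

lemma subalgebra_star_algebra:
  assumes A: "star_algebra c A" and B: "star_subalgebra B A"
  shows "star_algebra c (A\<lparr>carrier := B\<rparr>)"
    and "x \<in> B \<Longrightarrow> \<ominus>\<^bsub>A\<lparr>carrier := B\<rparr>\<^esub> x = \<ominus>\<^bsub>A\<^esub> x"
    and "x \<in> B \<Longrightarrow> y \<in> B \<Longrightarrow> x \<ominus>\<^bsub>A\<lparr>carrier := B\<rparr>\<^esub> y = x \<ominus>\<^bsub>A\<^esub> y"
    and "\<zero>\<^bsub>A\<^esub> \<in> B" and "x \<in> B \<Longrightarrow> \<ominus>\<^bsub>A\<^esub> x \<in> B" and "x \<in> B \<Longrightarrow> y \<in> B \<Longrightarrow> x \<ominus>\<^bsub>A\<^esub> y \<in> B"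
proof -
  interpret star_algebra c A by fact
  note D = star_subalgebraD[OF B]
  let ?R = "A\<lparr>carrier := B\<rparr>"
  show zero: "\<zero>\<^bsub>A\<^esub> \<in> B"
    using D(5)[OF D(2), of 0] smult_zero_left[OF one_closed] by simp
  have neg: "\<ominus>\<^bsub>A\<^esub> x \<in> B" if "x \<in> B" for x
    using D(5)[OF that, of "- 1"] smult_neg_left[OF D(1)[OF that], of 1] smult_one[OF D(1)[OF that]] by simp
  then show "x \<in> B \<Longrightarrow> \<ominus>\<^bsub>A\<^esub> x \<in> B" .
  show "x \<in> B \<Longrightarrow> y \<in> B \<Longrightarrow> x \<ominus>\<^bsub>A\<^esub> y \<in> B"
    using neg D(3) by (simp add: a_minus_def)
  have "abelian_group ?R"
  proof (rule abelian_groupI)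
    show "\<exists>y\<in>carrier ?R. y \<oplus>\<^bsub>?R\<^esub> x = \<zero>\<^bsub>?R\<^esub>" if "x \<in> carrier ?R" for x
      using that neg D(1) by (intro bexI[of _ "\<ominus>\<^bsub>A\<^esub> x"]) (simp_all add: l_neg)
  qed (use D zero in \<open>simp_all add: a_ac\<close>)
  moreover have "monoid ?R"
    by unfold_locales (use D in \<open>simp_all add: m_assoc\<close>)
  ultimately have "ring ?R"
    by (rule ringI) (use D in \<open>simp_all add: l_distr r_distr\<close>)
  then show R: "star_algebra c ?R"
  proof (rule star_algebra.intro)
    show "star_algebra_axioms c ?R"
      by unfold_locales (use D in \<open>simp_all add: smult_l_distr smult_r_distr smult_assoc smult_one
          smult_mult_left smult_mult_right star_star star_add star_mult star_smult\<close>)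
  qed
  interpret R: star_algebra c ?R by (rule R)
  have neg_eq: "\<ominus>\<^bsub>?R\<^esub> x = \<ominus>\<^bsub>A\<^esub> x" if "x \<in> B" for x
    using R.minus_equality[of "\<ominus>\<^bsub>A\<^esub> x" x] that neg D(1) by (simp add: l_neg)
  then show "x \<in> B \<Longrightarrow> \<ominus>\<^bsub>?R\<^esub> x = \<ominus>\<^bsub>A\<^esub> x" .
  show "x \<in> B \<Longrightarrow> y \<in> B \<Longrightarrow> x \<ominus>\<^bsub>?R\<^esub> y = x \<ominus>\<^bsub>A\<^esub> y"
    by (simp add: a_minus_def neg_eq)
qed

text \<open>
  The function \<open>f\<close> stands for the distance, measured by \<open>p\<close>, to a point outside \<open>R\<close> that elements of \<open>R\<close>
  approximate. Since \<open>p\<close>-small differences have norm-small representatives, a sequence of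
  approximations can be chosen norm convergent, and its limit is at distance 0. This shows that the image
  of a C*-algebra in a Banach *-algebra is closed.
\<close>

lemma (in real_Cstar_quotient) distance_attained:
  assumes nonneg: "\<And>x. x \<in> carrier R \<Longrightarrow> 0 \<le> f x"
    and lipschitz: "\<And>x y. x \<in> carrier R \<Longrightarrow> y \<in> carrier R \<Longrightarrow> f x \<le> f y + p (x \<ominus> y)"
    and inf: "\<And>e. 0 < e \<Longrightarrow> \<exists>x\<in>carrier R. f x < e"
    and sum: "\<And>x y. x \<in> carrier R \<Longrightarrow> y \<in> carrier R \<Longrightarrow> p (x \<ominus> y) \<le> f x + f y"
  shows "\<exists>x\<in>carrier R. f x = 0"
proof -
  let ?c = "4 * (sqrt D + 1)"
  define P where "P n x \<longleftrightarrow> x \<in> carrier R \<and> f x < (1 / 2) ^ n" for n x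
  have "\<exists>s. \<forall>n. P n (s n) \<and> N (s (Suc n) \<ominus> s n, \<zero>) \<le> ?c * (1 / 2) ^ n"
  proof (rule dependent_nat_choice)
    show "\<exists>x. P 0 x" using inf[of 1] by (auto simp: P_def)
  next
    fix x n assume "P n x"
    then have x: "x \<in> carrier R" "f x < (1 / 2) ^ n" by (simp_all add: P_def)
    obtain b where b: "b \<in> carrier R" "f b < (1 / 2) ^ Suc n"
      using inf[of "(1 / 2) ^ Suc n"] by auto
    have half: "(0::real) < (1 / 2) ^ n" "(1 / 2) ^ Suc n < (1 / 2 :: real) ^ n" by simp_all
    have "p (b \<ominus> x) \<le> 2 * (1 / 2) ^ n"
      using sum[OF b(1) x(1)] b(2) x(2) half by linarith
    then have "sqrt D * p (b \<ominus> x) \<le> sqrt D * (2 * (1 / 2) ^ n)"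
      using D_nonneg by (intro mult_left_mono) auto
    also have "\<dots> = 2 * sqrt D * (1 / 2) ^ n" by simp
    also have "\<dots> < ?c * (1 / 2) ^ n"
    proof (rule mult_strict_right_mono)
      have "0 \<le> sqrt D" using D_nonneg by simp
      then have "0 < 2 * sqrt D + 4" by (intro add_nonneg_pos) simp_all
      moreover have "?c = 2 * sqrt D + (2 * sqrt D + 4)" by (simp add: algebra_simps)
      ultimately show "2 * sqrt D < ?c" by (simp only: less_add_same_cancel1)
    qed simp
    finally obtain y where y: "y \<in> carrier R" "p (b \<ominus> x \<ominus> y) = 0" "N (y, \<zero>) \<le> ?c * (1 / 2) ^ n"
      using bounded_representative[of "b \<ominus> x"] b(1) x(1) by blast
    have "x \<oplus> y \<ominus> x = y" "b \<ominus> (x \<oplus> y) = b \<ominus> x \<ominus> y"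
      using x(1) y(1) b(1) by algebra+
    moreover have "f (x \<oplus> y) < (1 / 2) ^ Suc n"
      using lipschitz[of "x \<oplus> y" b] p.p_sym[of b "x \<oplus> y"] calculation(2) x(1) y(1,2) b by simp
    ultimately show "\<exists>t. P (Suc n) t \<and> N (t \<ominus> x, \<zero>) \<le> ?c * (1 / 2) ^ n"
      using x(1) y(1,3) by (intro exI[of _ "x \<oplus> y"]) (simp add: P_def)
  qed
  then obtain s where s: "\<And>n. P n (s n)" "\<And>n. N (s (Suc n) \<ominus> s n, \<zero>) \<le> ?c * (1 / 2) ^ n"
    by blast
  have sR: "s n \<in> carrier R" "f (s n) < (1 / 2) ^ n" for n
    using s(1)[of n] by (simp_all add: P_def)
  obtain l where l: "l \<in> carrier R" "(\<lambda>n. N (s n \<ominus> l, \<zero>)) \<longlonglongrightarrow> 0"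
    by (rule Cauchy_limit_real[OF sR(1) s(2)])
  have "f l \<le> 0"
  proof (rule tendsto_le[OF sequentially_bot _ tendsto_const])
    have "(\<lambda>n. (1 / 2) ^ n + K * N (s n \<ominus> l, \<zero>)) \<longlonglongrightarrow> 0 + K * 0"
      by (intro tendsto_intros l(2) LIMSEQ_power_zero) auto
    then show "(\<lambda>n. (1 / 2) ^ n + K * N (s n \<ominus> l, \<zero>)) \<longlonglongrightarrow> 0" by simp
    show "\<forall>\<^sub>F n in sequentially. f l \<le> (1 / 2) ^ n + K * N (s n \<ominus> l, \<zero>)"
    proof (intro always_eventually allI)
      fix n
      show "f l \<le> (1 / 2) ^ n + K * N (s n \<ominus> l, \<zero>)"
        using lipschitz[OF l(1) sR(1)[of n]] sR[of n] p.p_sym[OF l(1) sR(1)[of n]] p_le[of "s n \<ominus> l"] l(1)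
        by simp
    qed
  qed
  then show ?thesis
    using nonneg[OF l(1)] l(1) by (intro bexI[of _ l]) simp_all
qed

lemma real_Cstar_imp_banach: "real_Cstar_algebra A n \<Longrightarrow> real_banach_star_algebra A n"
  by (simp add: real_Cstar_algebra_def)

text \<open>
  As the inclusion is continuous, the open unit ball of \<open>p\<close> contains a ball of the norm.
\<close>

lemma seminorm_bounded_on_subalgebra:
  assumes A: "real_star_algebra A" and B: "star_subalgebra B A"
    and banach: "real_banach_star_algebra (A\<lparr>carrier := B\<rparr>) n"
    and cont: "continuous_map (norm_topology (A\<lparr>carrier := B\<rparr>) n) T (\<lambda>x. x)"
    and p: "alg_seminorm (\<lambda>t. t) A p" "\<And>k x. x \<in> carrier A \<Longrightarrow> p (k \<odot>\<^bsub>A\<^esub> x) = \<bar>k\<bar> * p x"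
    and ball: "openin T {b \<in> carrier A. p (b \<ominus>\<^bsub>A\<^esub> \<zero>\<^bsub>A\<^esub>) < 1}"
  obtains K where "0 \<le> K" "\<And>b. b \<in> B \<Longrightarrow> p b \<le> K * n b"
proof -
  let ?R = "A\<lparr>carrier := B\<rparr>" and ?V = "{b \<in> carrier A. p (b \<ominus>\<^bsub>A\<^esub> \<zero>\<^bsub>A\<^esub>) < 1}"
  interpret p: alg_seminorm "\<lambda>t. t" A p by (rule p(1))
  interpret R: banach_star_algebra "\<lambda>t. t" ?R n by (rule banach)
  note sub = subalgebra_star_algebra[OF A B] and BD = star_subalgebraD[OF B]
  let ?U = "{x \<in> B. x \<in> ?V}"
  have op: "openin (norm_topology ?R n) ?U"
    using openin_continuous_map_preimage[OF cont ball] by simp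
  have zero: "\<zero>\<^bsub>A\<^esub> \<in> ?U"
    using sub(4) p.p_minus_self[OF p.zero_closed] by simp
  from op[unfolded R.openin_norm_topology, THEN conjunct2, THEN bspec, OF zero]
  obtain r where r: "0 < r" "\<forall>y\<in>carrier ?R. n (y \<ominus>\<^bsub>?R\<^esub> \<zero>\<^bsub>A\<^esub>) < r \<longrightarrow> y \<in> ?U"
    by (elim exE conjE) (rule that)
  have small: "p y < 1" if "y \<in> B" "n y < r" for y
  proof -
    have "y \<ominus>\<^bsub>?R\<^esub> \<zero>\<^bsub>A\<^esub> = y" "y \<ominus>\<^bsub>A\<^esub> \<zero>\<^bsub>A\<^esub> = y"
      using sub(3)[OF that(1) sub(4)] BD(1)[OF that(1)] by (simp_all add: a_minus_def)
    then show ?thesis using r(2)[THEN bspec, of y] that by simp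
  qed
  have "p b \<le> 1 / r * n b" if b: "b \<in> B" for b
  proof (rule seminorm_le_of_ball[OF R.star_algebra_axioms _ r(1)])
    show "b \<in> carrier ?R" using b by simp
    then show "0 \<le> n b" "n (k \<odot>\<^bsub>?R\<^esub> b) = \<bar>k\<bar> * n b" for k
      using R.nrm_nonneg R.nrm_smult[of b k] by simp_all
    show "p (k \<odot>\<^bsub>?R\<^esub> b) = \<bar>k\<bar> * p b" for k
      using p(2)[OF BD(1)[OF b]] by simp
    show "p y < 1" if "y \<in> carrier ?R" "n y < r" for y
      using small that by simp
  qed
  then show thesis using that[of "1 / r"] r(1) by simp
qed

lemma closure_of_meets_open:
  assumes "x \<in> X closure_of S" "openin X U" "x \<in> U"
  obtains y where "y \<in> S" "y \<in> U"
  using assms unfolding in_closure_of by blast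

text \<open>
  What is needed in order to write \<open>A\<close> as the limit of the quotients of \<open>B\<close>: a directed separating
  family of seminorms defining the topology, every element of \<open>A\<close> agreeing with an element of \<open>B\<close> up to the
  kernel of each given seminorm, and completeness in the form that compatible families of elements, one
  for each seminorm, come from a single element.
\<close>

locale dense_Cstar_presentation =
  fixes A :: "(real, 'a) star_alg" (structure) and T :: "'a topology" and B :: "'a set"
    and N :: "'a \<times> 'a \<Rightarrow> real" and P :: "('a \<Rightarrow> real) set"
  assumes A_top: "real_topological_star_algebra A T"
    and B_sub: "star_subalgebra B A"
    and seminorm: "q \<in> P \<Longrightarrow> star_seminorm (\<lambda>t. t) A q"
    and quotient: "q \<in> P \<Longrightarrow> \<exists>K D. real_Cstar_quotient (A\<lparr>carrier := B\<rparr>) N q K D"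
    and P_nonempty: "P \<noteq> {}"
    and P_directed: "\<lbrakk>q \<in> P; q' \<in> P\<rbrakk> \<Longrightarrow> \<exists>r\<in>P. \<exists>c\<ge>0. \<forall>a\<in>carrier A. q a \<le> c * r a \<and> q' a \<le> c * r a"
    and dense: "\<lbrakk>q \<in> P; a \<in> carrier A\<rbrakk> \<Longrightarrow> \<exists>b\<in>B. q (a \<ominus> b) = 0"
    and openin_T: "openin T U \<longleftrightarrow> U \<subseteq> carrier A \<and>
      (\<forall>a\<in>U. \<exists>q\<in>P. \<exists>r>0. \<forall>b\<in>carrier A. q (b \<ominus> a) < r \<longrightarrow> b \<in> U)"
    and separating: "\<lbrakk>a \<in> carrier A; \<And>q. q \<in> P \<Longrightarrow> q a = 0\<rbrakk> \<Longrightarrow> a = \<zero>"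
    and coherent: "\<lbrakk>\<And>q. q \<in> P \<Longrightarrow> x q \<in> carrier A;
      \<And>q q' c. q \<in> P \<Longrightarrow> q' \<in> P \<Longrightarrow> 0 \<le> c \<Longrightarrow> (\<And>a. a \<in> carrier A \<Longrightarrow> q a \<le> c * q' a) \<Longrightarrow>
        q (x q \<ominus> x q') = 0\<rbrakk> \<Longrightarrow> \<exists>a\<in>carrier A. \<forall>q\<in>P. q (a \<ominus> x q) = 0"
begin

abbreviation R :: "(real, 'a) star_alg"
  where "R \<equiv> A\<lparr>carrier := B\<rparr>"

text \<open>
  The seminorms index the limit. They are compared up to constants, since the Banach norms from which
  they come are determined only up to equivalence by the topology; the resulting relation is a preorder.
\<close>

definition dominates :: "('a \<Rightarrow> real) \<Rightarrow> ('a \<Rightarrow> real) \<Rightarrow> bool"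
  where "dominates q q' \<longleftrightarrow> (\<exists>c\<ge>0. \<forall>a\<in>carrier A. q a \<le> c * q' a)"

abbreviation factor :: "('a \<Rightarrow> real) \<Rightarrow> (real, 'a set) star_alg"
  where "factor q \<equiv> quotient_algebra R q"

definition factor_norm :: "('a \<Rightarrow> real) \<Rightarrow> 'a set \<Rightarrow> real"
  where "factor_norm q X = real_Cstar_quotient.quotient_norm R N q (X, \<zero>\<^bsub>factor q\<^esub>)"

definition transition :: "('a \<Rightarrow> real) \<Rightarrow> ('a \<Rightarrow> real) \<Rightarrow> 'a set \<Rightarrow> 'a set"
  where "transition q q' X = null_coset R q (representative X)"

lemma A_alg: "real_star_algebra A"
  using A_top by (simp add: real_topological_star_algebra_def)

lemmas R_alg = subalgebra_star_algebra(1)[OF A_alg B_sub]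
  and R_neg = subalgebra_star_algebra(2)[OF A_alg B_sub]
  and R_minus = subalgebra_star_algebra(3)[OF A_alg B_sub]
  and B_minus = subalgebra_star_algebra(6)[OF A_alg B_sub]
  and B_D = star_subalgebraD[OF B_sub]

lemma star_seminorm_R: "q \<in> P \<Longrightarrow> star_seminorm (\<lambda>t. t) R q"
proof -
  assume "q \<in> P"
  then obtain K D where "real_Cstar_quotient R N q K D" using quotient by blast
  then interpret real_Cstar_quotient R N q K D .
  show ?thesis by unfold_locales
qed

lemma factor_Cstar:
  assumes "q \<in> P"
  shows "real_Cstar_algebra (factor q) (factor_norm q)"
    and "\<exists>c\<ge>0. \<forall>b\<in>B. factor_norm q (null_coset R q b) \<le> c * q b \<and> q b \<le> c * factor_norm q (null_coset R q b)"
proof -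
  obtain K D where "real_Cstar_quotient R N q K D" using quotient assms by blast
  then interpret real_Cstar_quotient R N q K D .
  interpret Q: real_Cstar_pair "factor q" quotient_norm by (rule quotient_Cstar)
  have fn: "factor_norm q = (\<lambda>X. quotient_norm (X, \<zero>\<^bsub>factor q\<^esub>))"
    by (simp add: factor_norm_def fun_eq_iff)
  show "real_Cstar_algebra (factor q) (factor_norm q)"
    unfolding fn by (rule Q.real_Cstar_algebra)
  let ?c = "max (sqrt D) (2 * K)"
  have "factor_norm q (null_coset R q b) \<le> ?c * q b \<and> q b \<le> ?c * factor_norm q (null_coset R q b)"
    if "b \<in> B" for b
  proof
    have b: "b \<in> carrier R" using that by simp
    have "sqrt D * q b \<le> ?c * q b"
      using p.p_nonneg[OF b] by (intro mult_right_mono) auto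
    then show "factor_norm q (null_coset R q b) \<le> ?c * q b"
      using quotient_norm_le_seminorm[OF b] unfolding fn by simp
    have "0 \<le> factor_norm q (null_coset R q b)"
      unfolding fn using p.null_coset_in[OF b] Q.zero_closed by (intro quotient_norm_nonneg) simp
    then have "2 * K * factor_norm q (null_coset R q b) \<le> ?c * factor_norm q (null_coset R q b)"
      by (intro mult_right_mono) auto
    then show "q b \<le> ?c * factor_norm q (null_coset R q b)"
      using seminorm_le_quotient_norm[OF b] unfolding fn by simp
  qed
  moreover have "0 \<le> ?c" using D_nonneg by (simp add: le_max_iff_disj)
  ultimately show "\<exists>c\<ge>0. \<forall>b\<in>B. factor_norm q (null_coset R q b) \<le> c * q b \<and>
      q b \<le> c * factor_norm q (null_coset R q b)" by blast
qed

lemma dominates_null: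
  assumes "dominates q q'" "q \<in> P" "x \<in> carrier A" "q' x = 0"
  shows "q x = 0"
proof -
  interpret star_seminorm "\<lambda>t. t" A q using seminorm assms by blast
  show ?thesis
    using assms p_nonneg[OF assms(3)] by (auto simp: dominates_def intro!: antisym)
qed

lemma transition_null_coset:
  assumes "dominates q q'" "q \<in> P" "q' \<in> P" "b \<in> B"
  shows "transition q q' (null_coset R q' b) = null_coset R q b"
proof -
  interpret q: star_seminorm "\<lambda>t. t" R q using star_seminorm_R assms by blast
  interpret q': star_seminorm "\<lambda>t. t" R q' using star_seminorm_R assms by blast
  let ?r = "representative (null_coset R q' b)"
  have r: "?r \<in> B" "q' (?r \<ominus> b) = 0"
    using q'.representative_null_coset[of b] assms(4) R_minus by auto
  then have "q (?r \<ominus> b) = 0"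
    using dominates_null[OF assms(1,2)] B_minus assms(4) B_D(1) by blast
  then show ?thesis
    using q.null_coset_eq_iff[of ?r b] r(1) assms(4) R_minus by (simp add: transition_def)
qed

lemma transition_hom:
  assumes d: "dominates q q'" and q: "q \<in> P" "q' \<in> P"
  shows "transition q q' \<in> star_hom (factor q') (factor q)"
proof -
  interpret R: star_algebra "\<lambda>t. t" R by (rule R_alg)
  interpret q: star_seminorm "\<lambda>t. t" R q using star_seminorm_R q by blast
  interpret q': star_seminorm "\<lambda>t. t" R q' using star_seminorm_R q by blast
  have rep: "\<exists>b\<in>B. X = null_coset R q' b" if "X \<in> carrier (factor q')" for X
    using q'.representative_in[OF that] by (intro bexI[of _ "representative X"]) auto
  note tr = transition_null_coset[OF d q]
  have ops: "transition q q' (X \<oplus>\<^bsub>factor q'\<^esub> Y) = transition q q' X \<oplus>\<^bsub>factor q\<^esub> transition q q' Y"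
    "transition q q' (X \<otimes>\<^bsub>factor q'\<^esub> Y) = transition q q' X \<otimes>\<^bsub>factor q\<^esub> transition q q' Y"
    "transition q q' (k \<odot>\<^bsub>factor q'\<^esub> X) = k \<odot>\<^bsub>factor q\<^esub> transition q q' X"
    "transition q q' (star (factor q') X) = star (factor q) (transition q q' X)"
    "transition q q' X \<in> carrier (factor q)"
    if "X \<in> carrier (factor q')" "Y \<in> carrier (factor q')" for X Y k
  proof -
    from rep[OF that(1)] obtain x where x: "x \<in> B" "X = null_coset R q' x" by blast
    from rep[OF that(2)] obtain y where y: "y \<in> B" "Y = null_coset R q' y" by blast
    note xy = x y
    show "transition q q' (X \<oplus>\<^bsub>factor q'\<^esub> Y) = transition q q' X \<oplus>\<^bsub>factor q\<^esub> transition q q' Y"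
      "transition q q' (X \<otimes>\<^bsub>factor q'\<^esub> Y) = transition q q' X \<otimes>\<^bsub>factor q\<^esub> transition q q' Y"
      "transition q q' (k \<odot>\<^bsub>factor q'\<^esub> X) = k \<odot>\<^bsub>factor q\<^esub> transition q q' X"
      "transition q q' (star (factor q') X) = star (factor q) (transition q q' X)"
      "transition q q' X \<in> carrier (factor q)"
      using xy B_D q.quotient_operations[of x y] q'.quotient_operations[of x y] q.null_coset_in[of x]
      by (simp_all add: tr)
  qed
  moreover have "transition q q' \<one>\<^bsub>factor q'\<^esub> = \<one>\<^bsub>factor q\<^esub>"
    using B_D(2) by (simp add: q.quotient_constants q'.quotient_constants tr)
  ultimately show ?thesis
    by (simp add: star_hom_def ring_hom_def)
qed

lemma factor_family: "banach_projective_family P dominates factor factor_norm transition"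
proof (intro banach_projective_family.intro banach_projective_family_axioms.intro projective_family.intro)
  show "upward_directed P dominates"
    unfolding upward_directed_def
  proof (intro conjI ballI)
    show "P \<noteq> {}" by (rule P_nonempty)
    show "reflp_on P dominates"
      by (auto simp: reflp_on_def dominates_def intro!: exI[of _ 1])
    show "transp_on P dominates"
      unfolding transp_on_def dominates_def
    proof (intro ballI impI)
      fix q1 q2 q3 :: "'a \<Rightarrow> real"
      assume "\<exists>c\<ge>0. \<forall>a\<in>carrier A. q1 a \<le> c * q2 a" "\<exists>c\<ge>0. \<forall>a\<in>carrier A. q2 a \<le> c * q3 a"
      then obtain c d where c: "0 \<le> c" "\<And>a. a \<in> carrier A \<Longrightarrow> q1 a \<le> c * q2 a"
        and d: "0 \<le> d" "\<And>a. a \<in> carrier A \<Longrightarrow> q2 a \<le> d * q3 a" by blast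
      have "q1 a \<le> c * d * q3 a" if "a \<in> carrier A" for a
        using c(2)[OF that] mult_left_mono[OF d(2)[OF that] c(1)] by simp
      then show "\<exists>c\<ge>0. \<forall>a\<in>carrier A. q1 a \<le> c * q3 a"
        using c(1) d(1) by (intro exI[of _ "c * d"]) simp
    qed
    show "\<exists>k\<in>P. dominates i k \<and> dominates j k" if "i \<in> P" "j \<in> P" for i j
      using P_directed[OF that] unfolding dominates_def by blast
  qed
next
  fix q assume q: "q \<in> P"
  interpret q: star_seminorm "\<lambda>t. t" R q using star_seminorm_R q by blast
  show banach: "real_banach_star_algebra (factor q) (factor_norm q)"
    by (rule real_Cstar_imp_banach[OF factor_Cstar(1)[OF q]])
  show "real_topological_star_algebra (factor q) (norm_topology (factor q) (factor_norm q))"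
    "locally_convex (factor q) (norm_topology (factor q) (factor_norm q))"
    "Hausdorff_space (norm_topology (factor q) (factor_norm q))"
    by (rule norm_topology_star_algebra[OF banach])+
  show "transition q q X = X" if "X \<in> carrier (factor q)" for X
    using q.representative_in[OF that] by (simp add: transition_def)
next
  fix q q' assume q: "q \<in> P" "q' \<in> P" and d: "dominates q q'"
  show hom: "transition q q' \<in> star_hom (factor q') (factor q)"
    by (rule transition_hom[OF d q])
  interpret q': star_seminorm "\<lambda>t. t" R q' using star_seminorm_R q by blast
  obtain c where c: "0 \<le> c" "\<And>a. a \<in> carrier A \<Longrightarrow> q a \<le> c * q' a"
    using d unfolding dominates_def by blast
  obtain d where d': "0 \<le> d" "\<And>b. b \<in> B \<Longrightarrow> factor_norm q (null_coset R q b) \<le> d * q b"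
    using factor_Cstar(2)[OF q(1)] by blast
  obtain e where e: "0 \<le> e" "\<And>b. b \<in> B \<Longrightarrow> q' b \<le> e * factor_norm q' (null_coset R q' b)"
    using factor_Cstar(2)[OF q(2)] by blast
  have "factor_norm q (transition q q' X) \<le> d * c * e * factor_norm q' X" if X: "X \<in> carrier (factor q')" for X
  proof -
    let ?b = "representative X"
    have b: "?b \<in> B" "null_coset R q' ?b = X"
      using q'.representative_in[OF X] by simp_all
    have "factor_norm q (transition q q' X) \<le> d * q ?b"
      using d'(2)[OF b(1)] by (simp add: transition_def)
    also have "\<dots> \<le> d * (c * (e * factor_norm q' X))"
      using e(2)[OF b(1)] b c(2)[OF B_D(1)[OF b(1)]] c(1) d'(1)
      by (intro mult_left_mono) (auto intro: order.trans mult_left_mono)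
    finally show ?thesis by (simp add: mult.assoc)
  qed
  then show "continuous_map (norm_topology (factor q') (factor_norm q')) (norm_topology (factor q) (factor_norm q)) (transition q q')"
    using c(1) d'(1) e(1) q
    by (intro bounded_star_hom_continuous[OF _ _ hom, of _ _ "d * c * e"] real_Cstar_imp_banach factor_Cstar) auto
next
  fix q1 q2 q3 X
  assume q: "q1 \<in> P" "q2 \<in> P" "q3 \<in> P" "dominates q1 q2" "dominates q2 q3" "X \<in> carrier (factor q3)"
  interpret q3: star_seminorm "\<lambda>t. t" R q3 using star_seminorm_R q by blast
  let ?b = "representative X"
  have "?b \<in> B" using q3.representative_in[OF q(6)] by simp
  then have "transition q1 q2 (transition q2 q3 X) = null_coset R q1 ?b"
    using transition_null_coset[OF q(4,1,2), of ?b] by (simp add: transition_def[of q2])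
  then show "transition q1 q3 X = transition q1 q2 (transition q2 q3 X)"
    by (simp add: transition_def[of q1 q3])
qed

text \<open>
  By \<open>to_factors_eq\<close> every element of \<open>B\<close> that agrees with \<open>a\<close> for \<open>q\<close> gives the same coset.
\<close>

definition to_factors :: "'a \<Rightarrow> ('a \<Rightarrow> real) \<Rightarrow> 'a set"
  where "to_factors a = (\<lambda>q\<in>P. null_coset R q (SOME b. b \<in> B \<and> q (a \<ominus> b) = 0))"

lemma to_factors_eq:
  assumes q: "q \<in> P" and a: "a \<in> carrier A" and b: "b \<in> B" "q (a \<ominus> b) = 0"
  shows "to_factors a q = null_coset R q b"
proof -
  interpret q: star_seminorm "\<lambda>t. t" R q using star_seminorm_R q by blast
  interpret A: star_seminorm "\<lambda>t. t" A q using seminorm q by blast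
  define b' where "b' = (SOME b. b \<in> B \<and> q (a \<ominus> b) = 0)"
  have b': "b' \<in> B \<and> q (a \<ominus> b') = 0"
    unfolding b'_def using b by (intro someI) blast
  then have "q (b' \<ominus> b) = 0"
    using A.null_coset_eq_iff[of a b] A.null_coset_eq_iff[of a b'] A.null_coset_eq_iff[of b' b] a b B_D(1) by simp
  then show ?thesis
    using q q.null_coset_eq_iff[of b' b] b' b(1) R_minus by (simp add: to_factors_def b'_def)
qed

lemma to_factors_norm:
  assumes q: "q \<in> P"
  obtains c where "0 < c"
    and "\<And>a a'. a \<in> carrier A \<Longrightarrow> a' \<in> carrier A \<Longrightarrow>
      factor_norm q (to_factors a q \<ominus>\<^bsub>factor q\<^esub> to_factors a' q) \<le> c * q (a \<ominus> a')"
    and "\<And>a a'. a \<in> carrier A \<Longrightarrow> a' \<in> carrier A \<Longrightarrow>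
      q (a \<ominus> a') \<le> c * factor_norm q (to_factors a q \<ominus>\<^bsub>factor q\<^esub> to_factors a' q)"
proof -
  interpret R: star_algebra "\<lambda>t. t" R by (rule R_alg)
  interpret q: star_seminorm "\<lambda>t. t" R q using star_seminorm_R q by blast
  interpret A: star_seminorm "\<lambda>t. t" A q using seminorm q by blast
  interpret F: banach_star_algebra "\<lambda>t. t" "factor q" "factor_norm q"
    by (rule real_Cstar_imp_banach[OF factor_Cstar(1)[OF q]])
  obtain c where c: "0 \<le> c" "\<And>b. b \<in> B \<Longrightarrow> factor_norm q (null_coset R q b) \<le> c * q b"
    "\<And>b. b \<in> B \<Longrightarrow> q b \<le> c * factor_norm q (null_coset R q b)"
    using factor_Cstar(2)[OF q] by blast
  have "factor_norm q (to_factors a q \<ominus>\<^bsub>factor q\<^esub> to_factors a' q) \<le> (c + 1) * q (a \<ominus> a') \<and>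
    q (a \<ominus> a') \<le> (c + 1) * factor_norm q (to_factors a q \<ominus>\<^bsub>factor q\<^esub> to_factors a' q)"
    if a: "a \<in> carrier A" "a' \<in> carrier A" for a a'
  proof -
    obtain b b' where b: "b \<in> B" "q (a \<ominus> b) = 0" "b' \<in> B" "q (a' \<ominus> b') = 0"
      using dense[OF q] a by meson
    let ?X = "null_coset R q (b \<ominus> b')"
    have X: "to_factors a q \<ominus>\<^bsub>factor q\<^esub> to_factors a' q = ?X"
      using star_hom_minus[OF R.star_algebra_axioms F.star_algebra_axioms q.null_coset_hom, of b b'] b R_minus a
        to_factors_eq[OF q a(1) b(1,2)] to_factors_eq[OF q a(2) b(3,4)] by simp
    have bb: "b \<ominus> b' \<in> B" using B_minus b by simp
    have bA: "b \<in> carrier A" "b' \<in> carrier A" using b B_D(1) by simp_all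
    have "q (a \<ominus> a') = q (b \<ominus> b')"
    proof -
      have "null_coset A q a = null_coset A q b" "null_coset A q a' = null_coset A q b'"
        using A.null_coset_eq_iff a b bA by simp_all
      then have "null_coset A q (a \<ominus> a') = null_coset A q (b \<ominus> b')"
        using star_hom_minus[OF A.star_algebra_axioms A.quotient_star_algebra A.null_coset_hom] a bA by metis
      then have "q ((a \<ominus> a') \<ominus> (b \<ominus> b')) = 0"
        using A.null_coset_eq_iff a bA by simp
      then show ?thesis using A.p_cong[of "a \<ominus> a'" "b \<ominus> b'"] a bA by simp
    qed
    moreover have "0 \<le> q (b \<ominus> b')" using A.p_nonneg bA by simp
    moreover have "0 \<le> factor_norm q ?X" using bb q.null_coset_in F.nrm_nonneg by simp
    ultimately show ?thesis
      using c(2,3)[OF bb] unfolding X by (simp add: distrib_right)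
  qed
  with c(1) show thesis by (intro that[of "c + 1"]) auto
qed

lemma to_factors_hom: "to_factors \<in> star_hom A (projective_limit P dominates factor transition)"
proof -
  let ?L = "projective_limit P dominates factor transition"
  interpret A: star_algebra "\<lambda>t. t" A by (rule A_alg)
  have val: "to_factors a q \<in> carrier (factor q)" if a: "a \<in> carrier A" and q: "q \<in> P" for a q
  proof -
    interpret q: star_seminorm "\<lambda>t. t" R q using star_seminorm_R q by blast
    obtain b where "b \<in> B" "q (a \<ominus> b) = 0" using dense[OF q a] by blast
    then show ?thesis using to_factors_eq[OF q a] q.null_coset_in by simp
  qed
  have in_L: "to_factors a \<in> carrier ?L" if a: "a \<in> carrier A" for a
  proof -
    have "to_factors a q = transition q q' (to_factors a q')" if q: "q \<in> P" "q' \<in> P" "dominates q q'" for q q'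
    proof -
      obtain b where b: "b \<in> B" "q' (a \<ominus> b) = 0" using dense q(2) a by blast
      then have "q (a \<ominus> b) = 0"
        using dominates_null[OF q(3,1)] a B_D(1) by simp
      then show ?thesis
        using to_factors_eq[OF q(1) a b(1)] to_factors_eq[OF q(2) a b] transition_null_coset[OF q(3,1,2) b(1)] by simp
    qed
    then show ?thesis
      using val[OF a] by (auto simp: projective_limit_def to_factors_def)
  qed
  have ops: "to_factors (a \<oplus> a') q = to_factors a q \<oplus>\<^bsub>factor q\<^esub> to_factors a' q"
    "to_factors (a \<otimes> a') q = to_factors a q \<otimes>\<^bsub>factor q\<^esub> to_factors a' q"
    "to_factors (k \<odot> a) q = k \<odot>\<^bsub>factor q\<^esub> to_factors a q"
    "to_factors (star A a) q = star (factor q) (to_factors a q)"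
    "to_factors \<one> q = \<one>\<^bsub>factor q\<^esub>"
    if a: "a \<in> carrier A" "a' \<in> carrier A" and q: "q \<in> P" for a a' k q
  proof -
    interpret q: star_seminorm "\<lambda>t. t" R q using star_seminorm_R q by blast
    interpret A: star_seminorm "\<lambda>t. t" A q using seminorm q by blast
    obtain b b' where b: "b \<in> B" "q (a \<ominus> b) = 0" "b' \<in> B" "q (a' \<ominus> b') = 0"
      using dense[OF q] a by meson
    have bA: "b \<in> carrier A" "b' \<in> carrier A" using b B_D(1) by simp_all
    note ab = to_factors_eq[OF q a(1) b(1,2)] to_factors_eq[OF q a(2) b(3,4)]
    have "null_coset A q a = null_coset A q b" "null_coset A q a' = null_coset A q b'"
      using A.null_coset_eq_iff a b bA by simp_all
    then have "null_coset A q (a \<oplus> a') = null_coset A q (b \<oplus> b')"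
      "null_coset A q (a \<otimes> a') = null_coset A q (b \<otimes> b')"
      "null_coset A q (k \<odot> a) = null_coset A q (k \<odot> b)"
      "null_coset A q (star A a) = null_coset A q (star A b)"
      using A.quotient_operations[OF a] A.quotient_operations[OF bA] by metis+
    then have "q (a \<oplus> a' \<ominus> (b \<oplus> b')) = 0" "q (a \<otimes> a' \<ominus> (b \<otimes> b')) = 0"
      "q (k \<odot> a \<ominus> (k \<odot> b)) = 0" "q (star A a \<ominus> star A b) = 0"
      using A.null_coset_eq_iff a bA A.alg_closed by simp_all
    then show "to_factors (a \<oplus> a') q = to_factors a q \<oplus>\<^bsub>factor q\<^esub> to_factors a' q"
      "to_factors (a \<otimes> a') q = to_factors a q \<otimes>\<^bsub>factor q\<^esub> to_factors a' q"
      "to_factors (k \<odot> a) q = k \<odot>\<^bsub>factor q\<^esub> to_factors a q"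
      "to_factors (star A a) q = star (factor q) (to_factors a q)"
      using a b B_D A.alg_closed q.quotient_operations[of b b'] ab
      by (simp_all add: to_factors_eq[OF q])
    show "to_factors \<one> q = \<one>\<^bsub>factor q\<^esub>"
      using to_factors_eq[OF q A.one_closed B_D(2)] A.p_minus_self[OF A.one_closed] by (simp add: q.quotient_constants)
  qed
  have eqI: "f = f'" if "f \<in> extensional P" "f' \<in> extensional P" "\<And>q. q \<in> P \<Longrightarrow> f q = f' q"
    for f f' :: "('a \<Rightarrow> real) \<Rightarrow> 'a set"
    using that by (rule extensionalityI)
  have ext: "to_factors a \<in> extensional P" for a
    by (simp add: to_factors_def)
  have "to_factors (a \<oplus> a') = to_factors a \<oplus>\<^bsub>?L\<^esub> to_factors a'"
    "to_factors (a \<otimes> a') = to_factors a \<otimes>\<^bsub>?L\<^esub> to_factors a'"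
    "to_factors (k \<odot> a) = k \<odot>\<^bsub>?L\<^esub> to_factors a"
    "to_factors (star A a) = star ?L (to_factors a)"
    if a: "a \<in> carrier A" "a' \<in> carrier A" for a a' k
    by (rule eqI, rule ext, simp add: projective_limit_def, simp add: projective_limit_def ops[OF a])+
  moreover have "to_factors \<one> = \<one>\<^bsub>?L\<^esub>"
    by (rule eqI, rule ext, simp add: projective_limit_def,
        simp add: projective_limit_def ops(5)[OF A.one_closed A.one_closed])
  ultimately show ?thesis
    using in_L by (simp add: star_hom_def ring_hom_def)
qed

lemma to_factors_inj: "inj_on to_factors (carrier A)"
proof (rule inj_onI)
  interpret A: star_algebra "\<lambda>t. t" A by (rule A_alg)
  fix a a' assume a: "a \<in> carrier A" "a' \<in> carrier A" and eq: "to_factors a = to_factors a'"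
  have "q (a \<ominus> a') = 0" if q: "q \<in> P" for q
  proof -
    interpret q: star_seminorm "\<lambda>t. t" R q using star_seminorm_R q by blast
    interpret A: star_seminorm "\<lambda>t. t" A q using seminorm q by blast
    obtain b b' where b: "b \<in> B" "q (a \<ominus> b) = 0" "b' \<in> B" "q (a' \<ominus> b') = 0"
      using dense[OF q] a by meson
    have "null_coset R q b = null_coset R q b'"
      using to_factors_eq[OF q a(1) b(1,2)] to_factors_eq[OF q a(2) b(3,4)] eq by simp
    then have "q (b \<ominus> b') = 0"
      using q.null_coset_eq_iff b R_minus by simp
    then show ?thesis
      using A.null_coset_eq_iff[of a b] A.null_coset_eq_iff[of a' b'] A.null_coset_eq_iff[of b b']
        A.null_coset_eq_iff[of a a'] a b B_D(1) by simp
  qed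
  then have "a \<ominus> a' = \<zero>" using separating a by simp
  then show "a = a'" using A.minus_eq_iff a by simp
qed

lemma to_factors_surj:
  assumes X: "X \<in> carrier (projective_limit P dominates factor transition)"
  shows "\<exists>a\<in>carrier A. to_factors a = X"
proof -
  interpret A: star_algebra "\<lambda>t. t" A by (rule A_alg)
  define x where "x q = representative (X q)" for q
  have x: "x q \<in> B" "null_coset R q (x q) = X q" if q: "q \<in> P" for q
  proof -
    interpret q: star_seminorm "\<lambda>t. t" R q using star_seminorm_R q by blast
    have "X q \<in> carrier (factor q)" using X q by (auto simp: projective_limit_def)
    then show "x q \<in> B" "null_coset R q (x q) = X q"
      using q.representative_in by (simp_all add: x_def)
  qed
  have "\<exists>a\<in>carrier A. \<forall>q\<in>P. q (a \<ominus> x q) = 0"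
  proof (rule coherent)
    show "x q \<in> carrier A" if "q \<in> P" for q using x(1)[OF that] B_D(1) by simp
    fix q q' c assume q: "q \<in> P" "q' \<in> P" and c: "0 \<le> c" "\<And>a. a \<in> carrier A \<Longrightarrow> q a \<le> c * q' a"
    interpret q: star_seminorm "\<lambda>t. t" R q using star_seminorm_R q by blast
    have "dominates q q'" using c by (auto simp: dominates_def)
    then have "X q = transition q q' (X q')" using X q by (auto simp: projective_limit_def)
    then have "null_coset R q (x q) = null_coset R q (x q')"
      using x(2)[OF q(1)] by (simp add: transition_def x_def)
    then show "q (x q \<ominus> x q') = 0"
      using q.null_coset_eq_iff x(1) q R_minus by simp
  qed
  then obtain a where a: "a \<in> carrier A" "\<And>q. q \<in> P \<Longrightarrow> q (a \<ominus> x q) = 0" by blast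
  have "to_factors a = X"
  proof (rule extensionalityI[of _ P])
    show "to_factors a \<in> extensional P" by (simp add: to_factors_def)
    show "X \<in> extensional P" using X by (auto simp: projective_limit_def PiE_def)
    show "to_factors a q = X q" if "q \<in> P" for q
      using to_factors_eq[OF that a(1) x(1)[OF that] a(2)[OF that]] x(2)[OF that] by simp
  qed
  with a(1) show ?thesis by blast
qed

theorem locally_Cstar: "real_locally_Cstar_algebra TYPE('a \<Rightarrow> real) TYPE('a set) A T"
proof -
  interpret F: banach_projective_family P dominates factor factor_norm transition by (rule factor_family)
  let ?L = "projective_limit P dominates factor transition"
  have surj: "to_factors ` carrier A = carrier ?L"
    using to_factors_surj star_homD(1)[OF to_factors_hom] by blast
  have top_T: "topspace T = carrier A"
    using A_top by (simp add: real_topological_star_algebra_def)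
  have open_iff: "openin F.L_topology (to_factors ` U) \<longleftrightarrow> openin T U" if U: "U \<subseteq> carrier A" for U
  proof
    assume op: "openin F.L_topology (to_factors ` U)"
    show "openin T U"
      unfolding openin_T
    proof (intro conjI ballI)
      fix a assume a: "a \<in> U"
      from op[unfolded F.openin_L_topology, THEN conjunct2, rule_format, OF imageI[OF a]]
      obtain q r where q: "q \<in> P" "0 < r"
        "\<And>y. y \<in> carrier ?L \<Longrightarrow> factor_norm q (y q \<ominus>\<^bsub>factor q\<^esub> to_factors a q) < r \<Longrightarrow> y \<in> to_factors ` U"
        by blast
      obtain c where c: "0 < c" "\<And>a a'. a \<in> carrier A \<Longrightarrow> a' \<in> carrier A \<Longrightarrow>
          factor_norm q (to_factors a q \<ominus>\<^bsub>factor q\<^esub> to_factors a' q) \<le> c * q (a \<ominus> a')"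
        by (rule to_factors_norm[OF q(1)]) (rule that)
      have "b \<in> U" if b: "b \<in> carrier A" "q (b \<ominus> a) < r / c" for b
      proof -
        have "c * q (b \<ominus> a) < r" using b(2) c(1) by (simp add: field_simps)
        moreover have "to_factors b \<in> carrier ?L" using surj b(1) by blast
        moreover have "a \<in> carrier A" using a U by blast
        ultimately have "to_factors b \<in> to_factors ` U"
          using q(3)[of "to_factors b"] c(2)[OF b(1), of a] by simp
        then show ?thesis
          using to_factors_inj b(1) U by (meson inj_on_image_mem_iff)
      qed
      then show "\<exists>q\<in>P. \<exists>r>0. \<forall>b\<in>carrier A. q (b \<ominus> a) < r \<longrightarrow> b \<in> U"
        using q(1,2) c(1) by (intro bexI[of _ q] exI[of _ "r / c"]) auto
    qed (rule U)
  next
    assume op: "openin T U"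
    show "openin F.L_topology (to_factors ` U)"
      unfolding F.openin_L_topology
    proof (intro conjI ballI)
      show "to_factors ` U \<subseteq> carrier ?L" using U surj by blast
      fix X assume "X \<in> to_factors ` U"
      then obtain a where a: "a \<in> U" "X = to_factors a" by blast
      from op[unfolded openin_T, THEN conjunct2, rule_format, OF a(1)]
      obtain q r where q: "q \<in> P" "0 < r" "\<And>b. b \<in> carrier A \<Longrightarrow> q (b \<ominus> a) < r \<Longrightarrow> b \<in> U"
        by blast
      obtain c where c: "0 < c" "\<And>a a'. a \<in> carrier A \<Longrightarrow> a' \<in> carrier A \<Longrightarrow>
          q (a \<ominus> a') \<le> c * factor_norm q (to_factors a q \<ominus>\<^bsub>factor q\<^esub> to_factors a' q)"
        by (rule to_factors_norm[OF q(1)]) (rule that)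
      have "Y \<in> to_factors ` U" if Y: "Y \<in> carrier ?L" "factor_norm q (Y q \<ominus>\<^bsub>factor q\<^esub> X q) < r / c" for Y
      proof -
        obtain b where b: "b \<in> carrier A" "Y = to_factors b" using Y(1) surj by blast
        have "c * factor_norm q (Y q \<ominus>\<^bsub>factor q\<^esub> X q) < r" using Y(2) c(1) by (simp add: field_simps)
        then have "q (b \<ominus> a) < r"
          using c(2)[OF b(1), of a] a U b(2) by auto
        then show ?thesis using q(3)[OF b(1)] b(2) by blast
      qed
      then show "\<exists>q\<in>P. \<exists>r>0. \<forall>y\<in>carrier ?L. factor_norm q (y q \<ominus>\<^bsub>factor q\<^esub> X q) < r \<longrightarrow> y \<in> to_factors ` U"
        using q(1,2) c(1) by (intro bexI[of _ q] exI[of _ "r / c"]) auto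
    qed
  qed
  have "homeomorphic_map T F.L_topology to_factors"
  proof (rule bijective_open_imp_homeomorphic_map)
    show "to_factors ` topspace T = topspace F.L_topology"
      by (simp add: top_T F.topspace_L_topology surj)
    show "inj_on to_factors (topspace T)"
      using to_factors_inj by (simp add: top_T)
    show "open_map T F.L_topology to_factors"
      unfolding open_map_def using open_iff openin_subset[of T] by (simp add: top_T)
    show "continuous_map T F.L_topology to_factors"
      unfolding continuous_map_def
    proof (intro conjI allI impI)
      fix V assume V: "openin F.L_topology V"
      let ?U = "{x \<in> topspace T. to_factors x \<in> V}"
      have "V \<subseteq> carrier ?L" using openin_subset[OF V] F.topspace_L_topology by simp
      then have "to_factors ` ?U = V" using surj by (auto simp: top_T)
      then show "openin T ?U" using open_iff[of ?U] V by (auto simp: top_T)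
    qed (use surj in \<open>auto simp: top_T F.topspace_L_topology\<close>)
  qed
  then have "top_star_isomorphic A T ?L F.L_topology"
    using to_factors_hom by (auto simp: top_star_isomorphic_def)
  then show ?thesis
    unfolding real_locally_Cstar_algebra_def
    using A_top factor_Cstar(1) F.projective_family_axioms by blast
qed

end

section \<open>Seminorms of a complete lmc *-algebra\<close>

text \<open>
  The algebra \<open>A\<close> identified by \<open>h\<close> with a limit of Banach *-algebras. The coordinates give continuous
  seminorms on \<open>A\<close> through which the topology and the completeness of \<open>A\<close> are expressed.
\<close>

locale limit_presentation = banach_projective_family I below E nrm g
  for I :: "'i set" and below and E :: "'i \<Rightarrow> (real, 'e) star_alg" and nrm g +
  fixes A :: "(real, 'a) star_alg" (structure) and T :: "'a topology" and h :: "'a \<Rightarrow> 'i \<Rightarrow> 'e"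
  assumes A_top: "real_topological_star_algebra A T"
    and h_hom: "h \<in> star_hom A L"
    and h_homeo: "homeomorphic_map T L_topology h"
begin

definition coord_seminorm :: "'i \<Rightarrow> 'a \<Rightarrow> real"
  where "coord_seminorm i a = nrm i (h a i)"

lemma A_alg: "real_star_algebra A"
  using A_top by (simp add: real_topological_star_algebra_def)

sublocale A: star_algebra "\<lambda>t. t" A by (rule A_alg)

lemma topspace_T: "topspace T = carrier A"
  using A_top by (simp add: real_topological_star_algebra_def)

lemma factor_star_algebra: "i \<in> I \<Longrightarrow> real_star_algebra (E i)"
  using algebras by (simp add: real_topological_star_algebra_def)

lemma coord_hom: "i \<in> I \<Longrightarrow> (\<lambda>a. h a i) \<in> star_hom A (E i)"
  using star_homD[OF h_hom] by (auto simp: star_hom_def ring_hom_def projective_limit_def)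

lemma coord_minus:
  "i \<in> I \<Longrightarrow> a \<in> carrier A \<Longrightarrow> b \<in> carrier A \<Longrightarrow> h (a \<ominus> b) i = h a i \<ominus>\<^bsub>E i\<^esub> h b i"
  using star_hom_minus[OF A_alg factor_star_algebra coord_hom] by blast

lemma coord_closed: "i \<in> I \<Longrightarrow> a \<in> carrier A \<Longrightarrow> h a i \<in> carrier (E i)"
  using star_homD(1)[OF coord_hom] by blast

lemma coord_compatible:
  "\<lbrakk>i \<in> I; j \<in> I; below i j; a \<in> carrier A\<rbrakk> \<Longrightarrow> h a i = g i j (h a j)"
  using star_homD(1)[OF h_hom] by (auto simp: projective_limit_def)

lemma h_bij: "h ` carrier A = carrier L" "inj_on h (carrier A)"
  using homeomorphic_imp_surjective_map[OF h_homeo] homeomorphic_imp_injective_map[OF h_homeo]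
  by (simp_all add: topspace_T topspace_L_topology)

lemma compatible_family_lifts:
  assumes "\<And>i. i \<in> I \<Longrightarrow> x i \<in> carrier (E i)"
    and "\<And>i j. i \<in> I \<Longrightarrow> j \<in> I \<Longrightarrow> below i j \<Longrightarrow> x i = g i j (x j)"
  obtains a where "a \<in> carrier A" "\<And>i. i \<in> I \<Longrightarrow> h a i = x i"
proof -
  have "(\<lambda>i\<in>I. x i) \<in> carrier L"
    using assms by (auto simp: projective_limit_def)
  then obtain a where "a \<in> carrier A" "h a = (\<lambda>i\<in>I. x i)"
    using h_bij(1) by (metis imageE)
  then show thesis using that[of a] by simp
qed

lemma coord_seminorm_star_seminorm:
  assumes i: "i \<in> I"
  shows "star_seminorm (\<lambda>t. t) A (coord_seminorm i)"
    and "a \<in> carrier A \<Longrightarrow> coord_seminorm i (k \<odot> a) = \<bar>k\<bar> * coord_seminorm i a"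
    and "\<exists>c\<ge>0. \<forall>a\<in>carrier A. coord_seminorm i (star A a) \<le> c * coord_seminorm i a"
proof -
  interpret Ei: banach_star_algebra "\<lambda>t. t" "E i" "nrm i" by (rule banach[OF i])
  note hom = star_homD[OF coord_hom[OF i]]
  note cl = coord_closed[OF i]
  obtain c where c: "\<And>x. x \<in> carrier (E i) \<Longrightarrow> nrm i (star (E i) x) \<le> c * nrm i x"
    using Ei.star_bounded by blast
  have "coord_seminorm i (star A a) \<le> \<bar>c\<bar> * coord_seminorm i a" if "a \<in> carrier A" for a
    using c[OF cl[OF that]] hom(5)[OF that] Ei.nrm_nonneg[OF cl[OF that]]
      mult_right_mono[OF abs_ge_self[of c], of "nrm i (h a i)"] by (simp add: coord_seminorm_def)
  then show star: "\<exists>c\<ge>0. \<forall>a\<in>carrier A. coord_seminorm i (star A a) \<le> c * coord_seminorm i a"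
    by (intro exI[of _ "\<bar>c\<bar>"]) simp
  show "coord_seminorm i (k \<odot> a) = \<bar>k\<bar> * coord_seminorm i a" if "a \<in> carrier A"
    using hom(4)[OF that] Ei.nrm_smult[OF cl[OF that]] by (simp add: coord_seminorm_def)
  interpret p: alg_seminorm "\<lambda>t. t" A "coord_seminorm i"
  proof unfold_locales
    show "coord_seminorm i \<zero> = 0"
      using star_hom_zero[OF A_alg factor_star_algebra coord_hom] i Ei.p_zero by (simp add: coord_seminorm_def)
  next
    fix a b assume a: "a \<in> carrier A"
    show "0 \<le> coord_seminorm i a" using Ei.nrm_nonneg[OF cl[OF a]] by (simp add: coord_seminorm_def)
    show "coord_seminorm i (\<ominus> a) = coord_seminorm i a"
      using star_hom_neg[OF A_alg factor_star_algebra[OF i] coord_hom[OF i] a] Ei.p_neg[OF cl[OF a]] by (simp add: coord_seminorm_def)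
    assume b: "b \<in> carrier A"
    show "coord_seminorm i (a \<oplus> b) \<le> coord_seminorm i a + coord_seminorm i b"
      using hom(2)[OF a b] Ei.nrm_triangle[OF cl[OF a] cl[OF b]] by (simp add: coord_seminorm_def)
    show "coord_seminorm i (a \<otimes> b) \<le> coord_seminorm i a * coord_seminorm i b"
      using hom(3)[OF a b] Ei.nrm_mult[OF cl[OF a] cl[OF b]] by (simp add: coord_seminorm_def)
  qed
  show "star_seminorm (\<lambda>t. t) A (coord_seminorm i)"
  proof unfold_locales
    fix a assume a: "a \<in> carrier A" "coord_seminorm i a = 0"
    then have "coord_seminorm i (star A a) \<le> 0" using star by force
    then show "coord_seminorm i (star A a) = 0"
      using p.p_nonneg[OF A.star_closed[OF a(1)]] by simp
  qed
qed

lemma coord_seminorm_minus: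
  "i \<in> I \<Longrightarrow> a \<in> carrier A \<Longrightarrow> b \<in> carrier A \<Longrightarrow>
    coord_seminorm i (a \<ominus> b) = nrm i (h a i \<ominus>\<^bsub>E i\<^esub> h b i)"
  by (simp add: coord_seminorm_def coord_minus)

lemma coord_seminorm_mono:
  assumes ij: "i \<in> I" "j \<in> I" "below i j"
  obtains c where "0 \<le> c" "\<And>a. a \<in> carrier A \<Longrightarrow> coord_seminorm i a \<le> c * coord_seminorm j a"
proof -
  obtain c where c: "0 \<le> c" "\<And>x. x \<in> carrier (E j) \<Longrightarrow> nrm i (g i j x) \<le> c * nrm j x"
    by (rule continuous_star_hom_bounded[OF banach[OF ij(2)] banach[OF ij(1)] hom[OF ij] cont[OF ij]]) (rule that)
  have "coord_seminorm i a \<le> c * coord_seminorm j a" if "a \<in> carrier A" for a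
    using c(2)[OF coord_closed[OF ij(2) that]] coord_compatible[OF ij that] by (simp add: coord_seminorm_def)
  with c(1) show thesis by (rule that)
qed

lemma openin_T:
  "openin T U \<longleftrightarrow> U \<subseteq> carrier A \<and>
    (\<forall>a\<in>U. \<exists>i\<in>I. \<exists>r>0. \<forall>b\<in>carrier A. coord_seminorm i (b \<ominus> a) < r \<longrightarrow> b \<in> U)"
proof (cases "U \<subseteq> carrier A")
  case False
  then show ?thesis using openin_subset[of T U] by (auto simp: topspace_T)
next
  case True
  have "openin T U \<longleftrightarrow> openin L_topology (h ` U)"
    using homeomorphic_map_openness_eq[OF h_homeo, of U] True by (simp add: topspace_T)
  also have "\<dots> \<longleftrightarrow> (\<forall>a\<in>U. \<exists>i\<in>I. \<exists>r>0. \<forall>b\<in>carrier A. coord_seminorm i (b \<ominus> a) < r \<longrightarrow> b \<in> U)"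
  proof -
    have "(\<forall>y\<in>carrier L. nrm i (y i \<ominus>\<^bsub>E i\<^esub> h a i) < r \<longrightarrow> y \<in> h ` U) \<longleftrightarrow>
        (\<forall>b\<in>carrier A. coord_seminorm i (b \<ominus> a) < r \<longrightarrow> b \<in> U)" if i: "i \<in> I" and a: "a \<in> U" for i a r
    proof -
      have "h b \<in> h ` U \<longleftrightarrow> b \<in> U" if "b \<in> carrier A" for b
        using inj_on_image_mem_iff[OF h_bij(2) that True] .
      moreover have "coord_seminorm i (b \<ominus> a) = nrm i (h b i \<ominus>\<^bsub>E i\<^esub> h a i)" if "b \<in> carrier A" for b
        using coord_seminorm_minus[OF i that] a True by blast
      ultimately show ?thesis
        unfolding h_bij(1)[symmetric] by simp
    qed
    then have "(\<exists>i\<in>I. \<exists>r>0. \<forall>y\<in>carrier L. nrm i (y i \<ominus>\<^bsub>E i\<^esub> h a i) < r \<longrightarrow> y \<in> h ` U) \<longleftrightarrow>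
        (\<exists>i\<in>I. \<exists>r>0. \<forall>b\<in>carrier A. coord_seminorm i (b \<ominus> a) < r \<longrightarrow> b \<in> U)" if "a \<in> U" for a
      using that by simp
    moreover have "h ` U \<subseteq> carrier L" using True h_bij(1) by blast
    ultimately show ?thesis
      unfolding openin_L_topology by simp
  qed
  finally show ?thesis using True by simp
qed

lemma openin_T_ball:
  assumes i: "i \<in> I" and a: "a \<in> carrier A"
  shows "openin T {b \<in> carrier A. coord_seminorm i (b \<ominus> a) < r}"
proof -
  interpret p: star_seminorm "\<lambda>t. t" A "coord_seminorm i" by (rule coord_seminorm_star_seminorm(1)[OF i])
  have "\<exists>r'>0. \<forall>c\<in>carrier A. coord_seminorm i (c \<ominus> b) < r' \<longrightarrow> coord_seminorm i (c \<ominus> a) < r"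
    if b: "b \<in> carrier A" "coord_seminorm i (b \<ominus> a) < r" for b
  proof (intro exI[of _ "r - coord_seminorm i (b \<ominus> a)"] conjI ballI impI)
    fix c assume "c \<in> carrier A" "coord_seminorm i (c \<ominus> b) < r - coord_seminorm i (b \<ominus> a)"
    then show "coord_seminorm i (c \<ominus> a) < r"
      using p.p_dist_triangle[of c b a] a b by simp
  qed (use b in simp)
  then show ?thesis
    unfolding openin_T using i by (intro conjI ballI bexI[of _ i]) auto
qed

lemma coord_seminorm_separating:
  assumes a: "a \<in> carrier A" and null: "\<And>i. i \<in> I \<Longrightarrow> coord_seminorm i a = 0"
  shows "a = \<zero>"
proof -
  have "h a i = h \<zero> i" if i: "i \<in> I" for i
  proof -
    interpret Ei: banach_star_algebra "\<lambda>t. t" "E i" "nrm i" by (rule banach[OF i])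
    show ?thesis
      using null[OF i] Ei.p_definite[OF coord_closed[OF i a]] star_hom_zero[OF A_alg factor_star_algebra[OF i] coord_hom[OF i]]
      by (simp add: coord_seminorm_def)
  qed
  moreover have "h a \<in> extensional I" "h \<zero> \<in> extensional I"
    using star_homD(1)[OF h_hom] a by (auto simp: projective_limit_def PiE_def)
  ultimately have "h a = h \<zero>" by (intro extensionalityI) auto
  then show ?thesis using h_bij(2) a by (simp add: inj_on_def)
qed

text \<open>
  On \<open>B\<close> each coordinate seminorm is bounded by a multiple of the C*-norm, so its quotient is a
  C*-algebra. Every element \<open>a\<close> of \<open>A\<close> agrees with an element of \<open>B\<close> in the \<open>i\<close>-th coordinate, because the
  distance of \<open>a\<close> to \<open>B\<close> for the \<open>i\<close>-th seminorm is attained and, by density, zero.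
\<close>

theorem dense_imp_locally_Cstar:
  assumes dense: "dense_Cstar_subalgebra A T B n"
  shows "real_locally_Cstar_algebra TYPE('a \<Rightarrow> real) TYPE('a set) A T"
proof -
  let ?R = "A\<lparr>carrier := B\<rparr>" and ?P = "coord_seminorm ` I"
  have B: "star_subalgebra B A" and Cstar: "real_Cstar_algebra ?R n"
    and cont: "continuous_map (norm_topology ?R n) T (\<lambda>x. x)"
    and closure: "T closure_of B = topspace T"
    using dense by (auto simp: dense_Cstar_subalgebra_def)
  note sub = subalgebra_star_algebra[OF A_alg B] and BD = star_subalgebraD[OF B]
  obtain N where pair: "real_Cstar_pair ?R N" and N: "\<And>x. x \<in> B \<Longrightarrow> N (x, \<zero>) = n x"
    using real_Cstar_pair_exists[OF Cstar] by auto
  have quot: "\<exists>D. 0 \<le> D \<and> (\<exists>K. real_Cstar_quotient ?R N (coord_seminorm i) K D)" if i: "i \<in> I" for i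
  proof -
    interpret p: star_seminorm "\<lambda>t. t" A "coord_seminorm i" by (rule coord_seminorm_star_seminorm(1)[OF i])
    interpret R: real_Cstar_pair ?R N by (rule pair)
    obtain K where K: "0 \<le> K" "\<And>b. b \<in> B \<Longrightarrow> coord_seminorm i b \<le> K * n b"
      by (rule seminorm_bounded_on_subalgebra[OF A_alg B real_Cstar_imp_banach[OF Cstar] cont
            p.alg_seminorm_axioms coord_seminorm_star_seminorm(2)[OF i] openin_T_ball[OF i A.zero_closed]]) (assumption, rule that)
    obtain D where D: "0 \<le> D" "\<And>a. a \<in> carrier A \<Longrightarrow> coord_seminorm i (star A a) \<le> D * coord_seminorm i a"
      using coord_seminorm_star_seminorm(3)[OF i] by blast
    have "real_Cstar_quotient ?R N (coord_seminorm i) K D"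
      by unfold_locales
        (use K D BD N sub(2) p.p_zero p.p_nonneg p.p_neg p.p_triangle p.p_mult
          coord_seminorm_star_seminorm(2)[OF i] in simp_all)
    with D(1) show ?thesis by blast
  qed
  have "dense_Cstar_presentation A T B N ?P"
  proof (rule dense_Cstar_presentation.intro)
    show "real_topological_star_algebra A T" by (rule A_top)
    show "star_subalgebra B A" by (rule B)
    show "?P \<noteq> {}" using directed by (simp add: upward_directed_def)
    show "openin T U \<longleftrightarrow> U \<subseteq> carrier A \<and>
      (\<forall>a\<in>U. \<exists>q\<in>?P. \<exists>r>0. \<forall>b\<in>carrier A. q (b \<ominus> a) < r \<longrightarrow> b \<in> U)" for U
      unfolding openin_T by simp
    show "a = \<zero>" if "a \<in> carrier A" "\<And>q. q \<in> ?P \<Longrightarrow> q a = 0" for a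
      using coord_seminorm_separating that by blast
  next
    fix q assume "q \<in> ?P"
    then obtain i where i: "i \<in> I" "q = coord_seminorm i" by blast
    show "star_seminorm (\<lambda>t. t) A q" using coord_seminorm_star_seminorm(1)[OF i(1)] i(2) by simp
    show "\<exists>K D. real_Cstar_quotient ?R N q K D" using quot[OF i(1)] i(2) by blast
    fix a assume a: "a \<in> carrier A"
    interpret p: star_seminorm "\<lambda>t. t" A "coord_seminorm i" by (rule coord_seminorm_star_seminorm(1)[OF i(1)])
    obtain K D where "real_Cstar_quotient ?R N (coord_seminorm i) K D" using quot[OF i(1)] by blast
    then interpret R: real_Cstar_quotient ?R N "coord_seminorm i" K D .
    have "\<exists>x\<in>carrier ?R. coord_seminorm i (a \<ominus> x) = 0"
    proof (rule R.distance_attained)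
      fix x assume "x \<in> carrier ?R"
      then have x: "x \<in> B" "x \<in> carrier A" using BD(1) by auto
      show "0 \<le> coord_seminorm i (a \<ominus> x)" using p.p_nonneg a x by simp
      fix y assume "y \<in> carrier ?R"
      then have y: "y \<in> B" "y \<in> carrier A" using BD(1) by auto
      have xy: "x \<ominus>\<^bsub>?R\<^esub> y = x \<ominus> y" using sub(3)[OF x(1) y(1)] .
      show "coord_seminorm i (a \<ominus> x) \<le> coord_seminorm i (a \<ominus> y) + coord_seminorm i (x \<ominus>\<^bsub>?R\<^esub> y)"
        using p.p_dist_triangle[OF a y(2) x(2)] p.p_sym[OF x(2) y(2)] by (simp add: xy)
      show "coord_seminorm i (x \<ominus>\<^bsub>?R\<^esub> y) \<le> coord_seminorm i (a \<ominus> x) + coord_seminorm i (a \<ominus> y)"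
        using p.p_dist_triangle[OF x(2) a y(2)] p.p_sym[OF x(2) a] by (simp add: xy)
    next
      fix e :: real assume e: "0 < e"
      let ?V = "{b \<in> carrier A. coord_seminorm i (b \<ominus> a) < e}"
      have a_cl: "a \<in> T closure_of B" using closure a by (simp add: topspace_T)
      have a_V: "a \<in> ?V" using a e p.p_minus_self[OF a] by simp
      obtain b where "b \<in> B" "b \<in> ?V"
        by (rule closure_of_meets_open[OF a_cl openin_T_ball[OF i(1) a] a_V]) (rule that)
      then show "\<exists>x\<in>carrier ?R. coord_seminorm i (a \<ominus> x) < e"
        using p.p_sym[OF a, of b] by (intro bexI[of _ b]) simp_all
    qed
    then show "\<exists>b\<in>B. q (a \<ominus> b) = 0" using i(2) by simp
  next
    fix q q' assume "q \<in> ?P" "q' \<in> ?P"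
    then obtain i j where ij: "i \<in> I" "q = coord_seminorm i" "j \<in> I" "q' = coord_seminorm j" by blast
    obtain k where k: "k \<in> I" "below i k" "below j k"
      using directed ij unfolding upward_directed_def by blast
    interpret p: star_seminorm "\<lambda>t. t" A "coord_seminorm k" by (rule coord_seminorm_star_seminorm(1)[OF k(1)])
    obtain c where c: "0 \<le> c" "\<And>a. a \<in> carrier A \<Longrightarrow> coord_seminorm i a \<le> c * coord_seminorm k a"
      by (rule coord_seminorm_mono[OF ij(1) k(1,2)]) (rule that)
    obtain d where d: "0 \<le> d" "\<And>a. a \<in> carrier A \<Longrightarrow> coord_seminorm j a \<le> d * coord_seminorm k a"
      by (rule coord_seminorm_mono[OF ij(3) k(1,3)]) (rule that)
    have "q a \<le> (c + d) * coord_seminorm k a \<and> q' a \<le> (c + d) * coord_seminorm k a" if a: "a \<in> carrier A" for a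
      using c(2)[OF a] d(2)[OF a] mult_nonneg_nonneg[OF c(1) p.p_nonneg[OF a]]
        mult_nonneg_nonneg[OF d(1) p.p_nonneg[OF a]] ij by (simp add: distrib_right)
    then show "\<exists>r\<in>?P. \<exists>c\<ge>0. \<forall>a\<in>carrier A. q a \<le> c * r a \<and> q' a \<le> c * r a"
      using c(1) d(1) k(1) by (intro bexI[of _ "coord_seminorm k"] exI[of _ "c + d"]) auto
  next
    fix x
    assume x: "\<And>q. q \<in> ?P \<Longrightarrow> x q \<in> carrier A"
      and compat: "\<And>q q' c. q \<in> ?P \<Longrightarrow> q' \<in> ?P \<Longrightarrow> 0 \<le> c \<Longrightarrow> (\<And>a. a \<in> carrier A \<Longrightarrow> q a \<le> c * q' a) \<Longrightarrow>
        q (x q \<ominus> x q') = 0"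
    let ?y = "\<lambda>i. x (coord_seminorm i)"
    have y: "?y i \<in> carrier A" if "i \<in> I" for i using x that by blast
    obtain a where a: "a \<in> carrier A" "\<And>i. i \<in> I \<Longrightarrow> h a i = h (?y i) i"
    proof (rule compatible_family_lifts[of "\<lambda>i. h (?y i) i"])
      show "h (?y i) i \<in> carrier (E i)" if "i \<in> I" for i using coord_closed that y by blast
      fix i j assume ij: "i \<in> I" "j \<in> I" "below i j"
      interpret Ei: banach_star_algebra "\<lambda>t. t" "E i" "nrm i" by (rule banach[OF ij(1)])
      obtain c where c: "0 \<le> c" "\<And>a. a \<in> carrier A \<Longrightarrow> coord_seminorm i a \<le> c * coord_seminorm j a"
        by (rule coord_seminorm_mono[OF ij]) (rule that)
      have "coord_seminorm i (?y i \<ominus> ?y j) = 0"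
        using compat[OF imageI[OF ij(1)] imageI[OF ij(2)] c] by blast
      then have "h (?y i) i \<ominus>\<^bsub>E i\<^esub> h (?y j) i = \<zero>\<^bsub>E i\<^esub>"
        using Ei.p_definite[of "h (?y i) i \<ominus>\<^bsub>E i\<^esub> h (?y j) i"] coord_seminorm_minus[OF ij(1) y[OF ij(1)] y[OF ij(2)]]
          coord_closed[OF ij(1)] y ij by simp
      then have "h (?y i) i = h (?y j) i"
        using Ei.minus_eq_iff coord_closed[OF ij(1)] y ij by simp
      then show "h (?y i) i = g i j (h (?y j) j)"
        using coord_compatible[OF ij y[OF ij(2)]] by simp
    qed blast
    have "coord_seminorm i (a \<ominus> ?y i) = 0" if i: "i \<in> I" for i
    proof -
      interpret Ei: banach_star_algebra "\<lambda>t. t" "E i" "nrm i" by (rule banach[OF i])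
      show ?thesis
        using coord_seminorm_minus[OF i a(1) y[OF i]] a(2)[OF i] Ei.p_minus_self[OF coord_closed[OF i y[OF i]]] by simp
    qed
    with a(1) show "\<exists>a\<in>carrier A. \<forall>q\<in>?P. q (a \<ominus> x q) = 0" by blast
  qed
  then show ?thesis by (rule dense_Cstar_presentation.locally_Cstar)
qed

end

section \<open>The bounded elements of a limit of C*-algebras\<close>

text \<open>
  Write \<open>s = x*x\<close> and \<open>w = t s\<close>. The first bound depends on \<open>t\<close> only:
  \<open>t \<parallel>x k\<parallel>\<^sup>2 = t \<parallel>k s k\<parallel> = \<parallel>k w k\<parallel> \<le> \<parallel>w k\<parallel>\<close> and \<open>\<parallel>w k\<parallel>\<^sup>2 = \<parallel>k w\<^sup>2 k\<parallel> = \<parallel>k (1 - k)\<parallel> \<le> 2\<close>. The second one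
  follows from \<open>x - x k = x w\<^sup>2 k\<close>.
\<close>

lemma (in real_Cstar_pair) bounded_approximant:
  assumes x: "x \<in> carrier R" and "0 < t" and w: "w = t \<odot> (star R x \<otimes> x)"
    and k: "k \<in> carrier R" "k \<otimes> (\<one> \<oplus> w \<otimes> w) = \<one>" "(\<one> \<oplus> w \<otimes> w) \<otimes> k = \<one>"
  shows "(N (x \<otimes> k, \<zero>))\<^sup>2 \<le> 2 / t" and "N (x \<ominus> x \<otimes> k, \<zero>) \<le> t\<^sup>2 * N (x, \<zero>) ^ 5"
proof -
  let ?n = "\<lambda>x. N (x, \<zero>)"
  interpret n: banach_star_algebra "\<lambda>t. t" R ?n
    using real_Cstar_algebra by (rule real_Cstar_imp_banach)
  interpret n: regular_seminorm "\<lambda>t. t" R ?n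
    by unfold_locales (use real_Cstar_algebra in \<open>simp add: real_Cstar_algebra_def regular_on_def\<close>)
  define s where "s = star R x \<otimes> x"
  have s: "s \<in> carrier R" "star R s = s"
    using x by (simp_all add: s_def star_mult star_star star_closed)
  have w': "w \<in> carrier R" "star R w = w"
    using s by (simp_all add: w s_def[symmetric] alg_closed star_smult)
  have g: "\<one> \<oplus> w \<otimes> w \<in> carrier R" using w' by simp
  have star_k: "star R k = k"
    using star_inverse[OF g k(1) _ k(2,3)] w' by (simp add: star_add star_one star_mult)
  have k_le: "?n k \<le> 1"
  proof -
    obtain k' where k': "k' \<in> carrier R" "k' \<otimes> (\<one> \<oplus> w \<otimes> w) = \<one>" "(\<one> \<oplus> w \<otimes> w) \<otimes> k' = \<one>" "?n k' \<le> 1"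
      by (rule inverse_one_plus_square[OF w']) (rule that)
    then show ?thesis using inv_unique[OF k(2) k'(3) g k(1) k'(1)] by simp
  qed
  have k0: "0 \<le> ?n k" using n.nrm_nonneg[OF k(1)] .
  have one_k: "w \<otimes> w \<otimes> k = \<one> \<ominus> k"
  proof -
    have "w \<otimes> w \<otimes> k = (\<one> \<oplus> w \<otimes> w) \<otimes> k \<ominus> k"
      using k(1) w'(1) by algebra
    then show ?thesis using k by simp
  qed
  have "(?n (w \<otimes> k))\<^sup>2 = ?n (k \<otimes> (w \<otimes> w \<otimes> k))"
    using n.p_regular[of "w \<otimes> k"] w' k(1) star_k by (simp add: star_mult m_assoc)
  also have "\<dots> \<le> ?n k * ?n (\<one> \<ominus> k)"
    unfolding one_k using k(1) by (intro n.nrm_mult) simp_all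
  also have "\<dots> \<le> 1 * 2"
    using n.p_diff_le[of \<one> k] n.p_one_le k(1) k_le k0 n.nrm_nonneg[of "\<one> \<ominus> k"] by (intro mult_mono) auto
  finally have "(?n (w \<otimes> k))\<^sup>2 \<le> 2\<^sup>2" by simp
  then have wk: "?n (w \<otimes> k) \<le> 2"
    by (rule power2_le_imp_le) simp
  have "(?n (x \<otimes> k))\<^sup>2 = ?n (k \<otimes> s \<otimes> k)"
    using n.p_regular[of "x \<otimes> k"] x k(1) star_k by (simp add: star_mult star_closed m_assoc s_def)
  also have "t * \<dots> = ?n (k \<otimes> (w \<otimes> k))"
    using n.nrm_smult[of "k \<otimes> s \<otimes> k" t] k(1) s(1) \<open>0 < t\<close>
    by (simp add: w s_def[symmetric] smult_mult_left smult_mult_right m_assoc)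
  also have "\<dots> \<le> ?n k * ?n (w \<otimes> k)"
    using k(1) w' by (intro n.nrm_mult) simp_all
  also have "\<dots> \<le> 1 * 2"
    using k_le wk k(1) w' n.nrm_nonneg[of "w \<otimes> k"] by (intro mult_mono) simp_all
  finally show "(?n (x \<otimes> k))\<^sup>2 \<le> 2 / t"
    using \<open>0 < t\<close> by (simp add: field_simps)
  have x0: "0 \<le> ?n x" using n.nrm_nonneg[OF x] .
  have n_w: "?n w = t * (?n x)\<^sup>2"
    using n.nrm_smult[OF s(1), of t] n.p_regular[OF x] \<open>0 < t\<close> by (simp add: w s_def)
  have "x \<ominus> x \<otimes> k = x \<otimes> (w \<otimes> w \<otimes> k)"
    unfolding one_k using x k(1) by (simp add: mult_diff_right)
  then have "?n (x \<ominus> x \<otimes> k) \<le> ?n x * ?n (w \<otimes> w \<otimes> k)"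
    using x w' k(1) n.nrm_mult[of x "w \<otimes> w \<otimes> k"] by simp
  also have "\<dots> \<le> ?n x * (?n w * ?n w * 1)"
  proof (intro mult_left_mono x0)
    have "?n (w \<otimes> w \<otimes> k) \<le> ?n (w \<otimes> w) * ?n k"
      using w' k(1) by (intro n.nrm_mult) simp_all
    also have "\<dots> \<le> (?n w * ?n w) * 1"
      using w' k_le k0 n.nrm_nonneg by (intro mult_mono n.nrm_mult) auto
    finally show "?n (w \<otimes> w \<otimes> k) \<le> ?n w * ?n w * 1" .
  qed
  finally show "?n (x \<ominus> x \<otimes> k) \<le> t\<^sup>2 * ?n x ^ 5"
    unfolding n_w by (simp add: power2_eq_square numeral_eq_Suc mult_ac)
qed

locale Cstar_limit_presentation = limit_presentation I below E nrm g A T h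
  for I :: "'i set" and below and E :: "'i \<Rightarrow> (real, 'e) star_alg" and nrm g
    and A :: "(real, 'a) star_alg" (structure) and T h +
  assumes Cstar: "i \<in> I \<Longrightarrow> real_Cstar_algebra (E i) (nrm i)"
begin

text \<open>
  These are the elements bounded for the given coordinate seminorms; the bounded part is defined through an
  arbitrary defining family of regular seminorms.
\<close>

definition bounded_elements :: "'a set"
  where "bounded_elements = {a \<in> carrier A. \<exists>c. \<forall>i\<in>I. coord_seminorm i a \<le> c}"

abbreviation bounded_algebra :: "(real, 'a) star_alg"
  where "bounded_algebra \<equiv> A\<lparr>carrier := bounded_elements\<rparr>"

definition pair_norm :: "'i \<Rightarrow> 'e \<times> 'e \<Rightarrow> real"
  where "pair_norm i = (SOME N. real_Cstar_pair (E i) N \<and> (\<forall>x\<in>carrier (E i). N (x, \<zero>\<^bsub>E i\<^esub>) = nrm i x))"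

lemma pair_norm:
  assumes "i \<in> I"
  shows "real_Cstar_pair (E i) (pair_norm i)"
    and "x \<in> carrier (E i) \<Longrightarrow> pair_norm i (x, \<zero>\<^bsub>E i\<^esub>) = nrm i x"
proof -
  have "\<exists>N. real_Cstar_pair (E i) N \<and> (\<forall>x\<in>carrier (E i). N (x, \<zero>\<^bsub>E i\<^esub>) = nrm i x)"
    using real_Cstar_pair_exists[OF Cstar[OF assms]] by metis
  from someI_ex[OF this]
  show "real_Cstar_pair (E i) (pair_norm i)"
    "x \<in> carrier (E i) \<Longrightarrow> pair_norm i (x, \<zero>\<^bsub>E i\<^esub>) = nrm i x"
    unfolding pair_norm_def[symmetric] by auto
qed

definition sup_norm :: "'a \<times> 'a \<Rightarrow> real"
  where "sup_norm z = (SUP i\<in>I. pair_norm i (map_prod (\<lambda>a. h a i) (\<lambda>a. h a i) z))"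

lemma I_nonempty: "I \<noteq> {}"
  using directed by (simp add: upward_directed_def)

lemma coord_seminorm_nonneg: "i \<in> I \<Longrightarrow> a \<in> carrier A \<Longrightarrow> 0 \<le> coord_seminorm i a"
proof -
  assume i: "i \<in> I" and a: "a \<in> carrier A"
  interpret p: star_seminorm "\<lambda>t. t" A "coord_seminorm i" by (rule coord_seminorm_star_seminorm(1)[OF i])
  show ?thesis by (rule p.p_nonneg[OF a])
qed

lemma bounded_elementsE:
  assumes "a \<in> bounded_elements"
  obtains c where "a \<in> carrier A" "0 \<le> c" "\<And>i. i \<in> I \<Longrightarrow> coord_seminorm i a \<le> c"
proof -
  obtain c where c: "a \<in> carrier A" "\<And>i. i \<in> I \<Longrightarrow> coord_seminorm i a \<le> c"
    using assms by (auto simp: bounded_elements_def)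
  moreover have "0 \<le> c"
    using I_nonempty c coord_seminorm_nonneg[OF _ c(1)] by (meson ex_in_conv order.trans)
  ultimately show thesis using that by blast
qed

lemma bounded_elements_subalgebra: "star_subalgebra bounded_elements A"
  unfolding star_subalgebra_def
proof (intro conjI ballI allI)
  show "bounded_elements \<subseteq> carrier A" by (auto simp: bounded_elements_def)
  have "coord_seminorm i \<one> \<le> 1" if i: "i \<in> I" for i
  proof -
    interpret Ei: banach_star_algebra "\<lambda>t. t" "E i" "nrm i" by (rule banach[OF i])
    interpret Ei: regular_seminorm "\<lambda>t. t" "E i" "nrm i"
      by unfold_locales (use Cstar[OF i] in \<open>simp add: real_Cstar_algebra_def regular_on_def\<close>)
    show ?thesis using Ei.p_one_le star_homD(6)[OF coord_hom[OF i]] by (simp add: coord_seminorm_def)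
  qed
  then show "\<one> \<in> bounded_elements" by (auto simp: bounded_elements_def)
  fix a assume "a \<in> bounded_elements"
  then obtain c where a: "a \<in> carrier A" "0 \<le> c" "\<And>i. i \<in> I \<Longrightarrow> coord_seminorm i a \<le> c"
    by (rule bounded_elementsE) (rule that)
  have "coord_seminorm i (k \<odot> a) \<le> \<bar>k\<bar> * c" if i: "i \<in> I" for i k
    using coord_seminorm_star_seminorm(2)[OF i a(1)] a(3)[OF i] by (simp add: mult_left_mono)
  then show "k \<odot> a \<in> bounded_elements" for k
    using a(1) A.smult_closed by (auto simp: bounded_elements_def)
  have "coord_seminorm i (star A a) \<le> c" if i: "i \<in> I" for i
  proof -
    interpret Ei: banach_star_algebra "\<lambda>t. t" "E i" "nrm i" by (rule banach[OF i])
    interpret Ei: regular_seminorm "\<lambda>t. t" "E i" "nrm i"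
      by unfold_locales (use Cstar[OF i] in \<open>simp add: real_Cstar_algebra_def regular_on_def\<close>)
    show ?thesis
      using Ei.p_star[OF coord_closed[OF i a(1)]] star_homD(5)[OF coord_hom[OF i] a(1)] a(3)[OF i]
      by (simp add: coord_seminorm_def)
  qed
  then show "star A a \<in> bounded_elements"
    using a(1) A.star_closed by (auto simp: bounded_elements_def)
  fix b assume "b \<in> bounded_elements"
  then obtain d where b: "b \<in> carrier A" "0 \<le> d" "\<And>i. i \<in> I \<Longrightarrow> coord_seminorm i b \<le> d"
    by (rule bounded_elementsE) (rule that)
  have "coord_seminorm i (a \<oplus> b) \<le> c + d \<and> coord_seminorm i (a \<otimes> b) \<le> c * d" if i: "i \<in> I" for i
  proof
    interpret p: star_seminorm "\<lambda>t. t" A "coord_seminorm i" by (rule coord_seminorm_star_seminorm(1)[OF i])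
    show "coord_seminorm i (a \<oplus> b) \<le> c + d"
      using p.p_triangle[OF a(1) b(1)] a(3)[OF i] b(3)[OF i] by linarith
    show "coord_seminorm i (a \<otimes> b) \<le> c * d"
      using p.p_mult[OF a(1) b(1)] mult_mono[OF a(3)[OF i] b(3)[OF i] a(2) p.p_nonneg[OF b(1)]] by linarith
  qed
  then show "a \<oplus> b \<in> bounded_elements" "a \<otimes> b \<in> bounded_elements"
    using a(1) b(1) by (auto simp: bounded_elements_def)
qed

lemmas bounded_algebra_star_algebra = subalgebra_star_algebra(1)[OF A_alg bounded_elements_subalgebra]
  and BA_minus = subalgebra_star_algebra(3)[OF A_alg bounded_elements_subalgebra]
  and BA_zero = subalgebra_star_algebra(4)[OF A_alg bounded_elements_subalgebra]
  and BA_D = star_subalgebraD[OF bounded_elements_subalgebra]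

lemma BA_coord_hom: "i \<in> I \<Longrightarrow> (\<lambda>a. h a i) \<in> star_hom bounded_algebra (E i)"
  using coord_hom[of i] BA_D(1) by (auto simp: star_hom_def ring_hom_def)

abbreviation coord_pair :: "'i \<Rightarrow> 'a \<times> 'a \<Rightarrow> 'e \<times> 'e"
  where "coord_pair i \<equiv> map_prod (\<lambda>a. h a i) (\<lambda>a. h a i)"

lemma coord_zero: "i \<in> I \<Longrightarrow> h \<zero> i = \<zero>\<^bsub>E i\<^esub>"
  using star_hom_zero[OF A_alg factor_star_algebra coord_hom] by blast

lemma coord_pair_real:
  "i \<in> I \<Longrightarrow> a \<in> carrier A \<Longrightarrow> pair_norm i (coord_pair i (a, \<zero>)) = coord_seminorm i a"
  using pair_norm(2)[OF _ coord_closed] by (simp add: coord_zero coord_seminorm_def)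

lemma sup_norm_upper:
  assumes z: "z \<in> carrier (complexification bounded_algebra)" and i: "i \<in> I"
  shows "pair_norm i (coord_pair i z) \<le> sup_norm z"
  unfolding sup_norm_def
proof (rule cSUP_upper[OF i])
  obtain a b where ab: "z = (a, b)" "a \<in> bounded_elements" "b \<in> bounded_elements"
    using z by auto
  from ab(2) obtain c where a: "a \<in> carrier A" "0 \<le> c" "\<And>i. i \<in> I \<Longrightarrow> coord_seminorm i a \<le> c"
    by (rule bounded_elementsE) (rule that)
  from ab(3) obtain d where b: "b \<in> carrier A" "0 \<le> d" "\<And>i. i \<in> I \<Longrightarrow> coord_seminorm i b \<le> d"
    by (rule bounded_elementsE) (rule that)
  have "pair_norm j (coord_pair j z) \<le> c + d" if j: "j \<in> I" for j
  proof -
    interpret Ej: real_Cstar_pair "E j" "pair_norm j" by (rule pair_norm(1)[OF j])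
    note cl = coord_closed[OF j a(1)] coord_closed[OF j b(1)]
    have "pair_norm j (h a j, h b j) \<le> nrm j (h a j) + nrm j (h b j)"
      using Ej.N_le_sum[OF cl] pair_norm(2)[OF j cl(1)] pair_norm(2)[OF j cl(2)] by simp
    then show ?thesis
      using a(3)[OF j] b(3)[OF j] ab(1) by (simp add: coord_seminorm_def)
  qed
  then show "bdd_above ((\<lambda>i. pair_norm i (coord_pair i z)) ` I)"
    by (intro bdd_aboveI[of _ "c + d"]) auto
qed

lemma sup_norm_least: "(\<And>i. i \<in> I \<Longrightarrow> pair_norm i (coord_pair i z) \<le> c) \<Longrightarrow> sup_norm z \<le> c"
  unfolding sup_norm_def by (rule cSUP_least[OF I_nonempty])

lemma coord_le_sup_norm:
  assumes i: "i \<in> I" and a: "a \<in> bounded_elements"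
  shows "coord_seminorm i a \<le> sup_norm (a, \<zero>)"
  using sup_norm_upper[of "(a, \<zero>)" i] coord_pair_real[OF i BA_D(1)[OF a]] i a BA_zero by simp

lemma sup_norm_real_le:
  assumes a: "a \<in> carrier A" and "\<And>i. i \<in> I \<Longrightarrow> coord_seminorm i a \<le> c"
  shows "sup_norm (a, \<zero>) \<le> c"
  by (rule sup_norm_least) (use assms coord_pair_real in simp)

text \<open>
  The limits of the coordinates form a compatible family because the connecting maps are continuous. The
  coordinatewise convergence is uniform, so it is convergence for the supremum norm.
\<close>

lemma sup_norm_limits:
  assumes s: "\<And>n. s n \<in> bounded_elements"
    and step: "\<And>n. sup_norm (s (Suc n) \<ominus> s n, \<zero>) \<le> (1 / 2) ^ n"
  shows "\<exists>a\<in>bounded_elements. (\<lambda>n. sup_norm (s n \<ominus> a, \<zero>)) \<longlonglongrightarrow> 0"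
proof -
  note sub = subalgebra_star_algebra[OF A_alg bounded_elements_subalgebra]
  have sA: "s n \<in> carrier A" for n using s BA_D(1) by blast
  have "\<exists>l. l \<in> carrier (E i) \<and> (\<forall>n. nrm i (h (s n) i \<ominus>\<^bsub>E i\<^esub> l) \<le> 2 * (1 / 2) ^ n) \<and>
      (\<lambda>n. nrm i (h (s n) i \<ominus>\<^bsub>E i\<^esub> l)) \<longlonglongrightarrow> 0" if i: "i \<in> I" for i
  proof -
    interpret Ei: banach_star_algebra "\<lambda>t. t" "E i" "nrm i" by (rule banach[OF i])
    have "nrm i (h (s (Suc n)) i \<ominus>\<^bsub>E i\<^esub> h (s n) i) \<le> 1 * (1 / 2) ^ n" for n
      using coord_le_sup_norm[OF i sub(6)[OF s s], of "Suc n" n] step[of n] coord_seminorm_minus[OF i sA sA, of "Suc n" n]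
      by simp
    note lim = Ei.Cauchy_limit[of "\<lambda>n. h (s n) i", OF coord_closed[OF i sA] _ _ this]
    show ?thesis by (rule lim) (auto simp: field_simps)
  qed
  then obtain l where l: "\<And>i. i \<in> I \<Longrightarrow> l i \<in> carrier (E i)"
    "\<And>i n. i \<in> I \<Longrightarrow> nrm i (h (s n) i \<ominus>\<^bsub>E i\<^esub> l i) \<le> 2 * (1 / 2) ^ n"
    "\<And>i. i \<in> I \<Longrightarrow> (\<lambda>n. nrm i (h (s n) i \<ominus>\<^bsub>E i\<^esub> l i)) \<longlonglongrightarrow> 0"
    by metis
  obtain a where a: "a \<in> carrier A" "\<And>i. i \<in> I \<Longrightarrow> h a i = l i"
  proof (rule compatible_family_lifts[OF l(1)])
    fix i j assume ij: "i \<in> I" "j \<in> I" "below i j"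
    interpret Ei: banach_star_algebra "\<lambda>t. t" "E i" "nrm i" by (rule banach[OF ij(1)])
    interpret Ej: banach_star_algebra "\<lambda>t. t" "E j" "nrm j" by (rule banach[OF ij(2)])
    note gh = hom[OF ij]
    obtain c where c: "0 \<le> c" "\<And>x. x \<in> carrier (E j) \<Longrightarrow> nrm i (g i j x) \<le> c * nrm j x"
      by (rule continuous_star_hom_bounded[OF banach[OF ij(2)] banach[OF ij(1)] gh cont[OF ij]]) (rule that)
    have gl: "g i j (l j) \<in> carrier (E i)" using star_homD(1)[OF gh l(1)[OF ij(2)]] .
    have "nrm i (h (s n) i \<ominus>\<^bsub>E i\<^esub> g i j (l j)) \<le> c * nrm j (h (s n) j \<ominus>\<^bsub>E j\<^esub> l j)" for n
      using c(2)[of "h (s n) j \<ominus>\<^bsub>E j\<^esub> l j"] coord_closed[OF ij(2) sA[of n]] l(1)[OF ij(2)]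
        coord_compatible[OF ij sA[of n]] star_hom_minus[OF factor_star_algebra[OF ij(2)] factor_star_algebra[OF ij(1)] gh, of "h (s n) j" "l j"] by simp
    then have "(\<lambda>n. nrm i (h (s n) i \<ominus>\<^bsub>E i\<^esub> g i j (l j))) \<longlonglongrightarrow> 0"
      using coord_closed[OF ij(1) sA] gl Ei.nrm_nonneg
      by (intro real_tendsto_sandwich[OF _ _ tendsto_const tendsto_mult_right_zero[OF l(3)[OF ij(2)], of c]])
        (simp_all add: always_eventually)
    then show "l i = g i j (l j)"
      using Ei.limit_unique[OF coord_closed[OF ij(1) sA] l(1)[OF ij(1)] gl l(3)[OF ij(1)]] by simp
  qed (assumption, rule that)
  have near: "coord_seminorm i (s n \<ominus> a) \<le> 2 * (1 / 2) ^ n" if i: "i \<in> I" for i n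
    using coord_seminorm_minus[OF i sA a(1)] a(2)[OF i] l(2)[OF i] by simp
  obtain c where c: "\<And>i. i \<in> I \<Longrightarrow> coord_seminorm i (s 0) \<le> c"
    using s[of 0] by (rule bounded_elementsE) (rule that)
  have "coord_seminorm i a \<le> 2 + c" if i: "i \<in> I" for i
  proof -
    interpret p: star_seminorm "\<lambda>t. t" A "coord_seminorm i" by (rule coord_seminorm_star_seminorm(1)[OF i])
    show ?thesis
      using p.p_le_dist[OF a(1) sA[of 0]] p.p_sym[OF a(1) sA[of 0]] near[OF i, of 0] c[OF i] by simp
  qed
  then have aB: "a \<in> bounded_elements" using a(1) by (auto simp: bounded_elements_def)
  have "sup_norm (s n \<ominus> a, \<zero>) \<le> 2 * (1 / 2) ^ n" for n
    using near sA a(1) by (intro sup_norm_real_le) simp_all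
  moreover have "0 \<le> sup_norm (s n \<ominus> a, \<zero>)" for n
  proof -
    obtain i where i: "i \<in> I" using I_nonempty by blast
    show ?thesis
      using coord_le_sup_norm[OF i sub(6)[OF s aB], of n] coord_seminorm_nonneg[OF i, of "s n \<ominus> a"] sA a(1)
      by fastforce
  qed
  moreover have lim: "(\<lambda>n. 2 * (1 / 2 :: real) ^ n) \<longlonglongrightarrow> 0"
    by (intro tendsto_mult_right_zero LIMSEQ_power_zero) simp
  ultimately have "(\<lambda>n. sup_norm (s n \<ominus> a, \<zero>)) \<longlonglongrightarrow> 0"
    by (intro real_tendsto_sandwich[OF _ _ tendsto_const lim]) (simp_all add: always_eventually)
  with aB show ?thesis by blast
qed

lemma bounded_elements_Cstar: "real_Cstar_pair bounded_algebra sup_norm"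
proof (rule real_Cstar_pairI[OF bounded_algebra_star_algebra])
  let ?C = "complexification bounded_algebra"
  interpret C: star_algebra cnj ?C by (rule complexification_star_algebra[OF bounded_algebra_star_algebra])
  note hom = complexification_map_hom[OF bounded_algebra_star_algebra factor_star_algebra BA_coord_hom]
  have nonneg: "0 \<le> sup_norm z" if z: "z \<in> carrier ?C" for z
  proof -
    obtain i where i: "i \<in> I" using I_nonempty by blast
    interpret Ei: real_Cstar_pair "E i" "pair_norm i" by (rule pair_norm(1)[OF i])
    show ?thesis
      using Ei.C.nrm_nonneg[OF hom(1)[OF i i z z]] sup_norm_upper[OF z i] by simp
  qed
  fix z assume z: "z \<in> carrier ?C"
  show "0 \<le> sup_norm z" by (rule nonneg[OF z])
  show "sup_norm (k \<odot>\<^bsub>?C\<^esub> z) = cmod k * sup_norm z" for k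
  proof (rule homogeneous_of_le[OF C.star_algebra_axioms z])
    fix k w assume w: "w \<in> carrier ?C"
    show "0 \<le> sup_norm w" by (rule nonneg[OF w])
    show "sup_norm (k \<odot>\<^bsub>?C\<^esub> w) \<le> cmod k * sup_norm w"
    proof (rule sup_norm_least)
      fix i assume i: "i \<in> I"
      interpret Ei: real_Cstar_pair "E i" "pair_norm i" by (rule pair_norm(1)[OF i])
      show "pair_norm i (coord_pair i (k \<odot>\<^bsub>?C\<^esub> w)) \<le> cmod k * sup_norm w"
        using hom(4)[OF i i w w] Ei.C.nrm_smult[OF hom(1)[OF i i w w]] sup_norm_upper[OF w i]
        by (simp add: mult_left_mono)
    qed
  qed
  show "sup_norm (star ?C z \<otimes>\<^bsub>?C\<^esub> z) = (sup_norm z)\<^sup>2"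
  proof -
    let ?zz = "star ?C z \<otimes>\<^bsub>?C\<^esub> z"
    have zz: "?zz \<in> carrier ?C" using z C.star_closed by blast
    have eq: "pair_norm i (coord_pair i ?zz) = (pair_norm i (coord_pair i z))\<^sup>2"
      and pos: "0 \<le> pair_norm i (coord_pair i z)" if i: "i \<in> I" for i
    proof -
      interpret Ei: real_Cstar_pair "E i" "pair_norm i" by (rule pair_norm(1)[OF i])
      show "pair_norm i (coord_pair i ?zz) = (pair_norm i (coord_pair i z))\<^sup>2"
        using hom(3)[OF i i C.star_closed[OF z] z] hom(5)[OF i i z z] Ei.C.p_regular[OF hom(1)[OF i i z z]] by simp
      show "0 \<le> pair_norm i (coord_pair i z)" by (rule Ei.C.nrm_nonneg[OF hom(1)[OF i i z z]])
    qed
    have "sup_norm ?zz \<le> (sup_norm z)\<^sup>2"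
      by (rule sup_norm_least) (use eq pos sup_norm_upper[OF z] in \<open>simp add: power_mono\<close>)
    moreover have "sup_norm z \<le> sqrt (sup_norm ?zz)"
    proof (rule sup_norm_least)
      fix i assume i: "i \<in> I"
      have "(pair_norm i (coord_pair i z))\<^sup>2 \<le> sup_norm ?zz"
        using sup_norm_upper[OF zz i] eq[OF i] by simp
      then show "pair_norm i (coord_pair i z) \<le> sqrt (sup_norm ?zz)" by (rule real_le_rsqrt)
    qed
    then have "(sup_norm z)\<^sup>2 \<le> (sqrt (sup_norm ?zz))\<^sup>2"
      using nonneg[OF z] by (rule power_mono)
    then have "(sup_norm z)\<^sup>2 \<le> sup_norm ?zz" using nonneg[OF zz] by simp
    ultimately show ?thesis by simp
  qed
  show "sup_norm (cx_conj bounded_algebra z) = sup_norm z"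
    unfolding sup_norm_def
  proof (rule SUP_cong[OF refl])
    fix i assume i: "i \<in> I"
    interpret Ei: real_Cstar_pair "E i" "pair_norm i" by (rule pair_norm(1)[OF i])
    obtain x y where xy: "coord_pair i z = (x, y)" "x \<in> carrier (E i)" "y \<in> carrier (E i)"
      using hom(1)[OF i i z z] by auto
    show "pair_norm i (coord_pair i (cx_conj bounded_algebra z)) = pair_norm i (coord_pair i z)"
      using hom(6)[OF i i z z] Ei.N_conj[OF xy(2,3)] xy(1) by (simp add: cx_conj_def)
  qed
  fix w assume w: "w \<in> carrier ?C"
  show "sup_norm (z \<oplus>\<^bsub>?C\<^esub> w) \<le> sup_norm z + sup_norm w"
  proof (rule sup_norm_least)
    fix i assume i: "i \<in> I"
    interpret Ei: real_Cstar_pair "E i" "pair_norm i" by (rule pair_norm(1)[OF i])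
    show "pair_norm i (coord_pair i (z \<oplus>\<^bsub>?C\<^esub> w)) \<le> sup_norm z + sup_norm w"
      using hom(2)[OF i i z w] Ei.C.nrm_triangle[OF hom(1)[OF i i z z] hom(1)[OF i i w w]]
        sup_norm_upper[OF z i] sup_norm_upper[OF w i] by simp
  qed
  show "sup_norm (z \<otimes>\<^bsub>?C\<^esub> w) \<le> sup_norm z * sup_norm w"
  proof (rule sup_norm_least)
    fix i assume i: "i \<in> I"
    interpret Ei: real_Cstar_pair "E i" "pair_norm i" by (rule pair_norm(1)[OF i])
    note cl = hom(1)[OF i i z z] hom(1)[OF i i w w]
    have "pair_norm i (coord_pair i (z \<otimes>\<^bsub>?C\<^esub> w)) \<le> pair_norm i (coord_pair i z) * pair_norm i (coord_pair i w)"
      using hom(3)[OF i i z w] Ei.C.nrm_mult[OF cl] by simp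
    also have "\<dots> \<le> sup_norm z * sup_norm w"
      using sup_norm_upper[OF z i] sup_norm_upper[OF w i] nonneg[OF z] Ei.C.nrm_nonneg[OF cl(2)] by (rule mult_mono)
    finally show "pair_norm i (coord_pair i (z \<otimes>\<^bsub>?C\<^esub> w)) \<le> sup_norm z * sup_norm w" .
  qed
next
  fix x assume x: "x \<in> carrier bounded_algebra" "sup_norm (x, \<zero>\<^bsub>bounded_algebra\<^esub>) = 0"
  then have xB: "x \<in> bounded_elements" by simp
  show "x = \<zero>\<^bsub>bounded_algebra\<^esub>"
    using coord_seminorm_separating[OF BA_D(1)[OF xB]] coord_le_sup_norm[OF _ xB] x(2)
      coord_seminorm_nonneg[OF _ BA_D(1)[OF xB]] by (simp add: order_antisym)
next
  fix s assume s: "\<And>n. s n \<in> carrier bounded_algebra" "\<And>n. sup_norm (s (Suc n) \<ominus>\<^bsub>bounded_algebra\<^esub> s n, \<zero>\<^bsub>bounded_algebra\<^esub>) \<le> (1 / 2) ^ n"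
  have sB: "s n \<in> bounded_elements" for n using s(1)[of n] by simp
  have "\<exists>a\<in>bounded_elements. (\<lambda>n. sup_norm (s n \<ominus> a, \<zero>)) \<longlonglongrightarrow> 0"
    by (rule sup_norm_limits[OF sB]) (use s(2) BA_minus[OF sB sB] in simp)
  then obtain a where a: "a \<in> bounded_elements" "(\<lambda>n. sup_norm (s n \<ominus> a, \<zero>)) \<longlonglongrightarrow> 0" by blast
  show "\<exists>l\<in>carrier bounded_algebra. (\<lambda>n. sup_norm (s n \<ominus>\<^bsub>bounded_algebra\<^esub> l, \<zero>\<^bsub>bounded_algebra\<^esub>)) \<longlonglongrightarrow> 0"
    using a BA_minus[OF sB a(1)] by (intro bexI[of _ a]) simp_all
qed

text \<open>
  The inverses of \<open>1 + w\<^sup>2\<close>, where \<open>w = t a*a\<close>, exist in every factor. By uniqueness of inverses they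
  form a compatible family, hence an inverse \<open>k'\<close> in \<open>A\<close>. The bound of \<open>a k'\<close> is the same in all
  coordinates, and \<open>a k'\<close> is near \<open>a\<close> in the given coordinate when \<open>t\<close> is small.
\<close>

lemma bounded_elements_dense:
  assumes a: "a \<in> carrier A" and j: "j \<in> I" and "0 < r"
  obtains b where "b \<in> bounded_elements" "coord_seminorm j (b \<ominus> a) < r"
proof -
  define M where "M = coord_seminorm j a ^ 5"
  have M: "0 \<le> M" using coord_seminorm_nonneg[OF j a] by (simp add: M_def)
  \<comment> \<open>As \<open>t \<le> 1\<close>, the error \<open>t\<^sup>2 M\<close> is at most \<open>t M\<close>.\<close>
  define t where "t = min 1 (r / (M + 1))"
  have t: "0 < t" "t\<^sup>2 * M < r"
  proof -
    show "0 < t" using M \<open>0 < r\<close> by (simp add: t_def)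
    have "t * t \<le> 1 * t" using \<open>0 < t\<close> by (intro mult_right_mono) (auto simp: t_def)
    then have "t\<^sup>2 * M \<le> t * M" using M by (simp add: power2_eq_square mult_right_mono)
    also have "\<dots> \<le> r / (M + 1) * M" using M by (intro mult_right_mono) (simp_all add: t_def)
    also have "\<dots> < r" using M \<open>0 < r\<close> by (simp add: field_simps)
    finally show "t\<^sup>2 * M < r" .
  qed
  define w where "w = t \<odot> (star A a \<otimes> a)"
  have w: "w \<in> carrier A" "star A w = w"
    using a by (simp_all add: w_def A.star_mult A.star_star A.star_smult A.alg_closed)
  let ?g = "\<lambda>i. \<one>\<^bsub>E i\<^esub> \<oplus>\<^bsub>E i\<^esub> h w i \<otimes>\<^bsub>E i\<^esub> h w i"
  have gA: "h (\<one> \<oplus> w \<otimes> w) i = ?g i" if i: "i \<in> I" for i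
    using star_homD[OF coord_hom[OF i]] w(1) by simp
  have "\<exists>k. k \<in> carrier (E i) \<and> k \<otimes>\<^bsub>E i\<^esub> ?g i = \<one>\<^bsub>E i\<^esub> \<and> ?g i \<otimes>\<^bsub>E i\<^esub> k = \<one>\<^bsub>E i\<^esub>" if i: "i \<in> I" for i
  proof -
    interpret Ei: real_Cstar_pair "E i" "pair_norm i" by (rule pair_norm(1)[OF i])
    have "star (E i) (h w i) = h w i"
      using star_homD(5)[OF coord_hom[OF i] w(1)] w(2) by simp
    from Ei.inverse_one_plus_square[OF coord_closed[OF i w(1)] this] show ?thesis by blast
  qed
  then obtain k where k: "\<And>i. i \<in> I \<Longrightarrow> k i \<in> carrier (E i)"
    "\<And>i. i \<in> I \<Longrightarrow> k i \<otimes>\<^bsub>E i\<^esub> ?g i = \<one>\<^bsub>E i\<^esub>" "\<And>i. i \<in> I \<Longrightarrow> ?g i \<otimes>\<^bsub>E i\<^esub> k i = \<one>\<^bsub>E i\<^esub>"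
    by metis
  obtain k' where k': "k' \<in> carrier A" "\<And>i. i \<in> I \<Longrightarrow> h k' i = k i"
  proof (rule compatible_family_lifts[OF k(1)])
    fix i l assume il: "i \<in> I" "l \<in> I" "below i l"
    interpret Ei: star_algebra "\<lambda>t. t" "E i" by (rule factor_star_algebra[OF il(1)])
    interpret El: star_algebra "\<lambda>t. t" "E l" by (rule factor_star_algebra[OF il(2)])
    note gh = star_homD[OF hom[OF il]]
    have gg: "g i l (?g l) = ?g i"
      using coord_compatible[OF il, of "\<one> \<oplus> w \<otimes> w"] w(1) gA[OF il(1)] gA[OF il(2)] by simp
    have gl: "?g l \<in> carrier (E l)" "?g i \<in> carrier (E i)"
      using coord_closed[OF il(2) w(1)] coord_closed[OF il(1) w(1)] by simp_all
    have "g i l (k l) \<otimes>\<^bsub>E i\<^esub> ?g i = \<one>\<^bsub>E i\<^esub>"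
      using gh(3)[OF k(1)[OF il(2)] gl(1)] k(2)[OF il(2)] gh(6) gg by simp
    then show "k i = g i l (k l)"
      using Ei.inv_unique[OF _ k(3)[OF il(1)] gl(2) gh(1)[OF k(1)[OF il(2)]] k(1)[OF il(1)]] by simp
  qed (assumption, rule that)
  let ?b = "a \<otimes> k'"
  have bA: "?b \<in> carrier A" using a k' by simp
  have est: "(coord_seminorm i ?b)\<^sup>2 \<le> 2 / t" "coord_seminorm i (a \<ominus> ?b) \<le> t\<^sup>2 * coord_seminorm i a ^ 5"
    if i: "i \<in> I" for i
  proof -
    interpret Ei: real_Cstar_pair "E i" "pair_norm i" by (rule pair_norm(1)[OF i])
    note cl = coord_closed[OF i a]
    have hw: "h w i = t \<odot>\<^bsub>E i\<^esub> (star (E i) (h a i) \<otimes>\<^bsub>E i\<^esub> h a i)"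
      using star_homD[OF coord_hom[OF i]] a by (simp add: w_def A.alg_closed)
    have hb: "h ?b i = h a i \<otimes>\<^bsub>E i\<^esub> k i"
      using star_homD(3)[OF coord_hom[OF i] a k'(1)] k'(2)[OF i] by simp
    note approx = Ei.bounded_approximant[OF cl t(1) hw k(1)[OF i] k(2)[OF i] k(3)[OF i]]
    show "(coord_seminorm i ?b)\<^sup>2 \<le> 2 / t"
      using approx(1) pair_norm(2)[OF i] cl k(1)[OF i] by (simp add: coord_seminorm_def hb)
    show "coord_seminorm i (a \<ominus> ?b) \<le> t\<^sup>2 * coord_seminorm i a ^ 5"
      using approx(2) pair_norm(2)[OF i] cl k(1)[OF i]
      by (simp only: coord_seminorm_minus[OF i a bA] hb) (simp add: coord_seminorm_def)
  qed
  have "coord_seminorm i ?b \<le> sqrt (2 / t)" if "i \<in> I" for i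
    using est(1)[OF that] by (rule real_le_rsqrt)
  then have "?b \<in> bounded_elements" using bA by (auto simp: bounded_elements_def)
  moreover have "coord_seminorm j (?b \<ominus> a) < r"
  proof -
    interpret p: star_seminorm "\<lambda>t. t" A "coord_seminorm j" by (rule coord_seminorm_star_seminorm(1)[OF j])
    show ?thesis using est(2)[OF j] t(2) p.p_sym[OF a bA] by (simp add: M_def)
  qed
  ultimately show thesis by (rule that)
qed

theorem dense_subalgebra_exists: "dense_Cstar_subalgebra A T bounded_elements (\<lambda>a. sup_norm (a, \<zero>))"
proof -
  let ?n = "\<lambda>a. sup_norm (a, \<zero>)"
  interpret B: real_Cstar_pair bounded_algebra sup_norm by (rule bounded_elements_Cstar)
  have Cst: "real_Cstar_algebra bounded_algebra ?n" using B.real_Cstar_algebra by simp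
  interpret n: banach_star_algebra "\<lambda>t. t" bounded_algebra ?n by (rule real_Cstar_imp_banach[OF Cst])
  have "continuous_map (norm_topology bounded_algebra ?n) T (\<lambda>x. x)"
    unfolding continuous_map_def
  proof (intro conjI allI impI)
    fix U assume U: "openin T U"
    show "openin (norm_topology bounded_algebra ?n) {x \<in> topspace (norm_topology bounded_algebra ?n). x \<in> U}"
      unfolding n.openin_norm_topology
    proof (intro conjI ballI)
      fix x assume "x \<in> {x \<in> topspace (norm_topology bounded_algebra ?n). x \<in> U}"
      then have x: "x \<in> bounded_elements" "x \<in> U" by simp_all
      from U[unfolded openin_T, THEN conjunct2, THEN bspec, OF x(2)]
      obtain i r where i: "i \<in> I" "0 < r" "\<forall>b\<in>carrier A. coord_seminorm i (b \<ominus> x) < r \<longrightarrow> b \<in> U"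
        by (elim exE conjE bexE) (rule that)
      have "y \<in> U" if y: "y \<in> bounded_elements" "?n (y \<ominus>\<^bsub>bounded_algebra\<^esub> x) < r" for y
      proof -
        have "coord_seminorm i (y \<ominus> x) < r"
          using coord_le_sup_norm[OF i(1) subalgebra_star_algebra(6)[OF A_alg bounded_elements_subalgebra y(1) x(1)]]
            y(2) BA_minus[OF y(1) x(1)] by simp
        then show ?thesis using i(3)[THEN bspec, of y] BA_D(1)[OF y(1)] by simp
      qed
      then show "\<exists>r>0. \<forall>y\<in>carrier bounded_algebra. ?n (y \<ominus>\<^bsub>bounded_algebra\<^esub> x) < r \<longrightarrow> y \<in> {x \<in> topspace (norm_topology bounded_algebra ?n). x \<in> U}"
        using i(2) by (intro exI[of _ r]) simp
    qed auto
  qed (use BA_D(1) in \<open>auto simp: topspace_T\<close>)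
  moreover have "T closure_of bounded_elements = topspace T"
  proof (intro equalityI subsetI)
    fix a assume "a \<in> topspace T"
    then have a: "a \<in> carrier A" by (simp add: topspace_T)
    show "a \<in> T closure_of bounded_elements"
      unfolding in_closure_of
    proof (intro conjI allI impI)
      fix U assume U: "a \<in> U \<and> openin T U"
      from U[THEN conjunct2, unfolded openin_T, THEN conjunct2, THEN bspec, OF U[THEN conjunct1]]
      obtain i r where i: "i \<in> I" "0 < r" "\<forall>b\<in>carrier A. coord_seminorm i (b \<ominus> a) < r \<longrightarrow> b \<in> U"
        by (elim exE conjE bexE) (rule that)
      obtain b where b: "b \<in> bounded_elements" "coord_seminorm i (b \<ominus> a) < r"
        by (rule bounded_elements_dense[OF a i(1,2)]) (rule that)
      then show "\<exists>y. y \<in> bounded_elements \<and> y \<in> U"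
        using i(3)[THEN bspec, OF BA_D(1)[OF b(1)]] by blast
    qed (use a in \<open>simp add: topspace_T\<close>)
  qed (simp add: closure_of_subset_topspace[THEN subsetD])
  ultimately show ?thesis
    using Cst bounded_elements_subalgebra by (simp add: dense_Cstar_subalgebra_def)
qed

end

section \<open>Regular seminorms and the closed unit ball\<close>

lemma le_of_iterated_squares:
  fixes a b K :: real
  assumes "0 \<le> b" and le: "\<And>j. a ^ (2 ^ j) \<le> K * b ^ (2 ^ j)"
  shows "a \<le> b"
proof (rule ccontr)
  assume "\<not> a \<le> b"
  then have ab: "b < a" "0 < a" using \<open>0 \<le> b\<close> by auto
  have "(\<lambda>j. K * (b / a) ^ (2 ^ j)) \<longlonglongrightarrow> 0"
    using ab \<open>0 \<le> b\<close> by (intro tendsto_mult_right_zero power_power2_tendsto_zero) simp_all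
  then have "\<forall>\<^sub>F j in sequentially. K * (b / a) ^ (2 ^ j) < 1"
    by (rule order_tendstoD) simp
  then obtain j where "K * (b / a) ^ (2 ^ j) < 1"
    by (auto simp: eventually_sequentially)
  then show False
    using le[of j] ab by (simp add: power_divide field_simps)
qed

locale regular_seminorm_family =
  fixes A :: "(real, 'a) star_alg" (structure) and T :: "'a topology" and \<Gamma> :: "('a \<Rightarrow> real) set"
  assumes A_top: "real_topological_star_algebra A T"
    and \<Gamma>: "defining_regular_seminorms A T \<Gamma>"
begin

lemma A_alg: "real_star_algebra A"
  using A_top by (simp add: real_topological_star_algebra_def)

sublocale star_algebra "\<lambda>t. t" A by (rule A_alg)

lemma topspace_T: "topspace T = carrier A"
  using A_top by (simp add: real_topological_star_algebra_def)

lemma regular_seminorm: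
  assumes "p \<in> \<Gamma>"
  shows "regular_seminorm (\<lambda>t. t) A p"
    and "x \<in> carrier A \<Longrightarrow> p (k \<odot> x) = \<bar>k\<bar> * p x"
proof -
  have sub: "submultiplicative_seminorm A p" and reg: "regular_on A p"
    using \<Gamma> assms by (auto simp: defining_regular_seminorms_def)
  show smult: "p (k \<odot> x) = \<bar>k\<bar> * p x" if "x \<in> carrier A" for k x
    using sub that by (simp add: submultiplicative_seminorm_def)
  show "regular_seminorm (\<lambda>t. t) A p"
  proof unfold_locales
    show "p \<zero> = 0" using smult[OF one_closed, of 0] by (simp add: smult_zero_left)
    show "p (\<ominus> x) = p x" if "x \<in> carrier A" for x
      using smult[OF that, of "- 1"] smult_neg_left[OF that, of 1] smult_one[OF that] by simp
  qed (use sub reg in \<open>auto simp: submultiplicative_seminorm_def regular_on_def\<close>)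
qed

lemma openin_ball:
  assumes "p \<in> \<Gamma>" "x \<in> carrier A"
  shows "openin T {y \<in> carrier A. p (y \<ominus> x) < e}"
proof (cases "0 < e")
  case True
  have T: "T = topology_generated_by
      {{y \<in> carrier A. p (y \<ominus> x) < e} | p x e. p \<in> \<Gamma> \<and> x \<in> carrier A \<and> 0 < e}"
    using \<Gamma> unfolding defining_regular_seminorms_def by (elim conjE)
  show ?thesis
    by (subst T, rule topology_generated_by_Basis) (use assms True in blast)
next
  case False
  interpret p: regular_seminorm "\<lambda>t. t" A p by (rule regular_seminorm(1)[OF assms(1)])
  have "\<not> p (y \<ominus> x) < e" if "y \<in> carrier A" for y
    using p.p_nonneg[of "y \<ominus> x"] False that assms(2) by simp
  then have "{y \<in> carrier A. p (y \<ominus> x) < e} = {}" by blast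
  then show ?thesis by (simp only: openin_empty)
qed

lemma max_seminorm:
  assumes "p \<in> \<Gamma>" "q \<in> \<Gamma>"
  obtains m where "m \<in> \<Gamma>" "\<And>x. x \<in> carrier A \<Longrightarrow> m x = max (p x) (q x)"
proof -
  have "saturated (carrier A) \<Gamma>"
    using \<Gamma> by (simp add: defining_regular_seminorms_def)
  then have "\<exists>m\<in>\<Gamma>. \<forall>x\<in>carrier A. m x = (MAX r\<in>{p, q}. r x)"
    unfolding saturated_def using assms by (elim allE[of _ "{p, q}"]) auto
  then show thesis using that by auto
qed

text \<open>
  The basic open sets are balls around arbitrary centres, and maxima of two seminorms belong to the family,
  so a smaller ball around \<open>a\<close> fits into a finite intersection.
\<close>

lemma neighbourhood_ball:
  assumes U: "openin T U" and a: "a \<in> U"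
  obtains p r where "p \<in> \<Gamma>" "0 < r" "\<And>b. b \<in> carrier A \<Longrightarrow> p (b \<ominus> a) < r \<Longrightarrow> b \<in> U"
proof -
  let ?S = "{{y \<in> carrier A. p (y \<ominus> x) < e} | p x e. p \<in> \<Gamma> \<and> x \<in> carrier A \<and> 0 < e}"
  let ?near = "\<lambda>U a. \<exists>p\<in>\<Gamma>. \<exists>r>0. \<forall>b\<in>carrier A. p (b \<ominus> a) < r \<longrightarrow> b \<in> U"
  have "T = topology_generated_by ?S"
    using \<Gamma> unfolding defining_regular_seminorms_def by (elim conjE)
  from U[unfolded this] have "generate_topology_on ?S U"
    by (rule openin_topology_generated_by)
  moreover have "a \<in> carrier A" using openin_subset[OF U] a topspace_T by blast
  ultimately have "?near U a"
    using a
  proof (induction U)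
    case Empty
    then show ?case by simp
  next
    case (Int V W)
    then obtain p r where p: "p \<in> \<Gamma>" "0 < r" "\<forall>b\<in>carrier A. p (b \<ominus> a) < r \<longrightarrow> b \<in> V" by blast
    obtain q s where q: "q \<in> \<Gamma>" "0 < s" "\<forall>b\<in>carrier A. q (b \<ominus> a) < s \<longrightarrow> b \<in> W" using Int by blast
    obtain m where m: "m \<in> \<Gamma>" "\<And>x. x \<in> carrier A \<Longrightarrow> m x = max (p x) (q x)"
      by (rule max_seminorm[OF p(1) q(1)]) (rule that)
    have "b \<in> V \<inter> W" if "b \<in> carrier A" "m (b \<ominus> a) < min r s" for b
      using that m(2)[of "b \<ominus> a"] p(3) q(3) Int.prems(1) by simp
    then show ?case using m(1) p(2) q(2) by (intro bexI[of _ m] exI[of _ "min r s"]) auto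
  next
    case (UN \<K>)
    then obtain V where V: "V \<in> \<K>" "a \<in> V" by blast
    then show ?case using UN.IH[OF V(1) UN.prems(1) V(2)] by blast
  next
    case (Basis V)
    then obtain p x e where V: "V = {y \<in> carrier A. p (y \<ominus> x) < e}" "p \<in> \<Gamma>" "x \<in> carrier A" "0 < e"
      by blast
    interpret p: regular_seminorm "\<lambda>t. t" A p by (rule regular_seminorm(1)[OF V(2)])
    have a: "p (a \<ominus> x) < e" using Basis V(1) by blast
    have "b \<in> V" if "b \<in> carrier A" "p (b \<ominus> a) < e - p (a \<ominus> x)" for b
      using p.p_dist_triangle[OF that(1) Basis.prems(1) V(3)] that V(1) by simp
    then show ?case
      using V(2) a by (intro bexI[of _ p] exI[of _ "e - p (a \<ominus> x)"]) auto
  qed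
  then show thesis using that by blast
qed

text \<open>
  A regular seminorm \<open>p\<close> is bounded on \<open>B\<close> by a multiple of the norm, and the C*-identities on both sides
  remove the constant. Conversely, an element \<open>y\<close> with \<open>p y < 1 / 2\<close> for all \<open>p\<close> is in the closure of
  the unit ball: near \<open>y\<close> for a given \<open>p\<close> there is an element \<open>b\<close> of \<open>B\<close> with \<open>p b < 1\<close>, which has the
  same coset modulo the kernel of \<open>p\<close> as an element of norm at most 1.
\<close>

theorem dense_closed_unit_ball_eq_bounded_part:
  assumes dense: "dense_Cstar_subalgebra A T B n" and closed: "closedin T {x \<in> B. n x \<le> 1}"
  shows "B = bounded_part A \<Gamma>"
proof -
  let ?R = "A\<lparr>carrier := B\<rparr>"
  have B: "star_subalgebra B A" and Cst: "real_Cstar_algebra ?R n"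
    and cont: "continuous_map (norm_topology ?R n) T (\<lambda>x. x)"
    and closure: "T closure_of B = topspace T"
    using dense by (auto simp: dense_Cstar_subalgebra_def)
  note sub = subalgebra_star_algebra[OF A_alg B] and BD = star_subalgebraD[OF B]
  interpret n: banach_star_algebra "\<lambda>t. t" ?R n by (rule real_Cstar_imp_banach[OF Cst])
  interpret n: regular_seminorm "\<lambda>t. t" ?R n
    by unfold_locales (use Cst in \<open>simp add: real_Cstar_algebra_def regular_on_def\<close>)
  obtain N where pair: "real_Cstar_pair ?R N" and N: "\<And>x. x \<in> B \<Longrightarrow> N (x, \<zero>) = n x"
    using real_Cstar_pair_exists[OF Cst] by auto
  have "\<one> \<in> topspace T" by (simp add: topspace_T)
  then have \<Gamma>_nonempty: "\<Gamma> \<noteq> {}"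
    using neighbourhood_ball[OF openin_topspace] by blast
  have dominated: "p b \<le> n b" if p: "p \<in> \<Gamma>" and b: "b \<in> B" for p b
  proof -
    interpret p: regular_seminorm "\<lambda>t. t" A p by (rule regular_seminorm(1)[OF p])
    obtain K where le: "\<And>y. y \<in> B \<Longrightarrow> p y \<le> K * n y"
      by (rule seminorm_bounded_on_subalgebra[OF A_alg B real_Cstar_imp_banach[OF Cst] cont
            p.alg_seminorm_axioms regular_seminorm(2)[OF p] openin_ball[OF p zero_closed]]) (assumption, rule that)
    let ?s = "star A b \<otimes> b"
    have s: "?s \<in> B" "?s \<in> carrier A" "star A ?s = ?s"
      using b BD by (simp_all add: star_mult star_star star_closed)
    have pow_R: "x [^]\<^bsub>?R\<^esub> (m::nat) = x [^] m" for x m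
      by (simp add: nat_pow_def)
    have pow_B: "?s [^] (m::nat) \<in> B" for m
      by (induction m) (use s BD in auto)
    have "p ?s \<le> n ?s"
    proof (rule le_of_iterated_squares)
      show "0 \<le> n ?s" using n.nrm_nonneg[of ?s] s by simp
      fix j
      show "p ?s ^ (2 ^ j) \<le> K * n ?s ^ (2 ^ j)"
        using le[OF pow_B[of "2 ^ j"]] p.p_selfadjoint_pow[OF s(2,3), of j] n.p_selfadjoint_pow[of ?s j] s
        by (simp add: pow_R)
    qed
    then have "(p b)\<^sup>2 \<le> (n b)\<^sup>2"
      using p.p_regular[OF BD(1)[OF b]] n.p_regular[of b] b by simp
    then show ?thesis
      using n.nrm_nonneg[of b] b by (intro power2_le_imp_le[of "p b" "n b"]) simp_all
  qed
  show ?thesis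
  proof (intro equalityI subsetI)
    fix b assume b: "b \<in> B"
    have "(SUP p\<in>\<Gamma>. ereal (p b)) \<le> ereal (n b)"
      using dominated[OF _ b] by (intro SUP_least) simp
    then show "b \<in> bounded_part A \<Gamma>"
      using BD(1)[OF b] by (auto simp: bounded_part_def)
  next
    fix x assume "x \<in> bounded_part A \<Gamma>"
    then have x: "x \<in> carrier A" and fin: "(SUP p\<in>\<Gamma>. ereal (p x)) < \<infinity>"
      by (auto simp: bounded_part_def)
    obtain m :: nat where m: "(SUP p\<in>\<Gamma>. ereal (p x)) < ereal (real m)"
      using less_PInf_Ex_of_nat[THEN iffD1, OF less_imp_neq[OF fin]] by (elim exE) (rule that)
    have px: "p x < real m" if "p \<in> \<Gamma>" for p
      using order.strict_trans1[OF SUP_upper[OF that, of "\<lambda>p. ereal (p x)"] m] by simp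
    define t where "t = 1 / (2 * (real m + 1))"
    have t: "0 < t" "t * real m < 1 / 2" by (simp_all add: t_def field_simps)
    let ?y = "t \<odot> x"
    have y: "?y \<in> carrier A" using x by (simp add: smult_closed)
    have py: "p ?y < 1 / 2" if p: "p \<in> \<Gamma>" for p
    proof -
      have "p ?y = t * p x" using regular_seminorm(2)[OF p x] t by simp
      also have "\<dots> \<le> t * real m" using px[OF p] t by (intro mult_left_mono) auto
      finally show ?thesis using t by simp
    qed
    have "?y \<in> T closure_of {x \<in> B. n x \<le> 1}"
      unfolding in_closure_of
    proof (intro conjI allI impI)
      show "?y \<in> topspace T" using y by (simp add: topspace_T)
      fix U assume U: "?y \<in> U \<and> openin T U"
      obtain p r where p: "p \<in> \<Gamma>" "0 < r" "\<And>b. b \<in> carrier A \<Longrightarrow> p (b \<ominus> ?y) < r \<Longrightarrow> b \<in> U"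
        by (rule neighbourhood_ball[OF conjunct2[OF U] conjunct1[OF U]]) (rule that)
      interpret p: regular_seminorm "\<lambda>t. t" A p by (rule regular_seminorm(1)[OF p(1)])
      interpret R: real_Cstar_pair ?R N by (rule pair)
      interpret Q: real_Cstar_quotient ?R N p 1 1
        by unfold_locales
          (use BD N sub(2) dominated[OF p(1)] p.p_zero p.p_nonneg p.p_neg p.p_triangle p.p_mult p.p_star
            regular_seminorm(2)[OF p(1)] in simp_all)
      let ?e = "min r (1 / 2)"
      let ?V = "{b \<in> carrier A. p (b \<ominus> ?y) < ?e}"
      have y_cl: "?y \<in> T closure_of B" using closure y by (simp add: topspace_T)
      have y_V: "?y \<in> ?V" using y p(2) p.p_minus_self[OF y] by simp
      obtain b where b: "b \<in> B" "b \<in> ?V"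
        by (rule closure_of_meets_open[OF y_cl openin_ball[OF p(1) y] y_V]) (rule that)
      have bA: "b \<in> carrier A" using BD(1)[OF b(1)] .
      have "p b < 1" using p.p_le_dist[OF bA y] py[OF p(1)] b(2) by simp
      then obtain z where z: "z \<in> B" "p (b \<ominus>\<^bsub>?R\<^esub> z) = 0" "N (z, \<zero>\<^bsub>?R\<^esub>) \<le> 1"
        using Q.bounded_representative[of b 1] b(1) by auto
      have zA: "z \<in> carrier A" using BD(1)[OF z(1)] .
      have "p (z \<ominus> ?y) < r"
        using p.p_dist_triangle[OF zA bA y] p.p_sym[OF zA bA] z(2) b sub(3)[OF b(1) z(1)] by simp
      then have "z \<in> U" by (rule p(3)[OF zA])
      moreover have "n z \<le> 1" using z(3) N[OF z(1)] by simp
      ultimately show "\<exists>y. y \<in> {x \<in> B. n x \<le> 1} \<and> y \<in> U" using z(1) by blast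
    qed
    then have "?y \<in> B"
      using closure_of_closedin[OF closed] by auto
    then have "(1 / t) \<odot> ?y \<in> B" by (rule BD(5))
    then show "x \<in> B"
      using smult_assoc[OF x, of "1 / t" t] t smult_one[OF x] by simp
  qed
qed

end

lemma dense_Cstar_subalgebra_imp_locally_Cstar:
  assumes lmc: "complete_real_lmc_star_algebra TYPE('i) TYPE('e) A T"
    and dense: "dense_Cstar_subalgebra A T B nrm"
  shows "real_locally_Cstar_algebra TYPE('a \<Rightarrow> real) TYPE('a set) (A :: (real, 'a) star_alg) T"
proof -
  obtain I :: "'i set" and below and E :: "'i \<Rightarrow> (real, 'e) star_alg" and n g h where
    "real_topological_star_algebra A T" "\<forall>i\<in>I. real_banach_star_algebra (E i) (n i)"
    "projective_family I below E (\<lambda>i. norm_topology (E i) (n i)) g"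
    "h \<in> star_hom A (projective_limit I below E g)"
    "homeomorphic_map T (projective_limit_topology I below E (\<lambda>i. norm_topology (E i) (n i)) g) h"
    using lmc unfolding complete_real_lmc_star_algebra_def top_star_isomorphic_def by blast
  then interpret limit_presentation I below E n g A T h
    by (simp add: limit_presentation_def limit_presentation_axioms_def
        banach_projective_family_def banach_projective_family_axioms_def)
  show ?thesis by (rule dense_imp_locally_Cstar[OF dense])
qed

lemma locally_Cstar_imp_dense_Cstar_subalgebra:
  assumes "real_locally_Cstar_algebra TYPE('j) TYPE('f) A T"
  shows "\<exists>B nrm. dense_Cstar_subalgebra A T B nrm"
proof -
  obtain I :: "'j set" and below and E :: "'j \<Rightarrow> (real, 'f) star_alg" and n g h where
    "real_topological_star_algebra A T" "\<forall>i\<in>I. real_Cstar_algebra (E i) (n i)"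
    "projective_family I below E (\<lambda>i. norm_topology (E i) (n i)) g"
    "h \<in> star_hom A (projective_limit I below E g)"
    "homeomorphic_map T (projective_limit_topology I below E (\<lambda>i. norm_topology (E i) (n i)) g) h"
    using assms unfolding real_locally_Cstar_algebra_def top_star_isomorphic_def by blast
  then interpret Cstar_limit_presentation I below E n g A T h
    by (simp add: Cstar_limit_presentation_def Cstar_limit_presentation_axioms_def
        limit_presentation_def limit_presentation_axioms_def
        banach_projective_family_def banach_projective_family_axioms_def real_Cstar_imp_banach)
  show ?thesis using dense_subalgebra_exists by blast
qed

theorem theorem2:
  fixes A :: "(real, 'a) star_alg" and T :: "'a topology"
  assumes lmc: "complete_real_lmc_star_algebra TYPE('i) TYPE('e) A T"
  shows "(real_locally_Cstar_algebra TYPE('a \<Rightarrow> real) TYPE('a set) A T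
        \<longleftrightarrow> (\<exists>B nrm. dense_Cstar_subalgebra A T B nrm))
    \<and> (real_locally_Cstar_algebra TYPE('j) TYPE('f) A T
        \<longrightarrow> (\<exists>B nrm. dense_Cstar_subalgebra A T B nrm))
    \<and> (\<forall>B nrm \<Gamma>. dense_Cstar_subalgebra A T B nrm \<and> closedin T {x \<in> B. nrm x \<le> 1} \<and>
        defining_regular_seminorms A T \<Gamma> \<longrightarrow> B = bounded_part A \<Gamma>)"
proof (intro conjI allI impI)
  show "real_locally_Cstar_algebra TYPE('a \<Rightarrow> real) TYPE('a set) A T
      \<longleftrightarrow> (\<exists>B nrm. dense_Cstar_subalgebra A T B nrm)"
    using locally_Cstar_imp_dense_Cstar_subalgebra dense_Cstar_subalgebra_imp_locally_Cstar[OF lmc] by blast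
  show "\<exists>B nrm. dense_Cstar_subalgebra A T B nrm"
    if "real_locally_Cstar_algebra TYPE('j) TYPE('f) A T"
    using that by (rule locally_Cstar_imp_dense_Cstar_subalgebra)
next
  fix B nrm \<Gamma>
  assume *: "dense_Cstar_subalgebra A T B nrm \<and> closedin T {x \<in> B. nrm x \<le> 1} \<and>
    defining_regular_seminorms A T \<Gamma>"
  interpret regular_seminorm_family A T \<Gamma>
    using lmc * by unfold_locales (simp_all add: complete_real_lmc_star_algebra_def)
  show "B = bounded_part A \<Gamma>"
    using * dense_closed_unit_ball_eq_bounded_part[of B nrm] by simp
qed

end
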